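(* Let $m$ be a positive integer, $p$ a prime number with $p\ge3$, and $\alpha$ a positive integer. Let $F_m^{(4)}(z)=1+\sum_{\lambda\ge1}f_\lambda^{(4)}(m)z^\lambda$. Then $F_m^{(4)}(z)$, when its coefficients are reduced modulo $p^\alpha$, can be represented as a rational function, i.e. there exist $P(z),Q(z)\in\mathbb{Z}[z]$ with $Q(0)=1$ such that $Q(z)F_m^{(4)}(z)\equiv P(z)$ coefficientwise modulo $p^\alpha$. Equivalently, the sequence $(f_\lambda^{(4)}(m))_{\lambda\ge1}$ is ultimately periodic modulo $p^\alpha$.
   Context: For a positive integer $m$, let $\Gamma_m(4)=C_{2m}*_{C_m}C_{4m}=\langle x,y\mid x^{2m}=y^{4m}=1,\ x^2=y^4\rangle$ (for $m=1$ this is the Hecke group $C_2*C_4$). For $\lambda\ge1$, $f_\lambda^{(4)}(m)$ is the number of free subgroups of index $4m\lambda$ in $\Gamma_m(4)$. *)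

theory Defs
  imports
    "HOL-Algebra.Coset"
    "HOL-Computational_Algebra.Polynomial_FPS"
    "HOL-Number_Theory.Cong"
begin

text \<open>
  A letter \<open>(a, True)\<close> stands for the generator \<open>a\<close>, a letter \<open>(a, False)\<close> for its formal inverse.
\<close>

type_synonym 'a word = "('a \<times> bool) list"

definition words :: "'a set \<Rightarrow> 'a word set" where
  "words S = lists (S \<times> UNIV)"

inductive_set pres_rel :: "'a set \<Rightarrow> ('a word \<times> 'a word) set \<Rightarrow> ('a word \<times> 'a word) set"
  for S :: "'a set" and R :: "('a word \<times> 'a word) set" where
  refl: "u \<in> words S \<Longrightarrow> (u, u) \<in> pres_rel S R"
| sym: "(u, v) \<in> pres_rel S R \<Longrightarrow> (v, u) \<in> pres_rel S R"
| trans: "(u, v) \<in> pres_rel S R \<Longrightarrow> (v, w) \<in> pres_rel S R \<Longrightarrow> (u, w) \<in> pres_rel S R"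
| cancel: "u \<in> words S \<Longrightarrow> v \<in> words S \<Longrightarrow> a \<in> S
    \<Longrightarrow> (u @ [(a, e), (a, \<not> e)] @ v, u @ v) \<in> pres_rel S R"
| relation: "u \<in> words S \<Longrightarrow> v \<in> words S \<Longrightarrow> (r, s) \<in> R \<Longrightarrow> r \<in> words S \<Longrightarrow> s \<in> words S
    \<Longrightarrow> (u @ r @ v, u @ s @ v) \<in> pres_rel S R"

text \<open>
  The group \<open>\<langle>S | r = s for (r, s) \<in> R\<rangle>\<close>. Its elements are classes of words; the product is the
  class of the concatenation (see \<open>presented_group_mult\<close>).
\<close>

definition presented_group :: "'a set \<Rightarrow> ('a word \<times> 'a word) set \<Rightarrow> 'a word set monoid" where
  "presented_group S R =
    \<lparr>carrier = words S // pres_rel S R,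
     monoid.mult = (\<lambda>A B. {w. \<exists>u\<in>A. \<exists>v\<in>B. (u @ v, w) \<in> pres_rel S R}),
     monoid.one = pres_rel S R `` {[]}\<rparr>"

definition free_group :: "'a set \<Rightarrow> 'a word set monoid" where
  "free_group S = presented_group S {}"

text \<open>
  A basis of \<open>G\<close> is a subset of its carrier, so it is no restriction to let \<open>S\<close> range over sets of
  the element type of \<open>G\<close>. The trivial group is free (\<open>S = {}\<close>).
\<close>

definition is_free :: "('a, 'b) monoid_scheme \<Rightarrow> bool" where
  "is_free G \<longleftrightarrow> group G \<and> (\<exists>S :: 'a set. G \<cong> free_group S)"

datatype gen = X | Y

definition gen_pow :: "gen \<Rightarrow> nat \<Rightarrow> gen word" where
  "gen_pow g k = replicate k (g, True)"

definition Gamma4 :: "nat \<Rightarrow> gen word set monoid" where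
  "Gamma4 m = presented_group {X, Y}
     {(gen_pow X (2 * m), []), (gen_pow Y (4 * m), []), (gen_pow X 2, gen_pow Y 4)}"

text \<open>
  For \<open>m, l \<ge> 1\<close> the prescribed number of cosets is positive, so that \<open>card\<close> does force the index
  to be finite. The value at \<open>l = 0\<close> is meaningless.
\<close>

definition free_subgroup_number :: "nat \<Rightarrow> nat \<Rightarrow> nat" where
  "free_subgroup_number m l =
    card {H. subgroup H (Gamma4 m) \<and> card (rcosets\<^bsub>Gamma4 m\<^esub> H) = 4 * m * l
             \<and> is_free (Gamma4 m\<lparr>carrier := H\<rparr>)}"

definition free_subgroup_series :: "nat \<Rightarrow> int fps" where
  "free_subgroup_series m = Abs_fps (\<lambda>l. if l = 0 then 1 else int (free_subgroup_number m l))"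


lemma words_append [simp]: "u @ v \<in> words S \<longleftrightarrow> u \<in> words S \<and> v \<in> words S"
  by (auto simp: words_def)

lemma words_Nil [simp]: "[] \<in> words S"
  by (simp add: words_def)

lemma pres_rel_words: "(u, v) \<in> pres_rel S R \<Longrightarrow> u \<in> words S \<and> v \<in> words S"
  by (induction rule: pres_rel.induct) (auto simp: words_def)

lemma equiv_pres_rel: "equiv (words S) (pres_rel S R)"
  by (intro equivI refl_onI symI transI)
     (auto intro: pres_rel.refl pres_rel.sym pres_rel.trans dest: pres_rel_words)

lemma pres_rel_context:
  assumes "(u, v) \<in> pres_rel S R" "a \<in> words S" "b \<in> words S"
  shows "(a @ u @ b, a @ v @ b) \<in> pres_rel S R"
  using assms
proof (induction rule: pres_rel.induct)
  case (cancel u v c e)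
  then show ?case using pres_rel.cancel[of "a @ u" S "v @ b" c e R] by simp
next
  case (relation u v r s)
  then show ?case using pres_rel.relation[of "a @ u" S "v @ b" r s R] by simp
qed (auto intro: pres_rel.refl pres_rel.sym pres_rel.trans)

lemma pres_rel_append:
  assumes "(u, u') \<in> pres_rel S R" "(v, v') \<in> pres_rel S R"
  shows "(u @ v, u' @ v') \<in> pres_rel S R"
proof -
  have "(u @ v, u' @ v) \<in> pres_rel S R"
    using pres_rel_context[OF assms(1), of "[]" v] pres_rel_words[OF assms(2)] by simp
  moreover have "(u' @ v, u' @ v') \<in> pres_rel S R"
    using pres_rel_context[OF assms(2), of u' "[]"] pres_rel_words[OF assms(1)] by simp
  ultimately show ?thesis by (rule pres_rel.trans)
qed

lemma presented_group_mult:
  assumes "u \<in> words S" "v \<in> words S"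
  shows "(pres_rel S R `` {u}) \<otimes>\<^bsub>presented_group S R\<^esub> (pres_rel S R `` {v})
          = pres_rel S R `` {u @ v}"
  using assms
  by (auto simp: presented_group_def
      intro: pres_rel.refl pres_rel.trans pres_rel.sym pres_rel_append)

lemma inverse_word:
  assumes "u \<in> words S"
  shows "\<exists>v\<in>words S. (v @ u, []) \<in> pres_rel S R"
  using assms
proof (induction u)
  case Nil
  then show ?case by (auto intro!: bexI[of _ "[]"] pres_rel.refl)
next
  case (Cons x u)
  obtain a e where x: "x = (a, e)" by force
  from Cons.prems have a: "a \<in> S" and u: "u \<in> words S" by (auto simp: words_def x)
  from Cons.IH[OF u] obtain v where v: "v \<in> words S" "(v @ u, []) \<in> pres_rel S R" by blast
  have "(v @ [(a, \<not> e), (a, e)] @ u, v @ u) \<in> pres_rel S R"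
    using pres_rel.cancel[OF v(1) u a, of "\<not> e" R] by simp
  then have "((v @ [(a, \<not> e)]) @ x # u, []) \<in> pres_rel S R"
    using v(2) by (auto simp: x intro: pres_rel.trans)
  moreover have "v @ [(a, \<not> e)] \<in> words S" using v(1) a by (auto simp: words_def)
  ultimately show ?case by blast
qed

lemma group_presented_group: "group (presented_group S R)"
proof -
  let ?G = "presented_group S R" and ?c = "\<lambda>u. pres_rel S R `` {u}"
  have carr: "carrier ?G = ?c ` words S"
    by (auto simp: presented_group_def quotient_def)
  have one: "\<one>\<^bsub>?G\<^esub> = ?c []" by (simp add: presented_group_def)
  show ?thesis
  proof (rule groupI)
    fix A assume "A \<in> carrier ?G"
    then obtain u where u: "u \<in> words S" "A = ?c u" by (auto simp: carr)
    obtain v where v: "v \<in> words S" "(v @ u, []) \<in> pres_rel S R" using inverse_word[OF u(1)] by blast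
    have "?c v \<otimes>\<^bsub>?G\<^esub> A = \<one>\<^bsub>?G\<^esub>"
      using u v by (simp add: presented_group_mult one equiv_class_eq[OF equiv_pres_rel])
    then show "\<exists>B\<in>carrier ?G. B \<otimes>\<^bsub>?G\<^esub> A = \<one>\<^bsub>?G\<^esub>" using v(1) by (auto simp: carr)
  qed (auto simp: carr one presented_group_mult)
qed

lemma group_Gamma4: "group (Gamma4 m)"
  unfolding Gamma4_def by (rule group_presented_group)

end

theory Submission
  imports Defs "HOL-Combinatorics.Permutations"
begin

text \<open>
  A subgroup of finite index in \<open>\<Gamma>\<close> is free iff \<open>x\<close> and \<open>y\<close> act on its cosets with all cycles of length
  \<open>2m\<close> and \<open>4m\<close>: free groups are torsion free, and conversely such a subgroup acts freely on the
  Bass--Serre tree. Splitting off the orbit of a point from a pair of permutations \<open>(s, t)\<close> of \<open>N = 4mn\<close>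
  points with these cycle lengths and \<open>s\<^sup>2 = t\<^sup>4\<close> expresses the number of such pairs by the numbers
  \<open>f\<^sub>l\<close>. On the other hand, the number of pairs is \<open>N! m\<^sup>n K\<^sub>n / 16\<^sup>n\<close> with \<open>K\<^sub>n = (4n)! / ((2n)! n!)\<close>,
  because every permutation with cycles of length \<open>c\<close> has the same number of \<open>k\<close>-th roots with cycles of
  length \<open>ck\<close>. This gives
  \<open>4mn m\<^sup>n K\<^sub>n = \<Sum> 16\<^sup>l f\<^sub>l m\<^sup>n\<^sup>-\<^sup>l K\<^sub>n\<^sub>-\<^sub>l\<close> (sum over \<open>1 \<le> l \<le> n\<close>).
  As \<open>n!\<close> divides \<open>K\<^sub>n\<close> and 16 is invertible modulo \<open>p\<^sup>\<alpha>\<close>, this is a linear recurrence of bounded length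
  modulo \<open>p\<^sup>\<alpha>\<close>.
\<close>

text \<open>The Bass--Serre tree never occurs as an object. Its vertices are the cosets of
  \<open><x>\<close> and of \<open><y>\<close>, its edges the cosets of \<open><x^2>\<close>, and a
  set of vertices is represented by the union of the cosets, so that every argument is a computation
  in the group. The obstacle is to show that the proposed basis of \<open>H\<close> satisfies no
  relation: this needs a homomorphism from \<open>H\<close> to an abstract free group, although no
  presentation of \<open>H\<close> is at hand. It is obtained by letting the whole group act on its
  product with the free group, where only the three defining relations have to be verified.

  The constant 16 has two sources. For a common value \<open>z = s^2 = t^4\<close> the number of
  square roots has the denominator \<open>2^(2n)\<close>, as \<open>s\<close> has \<open>2n\<close>
  cycles, and the number of fourth roots has the denominator \<open>4^n\<close>, as \<open>t\<close>
  has \<open>n\<close> cycles. The factor \<open>4mn\<close> is the quotient of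
  \<open>(4mn)!\<close>, from counting all pairs, by \<open>(4mn - 1)!\<close>, which is common to
  all terms once an orbit is split off.\<close>

section \<open>Presented groups acting on sets\<close>

definition word_class :: "'a set \<Rightarrow> ('a word \<times> 'a word) set \<Rightarrow> 'a word \<Rightarrow> 'a word set" where
  "word_class S R u = pres_rel S R `` {u}"

lemma carrier_presented_group: "carrier (presented_group S R) = word_class S R ` words S"
  by (auto simp: presented_group_def quotient_def word_class_def)

lemma one_presented_group: "\<one>\<^bsub>presented_group S R\<^esub> = word_class S R []"
  by (simp add: presented_group_def word_class_def)

lemma word_class_append:
  "u \<in> words S \<Longrightarrow> v \<in> words S \<Longrightarrow>
    word_class S R (u @ v) = word_class S R u \<otimes>\<^bsub>presented_group S R\<^esub> word_class S R v"
  by (simp add: word_class_def presented_group_mult)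

lemma word_class_closed [simp]:
  "u \<in> words S \<Longrightarrow> word_class S R u \<in> carrier (presented_group S R)"
  by (simp add: carrier_presented_group)

lemma word_class_eq_iff:
  "u \<in> words S \<Longrightarrow> v \<in> words S \<Longrightarrow> word_class S R u = word_class S R v \<longleftrightarrow> (u, v) \<in> pres_rel S R"
  unfolding word_class_def by (rule eq_equiv_class_iff[OF equiv_pres_rel])

lemma words_Cons [simp]: "c # u \<in> words S \<longleftrightarrow> fst c \<in> S \<and> u \<in> words S"
  by (cases c) (auto simp: words_def)

lemma words_replicate: "a \<in> S \<Longrightarrow> replicate k (a, e) \<in> words S"
  by (induction k) auto

lemma word_class_inverse_letter:
  assumes "a \<in> S"
  shows "word_class S R [(a, \<not> e)] = inv\<^bsub>presented_group S R\<^esub> word_class S R [(a, e)]"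
proof -
  interpret group "presented_group S R" by (rule group_presented_group)
  have "([(a, \<not> e), (a, e)], []) \<in> pres_rel S R"
    using pres_rel.cancel[of "[]" S "[]" a "\<not> e" R] assms by simp
  then have "word_class S R [(a, \<not> e), (a, e)] = word_class S R []"
    using assms by (subst word_class_eq_iff) auto
  moreover have "word_class S R [(a, \<not> e), (a, e)] =
      word_class S R [(a, \<not> e)] \<otimes>\<^bsub>presented_group S R\<^esub> word_class S R [(a, e)]"
    using word_class_append[of "[(a, \<not> e)]" S "[(a, e)]" R] assms by simp
  ultimately show ?thesis
    using assms by (intro inv_equality[symmetric]) (auto simp: one_presented_group)
qed

lemma word_class_replicate:
  assumes "a \<in> S"
  shows "word_class S R (replicate k (a, e)) = word_class S R [(a, e)] [^]\<^bsub>presented_group S R\<^esub> k"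
proof -
  interpret group "presented_group S R" by (rule group_presented_group)
  show ?thesis
  proof (induction k)
    case (Suc k)
    then show ?case
      using assms word_class_append[of "replicate k (a, e)" S "[(a, e)]" R]
      by (simp add: words_replicate replicate_append_same)
  qed (simp add: one_presented_group)
qed

text \<open>Words act from the right: the leftmost letter acts first.\<close>

locale word_action =
  fixes S :: "'a set" and R :: "('a word \<times> 'a word) set" and St :: "'s set"
    and act :: "'a \<times> bool \<Rightarrow> 's \<Rightarrow> 's"
  assumes act_closed: "a \<in> S \<Longrightarrow> s \<in> St \<Longrightarrow> act (a, e) s \<in> St"
    and act_cancel: "a \<in> S \<Longrightarrow> s \<in> St \<Longrightarrow> act (a, \<not> e) (act (a, e) s) = s"
    and act_relation: "(r, r') \<in> R \<Longrightarrow> r \<in> words S \<Longrightarrow> r' \<in> words S \<Longrightarrow> s \<in> St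
      \<Longrightarrow> fold act r s = fold act r' s"
begin

lemma fold_act_closed: "w \<in> words S \<Longrightarrow> s \<in> St \<Longrightarrow> fold act w s \<in> St"
proof (induction w arbitrary: s)
  case (Cons c w)
  then show ?case using act_closed[of "fst c" s "snd c"] by simp
qed simp

lemma fold_act_cong: "(u, v) \<in> pres_rel S R \<Longrightarrow> s \<in> St \<Longrightarrow> fold act u s = fold act v s"
proof (induction arbitrary: s rule: pres_rel.induct)
  case (cancel u v a e)
  then show ?case using act_cancel[of a "fold act u s" e] by (simp add: fold_act_closed)
next
  case (relation u v r s')
  then show ?case using act_relation[of r s' "fold act u s"] by (simp add: fold_act_closed)
qed (auto)

text \<open>The representative is arbitrary. Equivalent words are known to agree on
  \<open>St\<close> only, so later facts about this map ask for \<open>s \<in> St\<close>.\<close>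

definition class_act :: "'a word set \<Rightarrow> 's \<Rightarrow> 's" where
  "class_act A = fold act (SOME w. w \<in> words S \<and> A = word_class S R w)"

lemma class_act_word_class:
  assumes "w \<in> words S" "s \<in> St"
  shows "class_act (word_class S R w) s = fold act w s"
proof -
  define v where "v = (SOME v. v \<in> words S \<and> word_class S R w = word_class S R v)"
  have v: "v \<in> words S \<and> word_class S R w = word_class S R v"
    unfolding v_def by (rule someI[of _ w]) (use assms in simp)
  then have "(w, v) \<in> pres_rel S R" using assms word_class_eq_iff by blast
  then show ?thesis unfolding class_act_def v_def[symmetric] using fold_act_cong assms by metis
qed

lemma class_act_closed:
  "A \<in> carrier (presented_group S R) \<Longrightarrow> s \<in> St \<Longrightarrow> class_act A s \<in> St"
  by (auto simp: carrier_presented_group class_act_word_class fold_act_closed)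

lemma class_act_mult:
  assumes "A \<in> carrier (presented_group S R)" "B \<in> carrier (presented_group S R)" "s \<in> St"
  shows "class_act (A \<otimes>\<^bsub>presented_group S R\<^esub> B) s = class_act B (class_act A s)"
proof -
  obtain u v where uv: "u \<in> words S" "v \<in> words S" "A = word_class S R u" "B = word_class S R v"
    using assms by (auto simp: carrier_presented_group)
  show ?thesis
    using uv assms word_class_append[of u S v R]
    by (simp add: class_act_word_class fold_act_closed flip: word_class_append)
qed

lemma class_act_one: "s \<in> St \<Longrightarrow> class_act \<one>\<^bsub>presented_group S R\<^esub> s = s"
  by (simp add: one_presented_group class_act_word_class)

lemma class_act_letter: "a \<in> S \<Longrightarrow> s \<in> St \<Longrightarrow> class_act (word_class S R [(a, e)]) s = act (a, e) s"
  by (simp add: class_act_word_class)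

lemma class_act_pow:
  assumes "A \<in> carrier (presented_group S R)" "s \<in> St"
  shows "class_act (A [^]\<^bsub>presented_group S R\<^esub> (k::nat)) s = (class_act A ^^ k) s"
proof -
  interpret group "presented_group S R" by (rule group_presented_group)
  show ?thesis
    by (induction k) (use assms in \<open>auto simp: class_act_one class_act_mult\<close>)
qed

end

section \<open>Reduced words and torsion in free groups\<close>

definition reduced :: "'a word \<Rightarrow> bool" where
  "reduced = successively (\<lambda>p q. \<not> (fst p = fst q \<and> snd p \<noteq> snd q))"

text \<open>Van der Waerden's device: letters act on reduced words by prepending with cancellation.
  An action on normal forms replaces a confluence argument for free reduction.\<close>

fun cancel_cons :: "'a \<times> bool \<Rightarrow> 'a word \<Rightarrow> 'a word" where
  "cancel_cons c [] = [c]"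
| "cancel_cons c (d # u) = (if fst c = fst d \<and> snd c \<noteq> snd d then u else c # d # u)"

lemma word_action_cancel_cons: "word_action S {} {u \<in> words S. reduced u} cancel_cons"
proof
  fix a s e assume a: "a \<in> S" and s: "s \<in> {u \<in> words S. reduced u}"
  show "cancel_cons (a, e) s \<in> {u \<in> words S. reduced u}"
    using a s by (cases s) (auto simp: reduced_def successively_Cons)
  show "cancel_cons (a, \<not> e) (cancel_cons (a, e) s) = s"
    using a s by (cases s; cases "tl s") (auto simp: reduced_def)
qed auto

text \<open>The letters of \<open>u\<close> are put in front one after the other, hence the
  reversal; as \<open>rev s @ u\<close> is reduced, no letter meets its inverse and nothing
  cancels.\<close>

lemma fold_cancel_cons: "reduced (rev s @ u) \<Longrightarrow> fold cancel_cons u s = rev u @ s"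
proof (induction u arbitrary: s)
  case (Cons c u)
  have "cancel_cons c s = c # s"
    using Cons.prems by (cases s) (auto simp: reduced_def successively_append_iff)
  then show ?case using Cons by simp
qed simp

text \<open>Acting on the empty word, \<open>u\<close> produces \<open>rev u\<close>, whereas the
  equivalent word \<open>[]\<close> leaves it unchanged.\<close>

lemma reduced_trivial_Nil:
  assumes "reduced u" "(u, []) \<in> pres_rel S {}"
  shows "u = []"
  using word_action.fold_act_cong[OF word_action_cancel_cons assms(2), of "[]"]
    fold_cancel_cons[of "[]" u] assms(1) by (simp add: reduced_def)

lemma not_successively_split:
  "\<not> successively P u \<Longrightarrow> \<exists>v c d w. u = v @ [c, d] @ w \<and> \<not> P c d"
proof (induction u rule: induct_list012)
  case (3 x y zs)
  show ?case
  proof (cases "P x y")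
    case True
    then obtain v c d w where "y # zs = v @ [c, d] @ w \<and> \<not> P c d" using 3 by auto
    then have "x # y # zs = (x # v) @ [c, d] @ w \<and> \<not> P c d" by simp
    then show ?thesis by blast
  next
    case False
    then have "x # y # zs = [] @ [x, y] @ zs \<and> \<not> P x y" by simp
    then show ?thesis by blast
  qed
qed auto

lemma successively_concat_replicate:
  assumes "successively P w" "w \<noteq> []" "P (last w) (hd w)"
  shows "successively P (concat (replicate n w))"
proof (induction n)
  case (Suc n)
  then show ?case using assms by (cases n) (auto simp: successively_append_iff)
qed simp

text \<open>A shortest word in the conjugacy class of an element is cyclically reduced, so its powers are reduced.\<close>

lemma free_group_torsion_free:
  assumes A: "A \<in> carrier (free_group S)" and n: "(n::nat) > 0"
    and An: "A [^]\<^bsub>free_group S\<^esub> n = \<one>\<^bsub>free_group S\<^esub>"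
  shows "A = \<one>\<^bsub>free_group S\<^esub>"
proof -
  let ?G = "presented_group S {}" and ?c = "word_class S {}"
  interpret group ?G by (rule group_presented_group)
  define conj where "conj w \<longleftrightarrow> w \<in> words S \<and> (\<exists>g\<in>carrier ?G. ?c w = g \<otimes>\<^bsub>?G\<^esub> A \<otimes>\<^bsub>?G\<^esub> inv\<^bsub>?G\<^esub> g)" for w
  have A': "A \<in> carrier ?G" using A by (simp add: free_group_def)
  then obtain w0 where "w0 \<in> words S" "A = ?c w0" by (auto simp: carrier_presented_group)
  then have "conj w0" unfolding conj_def using A' by (auto intro!: bexI[of _ "\<one>\<^bsub>?G\<^esub>"])
  then obtain w where w: "conj w" and least: "\<And>v. conj v \<Longrightarrow> length w \<le> length v"
    using ex_has_least_nat[of conj w0 length] by blast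
  from w obtain g where g: "w \<in> words S" "g \<in> carrier ?G" "?c w = g \<otimes>\<^bsub>?G\<^esub> A \<otimes>\<^bsub>?G\<^esub> inv\<^bsub>?G\<^esub> g"
    by (auto simp: conj_def)
  have pow: "?c (concat (replicate k w)) = ?c w [^]\<^bsub>?G\<^esub> k \<and> concat (replicate k w) \<in> words S" for k
  proof (induction k)
    case (Suc k)
    then show ?case using g(1) nat_pow_Suc2[of "?c w" k] by (simp add: word_class_append)
  qed (simp add: one_presented_group)
  have cpow: "?c w [^]\<^bsub>?G\<^esub> k = g \<otimes>\<^bsub>?G\<^esub> A [^]\<^bsub>?G\<^esub> k \<otimes>\<^bsub>?G\<^esub> inv\<^bsub>?G\<^esub> g" for k :: nat
  proof (induction k)
    case (Suc k)
    show ?case using Suc g A' by (simp add: m_assoc inv_solve_left')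
  qed (use g in simp)
  have "?c (concat (replicate n w)) = \<one>\<^bsub>?G\<^esub>"
    using pow cpow g An by (simp add: free_group_def)
  then have triv: "(concat (replicate n w), []) \<in> pres_rel S {}"
    using pow[of n] by (metis one_presented_group word_class_eq_iff words_Nil)
  have "w = []"
  proof (rule ccontr)
    assume "w \<noteq> []"
    \<comment> \<open>An inverse pair inside \<open>w\<close> could be cancelled without changing
      the element, against minimality.\<close>
    have red: "reduced w"
    proof (rule ccontr)
      assume "\<not> reduced w"
      then obtain u c d v where s: "w = u @ [c, d] @ v" "fst c = fst d" "snd c \<noteq> snd d"
        unfolding reduced_def using not_successively_split by blast
      obtain a e where "c = (a, e)" by force
      then have s: "w = u @ [(a, e), (a, \<not> e)] @ v" using s by (cases d) auto
      have uv: "u \<in> words S" "v \<in> words S" "a \<in> S" using g(1) s by auto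
      then have "?c w = ?c (u @ v)"
        using pres_rel.cancel[OF uv, of e "{}"] s g(1) by (subst word_class_eq_iff) auto
      then have "conj (u @ v)" using g uv by (auto simp: conj_def)
      then show False using least[of "u @ v"] s by simp
    qed
    \<comment> \<open>If the last letter were the inverse of the first, conjugation by the first
      letter would strip both ends and leave a shorter word.\<close>
    have cyc: "\<not> (fst (last w) = fst (hd w) \<and> snd (last w) \<noteq> snd (hd w))"
    proof
      assume c: "fst (last w) = fst (hd w) \<and> snd (last w) \<noteq> snd (hd w)"
      obtain a e where ae: "hd w = (a, e)" by force
      have l: "last w = (a, \<not> e)" using c ae by (cases "last w") auto
      obtain u where w': "w = (a, e) # u" using \<open>w \<noteq> []\<close> ae by (cases w) auto
      with l have "u \<noteq> []" by auto
      then obtain v where v: "u = v @ [(a, \<not> e)]" using w' l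
        by (metis append_butlast_last_id last_ConsR)
      have vS: "v \<in> words S" "a \<in> S" using g(1) w' v by auto
      have i: "?c [(a, \<not> e)] = inv\<^bsub>?G\<^esub> ?c [(a, e)]" by (rule word_class_inverse_letter) fact
      have "w = [(a, e)] @ v @ [(a, \<not> e)]" using w' v by simp
      then have "?c w = ?c [(a, e)] \<otimes>\<^bsub>?G\<^esub> (?c v \<otimes>\<^bsub>?G\<^esub> inv\<^bsub>?G\<^esub> ?c [(a, e)])"
        using vS by (simp only:) (subst word_class_append, simp_all add: word_class_append i del: append.simps)
      then have "?c v = inv\<^bsub>?G\<^esub> ?c [(a, e)] \<otimes>\<^bsub>?G\<^esub> ?c w \<otimes>\<^bsub>?G\<^esub> ?c [(a, e)]"
        using vS by (simp add: m_assoc) (simp flip: m_assoc)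
      also have "\<dots> = (inv\<^bsub>?G\<^esub> ?c [(a, e)] \<otimes>\<^bsub>?G\<^esub> g) \<otimes>\<^bsub>?G\<^esub> A \<otimes>\<^bsub>?G\<^esub> inv\<^bsub>?G\<^esub> (inv\<^bsub>?G\<^esub> ?c [(a, e)] \<otimes>\<^bsub>?G\<^esub> g)"
        using vS g A' by (simp add: inv_mult_group m_assoc)
      finally have "conj v" using vS g unfolding conj_def
        by (auto intro!: bexI[of _ "inv\<^bsub>?G\<^esub> ?c [(a, e)] \<otimes>\<^bsub>?G\<^esub> g"])
      then show False using least[of v] w' v by simp
    qed
    have "reduced (concat (replicate n w))"
      unfolding reduced_def using red cyc \<open>w \<noteq> []\<close>
      by (intro successively_concat_replicate) (auto simp: reduced_def)
    then have "concat (replicate n w) = []" using triv by (rule reduced_trivial_Nil)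
    then show False using n \<open>w \<noteq> []\<close> by (cases n) auto
  qed
  then have "g \<otimes>\<^bsub>?G\<^esub> A \<otimes>\<^bsub>?G\<^esub> inv\<^bsub>?G\<^esub> g = \<one>\<^bsub>?G\<^esub>" using g by (simp add: one_presented_group)
  then have "A = \<one>\<^bsub>?G\<^esub>" using g A'
    by (metis inv_closed inv_solve_right' l_cancel_one' l_one m_closed one_closed r_inv)
  then show ?thesis by (simp add: free_group_def)
qed

subsection \<open>Freeness of subgroups meeting the factors trivially\<close>

text \<open>
  \<open>U\<close> and \<open>V\<close> lift a subtree of the quotient of the Bass--Serre tree by \<open>H\<close> to the tree: they are
  the unions of the \<open>A\<close>-cosets and of the \<open>B\<close>-cosets that are vertices of the lift. The last clause says
  that the lift is connected.
\<close>

definition lift_connected ::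
  "('a, 'b) monoid_scheme \<Rightarrow> 'a set \<Rightarrow> 'a set \<Rightarrow> 'a set \<Rightarrow> 'a set \<Rightarrow> 'a set \<Rightarrow> 'a set \<Rightarrow> bool" where
  "lift_connected G A B U0 V0 U V \<longleftrightarrow>
     (\<forall>P Q. U0 \<subseteq> P \<longrightarrow> V0 \<subseteq> Q \<longrightarrow> (\<forall>g\<in>P \<inter> carrier G. \<forall>a\<in>A. g \<otimes>\<^bsub>G\<^esub> a \<in> P) \<longrightarrow>
        (\<forall>g\<in>Q \<inter> carrier G. \<forall>b\<in>B. g \<otimes>\<^bsub>G\<^esub> b \<in> Q) \<longrightarrow>
        (\<forall>g\<in>U \<inter> V. g \<in> P \<longleftrightarrow> g \<in> Q) \<longrightarrow> U \<subseteq> P \<and> V \<subseteq> Q)"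

definition lifted_tree ::
  "('a, 'b) monoid_scheme \<Rightarrow> 'a set \<Rightarrow> 'a set \<Rightarrow> 'a set \<Rightarrow> 'a set \<Rightarrow> 'a set \<Rightarrow> 'a set \<Rightarrow> 'a set \<Rightarrow> bool" where
  "lifted_tree G H A B U0 V0 U V \<longleftrightarrow>
     U \<subseteq> carrier G \<and> V \<subseteq> carrier G \<and> U0 \<subseteq> U \<and> V0 \<subseteq> V \<and>
     (\<forall>g\<in>U. \<forall>a\<in>A. g \<otimes>\<^bsub>G\<^esub> a \<in> U) \<and> (\<forall>g\<in>V. \<forall>b\<in>B. g \<otimes>\<^bsub>G\<^esub> b \<in> V) \<and>
     (\<forall>g\<in>U. \<forall>h\<in>H. h \<otimes>\<^bsub>G\<^esub> g \<in> U \<longrightarrow> h = \<one>\<^bsub>G\<^esub>) \<and>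
     (\<forall>g\<in>V. \<forall>h\<in>H. h \<otimes>\<^bsub>G\<^esub> g \<in> V \<longrightarrow> h = \<one>\<^bsub>G\<^esub>) \<and>
     lift_connected G A B U0 V0 U V"

text \<open>Exchanging the two factors spares a second proof of the extension step.\<close>

lemma lifted_tree_sym:
  assumes "lifted_tree G H A B U0 V0 U V"
  shows "lifted_tree G H B A V0 U0 V U"
proof -
  have "lift_connected G B A V0 U0 V U" if "lift_connected G A B U0 V0 U V"
    unfolding lift_connected_def
  proof (intro allI impI)
    fix P Q
    assume "V0 \<subseteq> P" "U0 \<subseteq> Q" "\<forall>g\<in>P \<inter> carrier G. \<forall>a\<in>B. g \<otimes>\<^bsub>G\<^esub> a \<in> P"
      "\<forall>g\<in>Q \<inter> carrier G. \<forall>b\<in>A. g \<otimes>\<^bsub>G\<^esub> b \<in> Q" "\<forall>g\<in>V \<inter> U. (g \<in> P) = (g \<in> Q)"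
    then show "V \<subseteq> P \<and> U \<subseteq> Q"
      using that[unfolded lift_connected_def, rule_format, of Q P] by blast
  qed
  then show ?thesis using assms unfolding lifted_tree_def by blast
qed

text \<open>\<open>HA\<close> and \<open>HB\<close> say that \<open>H\<close> meets the vertex
  stabilisers \<open>g A g^-1\<close> and \<open>g B g^-1\<close> trivially, that is, acts freely on
  the vertices. \<open>gen\<close> expresses generation by \<open>A\<close> and \<open>B\<close> as
  an induction principle.\<close>

locale tree_setting = group G for G (structure) +
  fixes H A B :: "'a set"
  assumes H: "subgroup H G" and A: "subgroup A G" and B: "subgroup B G"
    and fin: "finite (rcosets H)"
    and HA: "\<forall>g\<in>carrier G. \<forall>a\<in>A. g \<otimes> a \<otimes> inv g \<in> H \<longrightarrow> a = \<one>"
    and HB: "\<forall>g\<in>carrier G. \<forall>b\<in>B. g \<otimes> b \<otimes> inv g \<in> H \<longrightarrow> b = \<one>"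
    and gen: "\<And>W. \<one> \<in> W \<Longrightarrow> \<forall>g\<in>W \<inter> carrier G. \<forall>a\<in>A \<union> B. g \<otimes> a \<in> W \<Longrightarrow> carrier G \<subseteq> W"
begin

lemma H_carrier: "h \<in> H \<Longrightarrow> h \<in> carrier G" and A_carrier: "a \<in> A \<Longrightarrow> a \<in> carrier G"
  and B_carrier: "b \<in> B \<Longrightarrow> b \<in> carrier G"
  using subgroup.mem_carrier H A B by metis+

text \<open>An element of \<open>H\<close> that carries one point of the coset \<open>gK\<close> to
  another is \<open>g (b a^-1) g^-1\<close>, hence lies in a conjugate of \<open>K\<close>. So only
  the identity of \<open>H\<close> fixes a vertex.\<close>

lemma coset_free:
  assumes K: "subgroup K G" "\<forall>g\<in>carrier G. \<forall>a\<in>K. g \<otimes> a \<otimes> inv g \<in> H \<longrightarrow> a = \<one>"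
    and g: "g \<in> carrier G" and ab: "a \<in> K" "b \<in> K" and h: "h \<in> H" "h \<otimes> (g \<otimes> a) = g \<otimes> b"
  shows "h = \<one>"
proof -
  have c: "a \<in> carrier G" "b \<in> carrier G" "h \<in> carrier G"
    using subgroup.mem_carrier[OF K(1)] ab H_carrier h by auto
  have "h = h \<otimes> (g \<otimes> a) \<otimes> inv (g \<otimes> a)" using g c by (simp add: m_assoc)
  then have e: "h = g \<otimes> (b \<otimes> inv a) \<otimes> inv g" unfolding h(2) using g c by (simp add: inv_mult_group m_assoc)
  have "b \<otimes> inv a \<in> K" using K ab by (simp add: subgroup.m_closed subgroup.m_inv_closed)
  then have "b \<otimes> inv a = \<one>" using K(2) g h(1) e by metis
  then show ?thesis using e g by simp
qed

text \<open>The number of these cosets, bounded by the index of \<open>H\<close>, measures how much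
  of the quotient a lift reaches.\<close>

definition covered :: "'a set \<Rightarrow> 'a set set" where
  "covered U = (\<lambda>g. H #> g) ` U"

lemma covered_subset: "U \<subseteq> carrier G \<Longrightarrow> covered U \<subseteq> rcosets H"
  by (auto simp: covered_def RCOSETS_def)

lemma covered_iff:
  assumes "U \<subseteq> carrier G" "g \<in> carrier G"
  shows "H #> g \<in> covered U \<longleftrightarrow> (\<exists>h\<in>H. h \<otimes> g \<in> U)"
proof
  assume "H #> g \<in> covered U"
  then obtain u where u: "u \<in> U" "H #> g = H #> u" by (auto simp: covered_def)
  have "u \<in> H #> g" unfolding u(2) using u(1) assms H by (meson rcos_self subsetD)
  then show "\<exists>h\<in>H. h \<otimes> g \<in> U" using u(1) by (auto simp: r_coset_def)
next
  assume "\<exists>h\<in>H. h \<otimes> g \<in> U"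
  then obtain h where h: "h \<in> H" "h \<otimes> g \<in> U" by blast
  then have "H #> g = H #> (h \<otimes> g)" using assms H
    by (intro repr_independence[OF _ assms(2) H]) (auto simp: r_coset_def)
  then show "H #> g \<in> covered U" using h by (auto simp: covered_def)
qed

lemma card_covered_less:
  assumes "U \<subseteq> carrier G" "U' \<subseteq> carrier G" "U \<subseteq> U'" "g \<in> U'" "\<not> (\<exists>h\<in>H. h \<otimes> g \<in> U)"
  shows "card (covered U) < card (covered U')"
proof (rule psubset_card_mono)
  show "finite (covered U')" using covered_subset[OF assms(2)] fin finite_subset by blast
  have "H #> g \<in> covered U'" using assms by (auto simp: covered_def)
  moreover have "H #> g \<notin> covered U" using assms covered_iff[of U g] by blast
  moreover have "covered U \<subseteq> covered U'" using assms by (auto simp: covered_def)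
  ultimately show "covered U \<subset> covered U'" by blast
qed

text \<open>The vertex \<open>gB\<close>, adjacent to the lift through \<open>g \<in> U\<close>, is
  added. Since \<open>V\<close> is closed under \<open>B\<close>, the hypothesis on \<open>g\<close>
  keeps all \<open>H\<close>-translates of points of \<open>gB\<close> out of \<open>V\<close>,
  which preserves freeness. Connectedness survives because \<open>g\<close> now lies in both
  halves.\<close>

lemma lifted_tree_extend_right:
  assumes t: "lifted_tree G H A B U0 V0 U V" and g: "g \<in> U" and nV: "\<not> (\<exists>h\<in>H. h \<otimes> g \<in> V)"
  shows "lifted_tree G H A B U0 V0 U (V \<union> (\<lambda>b. g \<otimes> b) ` B)" (is "lifted_tree G H A B U0 V0 U ?V")
proof -
  have sub: "U \<subseteq> carrier G" "V \<subseteq> carrier G" and Vb: "\<And>v b. v \<in> V \<Longrightarrow> b \<in> B \<Longrightarrow> v \<otimes> b \<in> V"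
    and V1: "\<And>v h. v \<in> V \<Longrightarrow> h \<in> H \<Longrightarrow> h \<otimes> v \<in> V \<Longrightarrow> h = \<one>" and con: "lift_connected G A B U0 V0 U V"
    using t unfolding lifted_tree_def by blast+
  have gc: "g \<in> carrier G" using g sub by auto
  have nV': "h \<otimes> (g \<otimes> b) \<notin> V" if "h \<in> H" "b \<in> B" for h b
  proof
    assume "h \<otimes> (g \<otimes> b) \<in> V"
    then have "h \<otimes> (g \<otimes> b) \<otimes> inv b \<in> V" using Vb subgroup.m_inv_closed[OF B that(2)] by blast
    moreover have "h \<otimes> (g \<otimes> b) \<otimes> inv b = h \<otimes> g"
      using that gc B_carrier H_carrier by (simp add: m_assoc)
    ultimately show False using nV that(1) by auto
  qed
  have free: "h = \<one>" if v: "v \<in> ?V" and h: "h \<in> H" and hv: "h \<otimes> v \<in> ?V" for v h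
  proof -
    consider "v \<in> V" "h \<otimes> v \<in> V" | b where "b \<in> B" "v = g \<otimes> b" "h \<otimes> v \<in> V"
      | b where "b \<in> B" "v \<in> V" "h \<otimes> v = g \<otimes> b" | b c where "b \<in> B" "c \<in> B" "v = g \<otimes> b" "h \<otimes> v = g \<otimes> c"
      using v hv by blast
    then show ?thesis
    proof cases
      case 1 then show ?thesis using V1 h by blast
    next
      case 2 then show ?thesis using nV' h by blast
    next
      case (3 b)
      have "v \<in> carrier G" "h \<in> carrier G" using 3 sub h H_carrier by auto
      then have "inv h \<otimes> (h \<otimes> v) = v" by (simp flip: m_assoc)
      then have "inv h \<otimes> (g \<otimes> b) \<in> V" using 3 by simp
      then show ?thesis using nV'[of "inv h" b] 3 h H by (simp add: subgroup.m_inv_closed)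
    next
      case (4 b c)
      then show ?thesis using coset_free[OF B HB gc 4(1,2) h] by simp
    qed
  qed
  have closed: "v \<otimes> b \<in> ?V" if v: "v \<in> ?V" and b: "b \<in> B" for v b
  proof (cases "v \<in> V")
    case False
    then obtain c where c: "c \<in> B" "v = g \<otimes> c" using v by blast
    then have "v \<otimes> b = g \<otimes> (c \<otimes> b)" using gc b B_carrier by (simp add: m_assoc)
    moreover have "c \<otimes> b \<in> B" using c b B by (simp add: subgroup.m_closed)
    ultimately show ?thesis by blast
  qed (use Vb b in blast)
  have "lift_connected G A B U0 V0 U ?V"
    unfolding lift_connected_def
  proof (intro allI impI)
    fix P Q
    assume PQ: "U0 \<subseteq> P" "V0 \<subseteq> Q" "\<forall>g\<in>P \<inter> carrier G. \<forall>a\<in>A. g \<otimes> a \<in> P"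
      "\<forall>g\<in>Q \<inter> carrier G. \<forall>b\<in>B. g \<otimes> b \<in> Q" "\<forall>g\<in>U \<inter> ?V. g \<in> P \<longleftrightarrow> g \<in> Q"
    have UV: "U \<subseteq> P \<and> V \<subseteq> Q"
      using con[unfolded lift_connected_def, rule_format, OF PQ(1,2)] PQ(3,4,5) by blast
    have "g \<otimes> \<one> \<in> ?V" using subgroup.one_closed[OF B] by blast
    then have "g \<in> ?V" using gc by simp
    then have "g \<in> Q" using PQ(5) UV g by blast
    then show "U \<subseteq> P \<and> ?V \<subseteq> Q" using UV PQ(4) gc by blast
  qed
  moreover have "?V \<subseteq> carrier G" using sub gc B_carrier by auto
  moreover have "U0 \<subseteq> U" "V0 \<subseteq> ?V" "\<forall>g\<in>U. \<forall>a\<in>A. g \<otimes> a \<in> U"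
    "\<forall>g\<in>U. \<forall>h\<in>H. h \<otimes> g \<in> U \<longrightarrow> h = \<one>"
    using t unfolding lifted_tree_def by blast+
  moreover have "\<forall>g\<in>?V. \<forall>b\<in>B. g \<otimes> b \<in> ?V" "\<forall>g\<in>?V. \<forall>h\<in>H. h \<otimes> g \<in> ?V \<longrightarrow> h = \<one>"
    using closed free by blast+
  ultimately show ?thesis using sub(1) unfolding lifted_tree_def by - (rule conjI | assumption)+
qed

lemma tree_setting_sym: "tree_setting G H B A"
proof (intro tree_setting.intro tree_setting_axioms.intro is_group)
  fix W assume "\<one> \<in> W" "\<forall>g\<in>W \<inter> carrier G. \<forall>a\<in>B \<union> A. g \<otimes> a \<in> W"
  then show "carrier G \<subseteq> W" using gen[of W] by (simp add: Un_commute)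
qed (fact H A B fin HA HB)+

lemma lifted_tree_extend_left:
  assumes "lifted_tree G H A B U0 V0 U V" and "g \<in> V" and "\<not> (\<exists>h\<in>H. h \<otimes> g \<in> U)"
  shows "lifted_tree G H A B U0 V0 (U \<union> (\<lambda>a. g \<otimes> a) ` A) V"
  using tree_setting.lifted_tree_extend_right[OF tree_setting_sym lifted_tree_sym[OF assms(1)] assms(2,3)]
  by (rule lifted_tree_sym)

lemma lifted_tree_initial: "lifted_tree G H A B {\<one>} {} A {}"
proof -
  have "h = \<one>" if "g \<in> A" "h \<in> H" "h \<otimes> g \<in> A" for g h
    using coset_free[OF A HA one_closed that(1,3,2)] that A_carrier by simp
  moreover have "lift_connected G A B {\<one>} {} A {}"
    unfolding lift_connected_def
  proof (intro allI impI conjI subsetI)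
    fix P Q a assume "{\<one>} \<subseteq> P" "\<forall>g\<in>P \<inter> carrier G. \<forall>a\<in>A. g \<otimes> a \<in> P" "a \<in> A"
    then have "\<one> \<otimes> a \<in> P" by blast
    then show "a \<in> P" using \<open>a \<in> A\<close> A_carrier by simp
  qed auto
  moreover have "{\<one>} \<subseteq> A" "\<And>a b. a \<in> A \<Longrightarrow> b \<in> A \<Longrightarrow> a \<otimes> b \<in> A" "A \<subseteq> carrier G"
    using A A_carrier by (auto simp: subgroup.one_closed subgroup.m_closed)
  ultimately show ?thesis unfolding lifted_tree_def by (intro conjI) blast+
qed

text \<open>A lift covering as many cosets as possible exists because the index is finite.
  Maximality forces \<open>U\<close> and \<open>V\<close> to cover the same cosets, since otherwise
  one of them could be extended; the set of covered elements is then stable under \<open>A\<close>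
  and \<open>B\<close>, hence everything.\<close>

lemma lifted_spanning_tree:
  obtains U V where "lifted_tree G H A B {\<one>} {} U V"
    "\<And>g. g \<in> carrier G \<Longrightarrow> \<exists>h\<in>H. h \<otimes> g \<in> U" "\<And>g. g \<in> carrier G \<Longrightarrow> \<exists>h\<in>H. h \<otimes> g \<in> V"
proof -
  define f where "f UV = card (covered (fst UV)) + card (covered (snd UV))" for UV
  define T where "T UV \<longleftrightarrow> lifted_tree G H A B {\<one>} {} (fst UV) (snd UV)" for UV
  have bound: "f UV \<le> 2 * card (rcosets H)" if "T UV" for UV
  proof -
    have "fst UV \<subseteq> carrier G" "snd UV \<subseteq> carrier G" using that by (auto simp: T_def lifted_tree_def)
    then show ?thesis unfolding f_def using card_mono[OF fin covered_subset] by (metis add_mono mult_2)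
  qed
  have "T (A, {})" using lifted_tree_initial by (simp add: T_def)
  moreover have "\<forall>UV. T UV \<longrightarrow> f UV < Suc (2 * card (rcosets H))" using bound by (auto simp: less_Suc_eq_le)
  ultimately have "\<exists>UV. T UV \<and> (\<forall>UV'. T UV' \<longrightarrow> f UV' \<le> f UV)"
    by (rule ex_has_greatest_nat)
  then obtain U V where t: "lifted_tree G H A B {\<one>} {} U V" and max: "\<And>UV. T UV \<Longrightarrow> f UV \<le> f (U, V)"
    by (auto simp: T_def)
  have sub: "U \<subseteq> carrier G" "V \<subseteq> carrier G" using t by (auto simp: lifted_tree_def)
  have UV: "\<exists>h\<in>H. h \<otimes> g \<in> V" if "g \<in> U" for g
  proof (rule ccontr)
    assume n: "\<not> ?thesis"
    note t' = lifted_tree_extend_right[OF t that n]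
    have "g \<otimes> \<one> \<in> V \<union> (\<lambda>b. g \<otimes> b) ` B" using subgroup.one_closed[OF B] by blast
    then have "g \<in> V \<union> (\<lambda>b. g \<otimes> b) ` B" using that sub by auto
    then have "card (covered V) < card (covered (V \<union> (\<lambda>b. g \<otimes> b) ` B))"
      using t' n sub by (intro card_covered_less[of _ _ g]) (simp_all add: lifted_tree_def)
    then show False using max[of "(U, V \<union> (\<lambda>b. g \<otimes> b) ` B)"] t' by (simp add: f_def T_def)
  qed
  have VU: "\<exists>h\<in>H. h \<otimes> g \<in> U" if "g \<in> V" for g
  proof (rule ccontr)
    assume n: "\<not> ?thesis"
    note t' = lifted_tree_extend_left[OF t that n]
    have "g \<otimes> \<one> \<in> U \<union> (\<lambda>a. g \<otimes> a) ` A" using subgroup.one_closed[OF A] by blast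
    then have "g \<in> U \<union> (\<lambda>a. g \<otimes> a) ` A" using that sub by auto
    then have "card (covered U) < card (covered (U \<union> (\<lambda>a. g \<otimes> a) ` A))"
      using t' n sub by (intro card_covered_less[of _ _ g]) (simp_all add: lifted_tree_def)
    then show False using max[of "(U \<union> (\<lambda>a. g \<otimes> a) ` A, V)"] t' by (simp add: f_def T_def)
  qed
  define W where "W = {g \<in> carrier G. \<exists>h\<in>H. h \<otimes> g \<in> U}"
  have W: "W = {g \<in> carrier G. \<exists>h\<in>H. h \<otimes> g \<in> V}"
  proof (intro equalityI subsetI)
    fix g assume "g \<in> W"
    then obtain h where h: "g \<in> carrier G" "h \<in> H" "h \<otimes> g \<in> U" by (auto simp: W_def)
    then obtain k where "k \<in> H" "k \<otimes> (h \<otimes> g) \<in> V" using UV by blast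
    then have "k \<otimes> h \<in> H" "k \<otimes> h \<otimes> g \<in> V" using h H H_carrier by (auto simp: m_assoc subgroup.m_closed)
    then show "g \<in> {g \<in> carrier G. \<exists>h\<in>H. h \<otimes> g \<in> V}" using h by blast
  next
    fix g assume "g \<in> {g \<in> carrier G. \<exists>h\<in>H. h \<otimes> g \<in> V}"
    then obtain h where h: "g \<in> carrier G" "h \<in> H" "h \<otimes> g \<in> V" by auto
    then obtain k where "k \<in> H" "k \<otimes> (h \<otimes> g) \<in> U" using VU by blast
    then have "k \<otimes> h \<in> H" "k \<otimes> h \<otimes> g \<in> U" using h H H_carrier by (auto simp: m_assoc subgroup.m_closed)
    then show "g \<in> W" using h by (auto simp: W_def)
  qed
  have "carrier G \<subseteq> W"
  proof (rule gen)
    have "\<one> \<in> U" using t by (auto simp: lifted_tree_def)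
    then show "\<one> \<in> W" using subgroup.one_closed[OF H] unfolding W_def by force
    show "\<forall>g\<in>W \<inter> carrier G. \<forall>a\<in>A \<union> B. g \<otimes> a \<in> W"
    proof (intro ballI)
      fix g a assume g: "g \<in> W \<inter> carrier G" and a: "a \<in> A \<union> B"
      have ac: "a \<in> carrier G" using a A_carrier B_carrier by blast
      show "g \<otimes> a \<in> W"
      proof (cases "a \<in> A")
        case True
        obtain h where h: "h \<in> H" "h \<otimes> g \<in> U" using g by (auto simp: W_def)
        then have "h \<otimes> g \<otimes> a \<in> U" using t True by (auto simp: lifted_tree_def)
        then show ?thesis using g h ac H_carrier by (auto simp: W_def m_assoc)
      next
        case False
        obtain h where h: "h \<in> H" "h \<otimes> g \<in> V" using g by (auto simp: W)
        then have "h \<otimes> g \<otimes> a \<in> V" using t False a by (auto simp: lifted_tree_def)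
        then show ?thesis using g h ac H_carrier by (auto simp: W m_assoc)
      qed
    qed
  qed
  then show ?thesis using that[of U V] t W by (auto simp: W_def)
qed

end

section \<open>The generators \<open>x\<close> and \<open>y\<close>, and actions given by two
  maps\<close>

definition gamma_rels :: "nat \<Rightarrow> (gen word \<times> gen word) set" where
  "gamma_rels m = {(gen_pow X (2 * m), []), (gen_pow Y (4 * m), []), (gen_pow X 2, gen_pow Y 4)}"

definition gx :: "nat \<Rightarrow> gen word set" where
  "gx m = word_class {X, Y} (gamma_rels m) [(X, True)]"

definition gy :: "nat \<Rightarrow> gen word set" where
  "gy m = word_class {X, Y} (gamma_rels m) [(Y, True)]"

lemma Gamma4_eq: "Gamma4 m = presented_group {X, Y} (gamma_rels m)"
  by (simp add: Gamma4_def gamma_rels_def)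

lemma gx_carrier [simp]: "gx m \<in> carrier (Gamma4 m)" and gy_carrier [simp]: "gy m \<in> carrier (Gamma4 m)"
  by (auto simp: Gamma4_eq gx_def gy_def)

lemma word_class_gen_pow:
  "word_class {X, Y} (gamma_rels m) (gen_pow X k) = gx m [^]\<^bsub>Gamma4 m\<^esub> k"
  "word_class {X, Y} (gamma_rels m) (gen_pow Y k) = gy m [^]\<^bsub>Gamma4 m\<^esub> k"
  by (simp_all add: gen_pow_def gx_def gy_def word_class_replicate Gamma4_eq)

lemma gen_pow_words: "gen_pow g k \<in> words {X, Y}"
  by (cases g) (simp_all add: gen_pow_def words_replicate)

lemma word_class_relation:
  assumes "(r, s) \<in> R" "r \<in> words S" "s \<in> words S"
  shows "word_class S R r = word_class S R s"
  using pres_rel.relation[of "[]" S "[]" r s R] assms by (simp add: word_class_eq_iff)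

lemma gx_pow: "gx m [^]\<^bsub>Gamma4 m\<^esub> (2 * m) = \<one>\<^bsub>Gamma4 m\<^esub>"
  and gy_pow: "gy m [^]\<^bsub>Gamma4 m\<^esub> (4 * m) = \<one>\<^bsub>Gamma4 m\<^esub>"
  and gx_gy_pow: "gx m [^]\<^bsub>Gamma4 m\<^esub> (2::nat) = gy m [^]\<^bsub>Gamma4 m\<^esub> (4::nat)"
proof -
  have "word_class {X, Y} (gamma_rels m) (gen_pow X (2 * m)) = word_class {X, Y} (gamma_rels m) []"
    by (rule word_class_relation) (auto simp: gamma_rels_def gen_pow_words)
  then show "gx m [^]\<^bsub>Gamma4 m\<^esub> (2 * m) = \<one>\<^bsub>Gamma4 m\<^esub>"
    by (simp add: word_class_gen_pow one_presented_group Gamma4_eq)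
  have "word_class {X, Y} (gamma_rels m) (gen_pow Y (4 * m)) = word_class {X, Y} (gamma_rels m) []"
    by (rule word_class_relation) (auto simp: gamma_rels_def gen_pow_words)
  then show "gy m [^]\<^bsub>Gamma4 m\<^esub> (4 * m) = \<one>\<^bsub>Gamma4 m\<^esub>"
    by (simp add: word_class_gen_pow one_presented_group Gamma4_eq)
  have "word_class {X, Y} (gamma_rels m) (gen_pow X 2) = word_class {X, Y} (gamma_rels m) (gen_pow Y 4)"
    by (rule word_class_relation) (auto simp: gamma_rels_def gen_pow_words)
  then show "gx m [^]\<^bsub>Gamma4 m\<^esub> (2::nat) = gy m [^]\<^bsub>Gamma4 m\<^esub> (4::nat)"
    by (simp add: word_class_gen_pow)
qed

lemma (in group) pow_closed_right:
  assumes "\<forall>g\<in>W \<inter> carrier G. g \<otimes> x \<in> W" "x \<in> carrier G" "g \<in> W" "g \<in> carrier G"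
  shows "g \<otimes> x [^] (k::nat) \<in> W"
proof (induction k)
  case (Suc k)
  then have "g \<otimes> x [^] k \<otimes> x \<in> W" using assms by auto
  then show ?case using assms by (simp add: m_assoc)
qed (use assms in simp)

lemma (in group) inv_eq_pow:
  assumes "x \<in> carrier G" "x [^] n = \<one>" "(n::nat) \<ge> 1"
  shows "inv x = x [^] (n - 1)"
proof -
  have "x [^] (n - 1) \<otimes> x = \<one>" using assms by (cases n) auto
  then show ?thesis using assms by (simp add: inv_equality)
qed

lemma (in group) subgroup_range_pow:
  assumes x: "x \<in> carrier G" "x [^] n = \<one>" "(n::nat) \<ge> 1"
  shows "subgroup (range (\<lambda>k::nat. x [^] k)) G"
proof
  fix a assume "a \<in> range (\<lambda>k::nat. x [^] k)"
  then obtain k :: nat where k: "a = x [^] k" by blast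
  have "(x [^] k) [^] n = (x [^] n) [^] k" using x by (metis nat_pow_pow mult.commute)
  then have "inv a = x [^] (k * (n - 1))" using x k inv_eq_pow[of "x [^] k" n]
    by (simp add: nat_pow_pow nat_pow_one)
  then show "inv a \<in> range (\<lambda>k::nat. x [^] k)" by blast
next
  fix a b assume "a \<in> range (\<lambda>k::nat. x [^] k)" "b \<in> range (\<lambda>k::nat. x [^] k)"
  then obtain k l :: nat where "a = x [^] k" "b = x [^] l" by blast
  then have "a \<otimes> b = x [^] (k + l)" using x by (simp add: nat_pow_mult)
  then show "a \<otimes> b \<in> range (\<lambda>k::nat. x [^] k)" by blast
qed (use x in \<open>auto intro: range_eqI[of _ _ 0]\<close>)

text \<open>Both generators have finite order, so inverse letters are positive powers, and stability
  of \<open>W\<close> under right multiplication by \<open>gx\<close> and \<open>gy\<close>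
  suffices.\<close>

lemma Gamma4_induct:
  assumes m: "m \<ge> 1" and one: "\<one>\<^bsub>Gamma4 m\<^esub> \<in> W"
    and W: "\<forall>g\<in>W \<inter> carrier (Gamma4 m). g \<otimes>\<^bsub>Gamma4 m\<^esub> gx m \<in> W"
      "\<forall>g\<in>W \<inter> carrier (Gamma4 m). g \<otimes>\<^bsub>Gamma4 m\<^esub> gy m \<in> W"
  shows "carrier (Gamma4 m) \<subseteq> W"
proof -
  interpret group "Gamma4 m" by (rule group_Gamma4)
  let ?c = "word_class {X, Y} (gamma_rels m)"
  have letter: "?c [(g, e)] \<in> range (\<lambda>k::nat. gx m [^]\<^bsub>Gamma4 m\<^esub> k) \<union> range (\<lambda>k::nat. gy m [^]\<^bsub>Gamma4 m\<^esub> k)" for g e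
  proof -
    have "gx m \<in> range (\<lambda>k::nat. gx m [^]\<^bsub>Gamma4 m\<^esub> k)" "gy m \<in> range (\<lambda>k::nat. gy m [^]\<^bsub>Gamma4 m\<^esub> k)"
      by (rule range_eqI[of _ _ 1], simp)+
    moreover have "inv\<^bsub>Gamma4 m\<^esub> gx m = gx m [^]\<^bsub>Gamma4 m\<^esub> (2 * m - 1)"
      "inv\<^bsub>Gamma4 m\<^esub> gy m = gy m [^]\<^bsub>Gamma4 m\<^esub> (4 * m - 1)"
      using inv_eq_pow[of "gx m" "2 * m"] inv_eq_pow[of "gy m" "4 * m"] gx_pow gy_pow m by auto
    moreover have "?c [(g, False)] = inv\<^bsub>Gamma4 m\<^esub> ?c [(g, True)]"
      using word_class_inverse_letter[of g "{X, Y}" "gamma_rels m" True] by (cases g) (auto simp: Gamma4_eq)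
    ultimately show ?thesis by (cases e; cases g) (auto simp flip: gx_def gy_def)
  qed
  have "?c w \<in> W" if "w \<in> words {X, Y}" for w
    using that
  proof (induction w rule: rev_induct)
    case (snoc c w)
    obtain g e where c: "c = (g, e)" by force
    have w: "w \<in> words {X, Y}" using snoc by simp
    then have "?c w \<in> W" "?c w \<in> carrier (Gamma4 m)" using snoc by (auto simp: Gamma4_eq)
    then have "?c w \<otimes>\<^bsub>Gamma4 m\<^esub> ?c [(g, e)] \<in> W"
      using letter[of g e] pow_closed_right[OF W(1)] pow_closed_right[OF W(2)] by auto
    then show ?case using word_class_append[of w "{X, Y}" "[c]" "gamma_rels m"] snoc.prems
      by (simp add: c Gamma4_eq)
  qed (use one in \<open>simp add: Gamma4_eq one_presented_group\<close>)
  then show ?thesis by (auto simp: Gamma4_eq carrier_presented_group)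
qed

text \<open>Inverse letters act through positive powers, so that two maps subject to the three
  relations define an action without inverse maps being supplied.\<close>

fun gamma_letter :: "nat \<Rightarrow> ('s \<Rightarrow> 's) \<Rightarrow> ('s \<Rightarrow> 's) \<Rightarrow> gen \<times> bool \<Rightarrow> 's \<Rightarrow> 's" where
  "gamma_letter m f g (X, e) = (if e then f else f ^^ (2 * m - 1))"
| "gamma_letter m f g (Y, e) = (if e then g else g ^^ (4 * m - 1))"

definition gamma_op :: "nat \<Rightarrow> ('s \<Rightarrow> 's) \<Rightarrow> ('s \<Rightarrow> 's) \<Rightarrow> gen word set \<Rightarrow> 's \<Rightarrow> 's" where
  "gamma_op m f g = word_action.class_act {X, Y} (gamma_rels m) (gamma_letter m f g)"

locale gamma_action =
  fixes m :: nat and St :: "'s set" and f g :: "'s \<Rightarrow> 's"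
  assumes m: "m \<ge> 1" and f: "f \<in> St \<rightarrow> St" and g: "g \<in> St \<rightarrow> St"
    and f_pow: "s \<in> St \<Longrightarrow> (f ^^ (2 * m)) s = s" and g_pow: "s \<in> St \<Longrightarrow> (g ^^ (4 * m)) s = s"
    and f_g: "s \<in> St \<Longrightarrow> (f ^^ 2) s = (g ^^ 4) s"
begin

lemma funpow_closed: "h \<in> St \<rightarrow> St \<Longrightarrow> s \<in> St \<Longrightarrow> (h ^^ k) s \<in> St"
  by (induction k) auto

sublocale word_action "{X, Y}" "gamma_rels m" St "gamma_letter m f g"
proof
  fix a s e assume a: "a \<in> {X, Y}" and s: "s \<in> St"
  show "gamma_letter m f g (a, e) s \<in> St"
    using f g s by (cases a) (auto intro: funpow_closed)
  have "(h ^^ (n - 1)) (h s) = s \<and> h ((h ^^ (n - 1)) s) = s" if "(h ^^ n) s = s" "n \<ge> 1" for h and n :: nat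
    using that by (cases n) (auto simp: funpow_swap1)
  then show "gamma_letter m f g (a, \<not> e) (gamma_letter m f g (a, e) s) = s"
    using f_pow[OF s] g_pow[OF s] m by (cases a; cases e) auto
next
  fix r r' s assume "(r, r') \<in> gamma_rels m" "s \<in> St"
  then show "fold (gamma_letter m f g) r s = fold (gamma_letter m f g) r' s"
    using f_pow g_pow f_g by (auto simp: gamma_rels_def gen_pow_def fold_replicate)
qed

lemma gamma_op_closed: "A \<in> carrier (Gamma4 m) \<Longrightarrow> s \<in> St \<Longrightarrow> gamma_op m f g A s \<in> St"
  and gamma_op_mult: "A \<in> carrier (Gamma4 m) \<Longrightarrow> B \<in> carrier (Gamma4 m) \<Longrightarrow> s \<in> St \<Longrightarrow>
    gamma_op m f g (A \<otimes>\<^bsub>Gamma4 m\<^esub> B) s = gamma_op m f g B (gamma_op m f g A s)"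
  and gamma_op_one: "s \<in> St \<Longrightarrow> gamma_op m f g \<one>\<^bsub>Gamma4 m\<^esub> s = s"
  and gamma_op_pow: "A \<in> carrier (Gamma4 m) \<Longrightarrow> s \<in> St \<Longrightarrow>
    gamma_op m f g (A [^]\<^bsub>Gamma4 m\<^esub> (k::nat)) s = (gamma_op m f g A ^^ k) s"
  unfolding gamma_op_def Gamma4_eq
  by (simp_all add: class_act_closed class_act_mult class_act_one class_act_pow)

lemma gamma_op_gx: "s \<in> St \<Longrightarrow> gamma_op m f g (gx m) s = f s"
  and gamma_op_gy: "s \<in> St \<Longrightarrow> gamma_op m f g (gy m) s = g s"
  unfolding gamma_op_def gx_def gy_def by (simp_all add: class_act_letter)

lemma gamma_op_gx_pow: "s \<in> St \<Longrightarrow> gamma_op m f g (gx m [^]\<^bsub>Gamma4 m\<^esub> (k::nat)) s = (f ^^ k) s"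
  and gamma_op_gy_pow: "s \<in> St \<Longrightarrow> gamma_op m f g (gy m [^]\<^bsub>Gamma4 m\<^esub> (k::nat)) s = (g ^^ k) s"
proof -
  assume s: "s \<in> St"
  have "(gamma_op m f g (gx m) ^^ k) s = (f ^^ k) s"
    by (induction k) (use s f in \<open>auto simp: gamma_op_gx funpow_closed\<close>)
  then show "gamma_op m f g (gx m [^]\<^bsub>Gamma4 m\<^esub> k) s = (f ^^ k) s" using s by (simp add: gamma_op_pow)
  have "(gamma_op m f g (gy m) ^^ k) s = (g ^^ k) s"
    by (induction k) (use s g in \<open>auto simp: gamma_op_gy funpow_closed\<close>)
  then show "gamma_op m f g (gy m [^]\<^bsub>Gamma4 m\<^esub> k) s = (g ^^ k) s" using s by (simp add: gamma_op_pow)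
qed

end

text \<open>The defining relations give the direction from right to left. The other one comes from
  the action on the residues modulo \<open>4m\<close> in which \<open>y\<close> adds 1 and
  \<open>x\<close> adds 2; it respects the relations since two steps of \<open>x\<close> equal four
  steps of \<open>y\<close>.\<close>

lemma gx_pow_eq_one: "m \<ge> 1 \<Longrightarrow> gx m [^]\<^bsub>Gamma4 m\<^esub> k = \<one>\<^bsub>Gamma4 m\<^esub> \<longleftrightarrow> 2 * m dvd (k::nat)"
  and gy_pow_eq_one: "m \<ge> 1 \<Longrightarrow> gy m [^]\<^bsub>Gamma4 m\<^esub> k = \<one>\<^bsub>Gamma4 m\<^esub> \<longleftrightarrow> 4 * m dvd (k::nat)"
proof -
  assume m: "m \<ge> 1"
  interpret group "Gamma4 m" by (rule group_Gamma4)
  have add: "((\<lambda>n. (n + c) mod (4 * m)) ^^ k) s = (s + k * c) mod (4 * m)" if "s < 4 * m" for c k s :: nat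
    by (induction k) (use that in \<open>auto simp: mod_simps algebra_simps\<close>)
  interpret gamma_action m "{..<4 * m}" "\<lambda>n. (n + 2) mod (4 * m)" "\<lambda>n. (n + 1) mod (4 * m)"
    by standard (use m in \<open>auto simp: add[where c = 1, simplified] add[where c = 2, simplified]\<close>)
  have "2 * m dvd k" if "gx m [^]\<^bsub>Gamma4 m\<^esub> k = \<one>\<^bsub>Gamma4 m\<^esub>"
  proof -
    have "((\<lambda>n. (n + 2) mod (4 * m)) ^^ k) 0 = 0"
      using gamma_op_gx_pow[of 0 k] gamma_op_one[of 0] m that by simp
    then have "2 * (2 * m) dvd 2 * k" using add[where c = 2 and k = k and s = 0] m by (auto simp: mult.commute dvd_eq_mod_eq_0)
    then show ?thesis by (simp only: nat_mult_dvd_cancel1 zero_less_numeral)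
  qed
  moreover have "gx m [^]\<^bsub>Gamma4 m\<^esub> k = \<one>\<^bsub>Gamma4 m\<^esub>" if "2 * m dvd k"
    using that gx_pow[of m] nat_pow_pow[of "gx m" "2 * m"] by (metis dvdE gx_carrier nat_pow_one)
  ultimately show "gx m [^]\<^bsub>Gamma4 m\<^esub> k = \<one>\<^bsub>Gamma4 m\<^esub> \<longleftrightarrow> 2 * m dvd k" by blast
  have "4 * m dvd k" if "gy m [^]\<^bsub>Gamma4 m\<^esub> k = \<one>\<^bsub>Gamma4 m\<^esub>"
  proof -
    have "((\<lambda>n. (n + 1) mod (4 * m)) ^^ k) 0 = 0"
      using gamma_op_gy_pow[of 0 k] gamma_op_one[of 0] m that by simp
    then show ?thesis using add[where c = 1 and k = k and s = 0] m by (auto simp: dvd_eq_mod_eq_0)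
  qed
  moreover have "gy m [^]\<^bsub>Gamma4 m\<^esub> k = \<one>\<^bsub>Gamma4 m\<^esub>" if "4 * m dvd k"
    using that gy_pow[of m] nat_pow_pow[of "gy m" "4 * m"] by (metis dvdE gy_carrier nat_pow_one)
  ultimately show "gy m [^]\<^bsub>Gamma4 m\<^esub> k = \<one>\<^bsub>Gamma4 m\<^esub> \<longleftrightarrow> 4 * m dvd k" by blast
qed

section \<open>A cocycle recording crossed edges, and evaluation of free groups\<close>

text \<open>Let \<open>a g\<close> be attached to the edge at \<open>g\<close>. Going from the
  vertex \<open>g<x>\<close> over this edge to \<open>g<y>\<close> and back over the edge at
  \<open>gy\<close> to \<open>gy<x>\<close> contributes \<open>a g\<close> and then the inverse of
  \<open>a (g y)\<close>; a step by \<open>x\<close> stays at its vertex. The record depends a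
  priori on the word for \<open>g\<close>. It becomes a function of \<open>g\<close> by following
  the orbit of \<open>(1, 1)\<close> under an action on pairs of a group element and a
  record.\<close>

lemma Gamma4_cocycle_exists:
  fixes L :: "('c, 'd) monoid_scheme"
  assumes m: "m \<ge> 1" and L: "group L" and a: "\<And>g. g \<in> carrier (Gamma4 m) \<Longrightarrow> a g \<in> carrier L"
    and az: "\<And>g. g \<in> carrier (Gamma4 m) \<Longrightarrow> a (g \<otimes>\<^bsub>Gamma4 m\<^esub> gx m [^]\<^bsub>Gamma4 m\<^esub> (2::nat)) = a g"
  obtains C where "C \<in> carrier (Gamma4 m) \<rightarrow> carrier L" "C \<one>\<^bsub>Gamma4 m\<^esub> = \<one>\<^bsub>L\<^esub>"
    "\<And>g. g \<in> carrier (Gamma4 m) \<Longrightarrow> C (g \<otimes>\<^bsub>Gamma4 m\<^esub> gx m) = C g"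
    "\<And>g. g \<in> carrier (Gamma4 m) \<Longrightarrow>
       C (g \<otimes>\<^bsub>Gamma4 m\<^esub> gy m) = C g \<otimes>\<^bsub>L\<^esub> a g \<otimes>\<^bsub>L\<^esub> inv\<^bsub>L\<^esub> a (g \<otimes>\<^bsub>Gamma4 m\<^esub> gy m)"
proof -
  let ?G = "Gamma4 m"
  interpret group ?G by (rule group_Gamma4)
  interpret L: group L by fact
  define f where "f = (\<lambda>(g, l :: 'c). (g \<otimes>\<^bsub>?G\<^esub> gx m, l))"
  define h where "h = (\<lambda>(g, l). (g \<otimes>\<^bsub>?G\<^esub> gy m, l \<otimes>\<^bsub>L\<^esub> a g \<otimes>\<^bsub>L\<^esub> inv\<^bsub>L\<^esub> a (g \<otimes>\<^bsub>?G\<^esub> gy m)))"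
  have fp: "(f ^^ k) (g, l) = (g \<otimes>\<^bsub>?G\<^esub> gx m [^]\<^bsub>?G\<^esub> k, l)" if "g \<in> carrier ?G" for k g l
    by (induction k) (use that in \<open>auto simp: f_def m_assoc\<close>)
  \<comment> \<open>The inner factors telescope along a power of \<open>y\<close>.\<close>
  have hp: "(h ^^ k) (g, l) = (g \<otimes>\<^bsub>?G\<^esub> gy m [^]\<^bsub>?G\<^esub> k, l \<otimes>\<^bsub>L\<^esub> a g \<otimes>\<^bsub>L\<^esub> inv\<^bsub>L\<^esub> a (g \<otimes>\<^bsub>?G\<^esub> gy m [^]\<^bsub>?G\<^esub> k))"
    if gl: "g \<in> carrier ?G" "l \<in> carrier L" for k g l
  proof (induction k)
    case 0
    then show ?case using gl a by (simp add: L.m_assoc)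
  next
    case (Suc k)
    have "inv\<^bsub>L\<^esub> a (g \<otimes>\<^bsub>?G\<^esub> gy m [^]\<^bsub>?G\<^esub> k) \<otimes>\<^bsub>L\<^esub> (a (g \<otimes>\<^bsub>?G\<^esub> gy m [^]\<^bsub>?G\<^esub> k) \<otimes>\<^bsub>L\<^esub> u) = u"
      if "u \<in> carrier L" for u
      using gl a that by (simp flip: L.m_assoc)
    then show ?case using Suc gl a by (simp add: h_def m_assoc L.m_assoc)
  qed
  interpret gamma_action m "carrier ?G \<times> carrier L" f h
  proof
    show "f \<in> carrier ?G \<times> carrier L \<rightarrow> carrier ?G \<times> carrier L" by (auto simp: f_def)
    show "h \<in> carrier ?G \<times> carrier L \<rightarrow> carrier ?G \<times> carrier L" using a by (auto simp: h_def)
    fix s assume "s \<in> carrier ?G \<times> carrier L"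
    then obtain g l where s: "s = (g, l)" and gl: "g \<in> carrier ?G" "l \<in> carrier L" by blast
    have inv: "l \<otimes>\<^bsub>L\<^esub> a g \<otimes>\<^bsub>L\<^esub> inv\<^bsub>L\<^esub> a g = l" using gl a by (simp add: L.m_assoc)
    show "(f ^^ (2 * m)) s = s" using s gl by (simp add: fp gx_pow)
    show "(h ^^ (4 * m)) s = s" using s gl inv by (simp add: hp gy_pow)
    \<comment> \<open>Invariance of \<open>a\<close> under \<open>x^2\<close> makes the telescoped
      factor of \<open>y^4\<close> trivial, in accordance with the step by \<open>x^2\<close>, which
      leaves the record unchanged.\<close>
    have "a (g \<otimes>\<^bsub>?G\<^esub> gy m [^]\<^bsub>?G\<^esub> (4::nat)) = a g" using az[OF gl(1)] by (simp add: gx_gy_pow)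
    then show "(f ^^ 2) s = (h ^^ 4) s" unfolding s fp[OF gl(1)] hp[OF gl] gx_gy_pow using inv by simp
  qed fact
  define e where "e = (\<one>\<^bsub>?G\<^esub>, \<one>\<^bsub>L\<^esub>)"
  have e: "e \<in> carrier ?G \<times> carrier L" by (simp add: e_def)
  have gopx: "gamma_op m f h (g \<otimes>\<^bsub>?G\<^esub> gx m) e = f (gamma_op m f h g e)" if "g \<in> carrier ?G" for g
    using that e gamma_op_closed by (simp add: gamma_op_mult gamma_op_gx)
  have gopy: "gamma_op m f h (g \<otimes>\<^bsub>?G\<^esub> gy m) e = h (gamma_op m f h g e)" if "g \<in> carrier ?G" for g
    using that e gamma_op_closed by (simp add: gamma_op_mult gamma_op_gy)
  \<comment> \<open>The first component reproduces the group element, so that in the step for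
    \<open>y\<close> the map \<open>a\<close> is evaluated at \<open>g\<close> itself.\<close>
  have "carrier ?G \<subseteq> {g. fst (gamma_op m f h g e) = g}"
  proof (rule Gamma4_induct[OF m])
    have "fst (f s) = fst s \<otimes>\<^bsub>?G\<^esub> gx m" "fst (h s) = fst s \<otimes>\<^bsub>?G\<^esub> gy m" for s
      by (simp_all add: f_def h_def split: prod.split)
    then show "\<forall>g\<in>{g. fst (gamma_op m f h g e) = g} \<inter> carrier ?G. g \<otimes>\<^bsub>?G\<^esub> gx m \<in> {g. fst (gamma_op m f h g e) = g}"
      "\<forall>g\<in>{g. fst (gamma_op m f h g e) = g} \<inter> carrier ?G. g \<otimes>\<^bsub>?G\<^esub> gy m \<in> {g. fst (gamma_op m f h g e) = g}"
      by (simp_all add: gopx gopy)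
    show "\<one>\<^bsub>?G\<^esub> \<in> {g. fst (gamma_op m f h g e) = g}" using gamma_op_one[OF e] by (simp add: e_def)
  qed
  then have fst: "fst (gamma_op m f h g e) = g" if "g \<in> carrier ?G" for g using that by blast
  have snd: "snd (f s) = snd s"
    "snd (h s) = snd s \<otimes>\<^bsub>L\<^esub> a (fst s) \<otimes>\<^bsub>L\<^esub> inv\<^bsub>L\<^esub> a (fst s \<otimes>\<^bsub>?G\<^esub> gy m)" for s
    by (simp_all add: f_def h_def split: prod.split)
  show ?thesis
  proof (rule that[of "\<lambda>g. snd (gamma_op m f h g e)"])
    show "(\<lambda>g. snd (gamma_op m f h g e)) \<in> carrier ?G \<rightarrow> carrier L"
      using gamma_op_closed[OF _ e] by (auto simp: mem_Times_iff)
    show "snd (gamma_op m f h \<one>\<^bsub>?G\<^esub> e) = \<one>\<^bsub>L\<^esub>" using e by (simp add: gamma_op_one e_def)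
    show "snd (gamma_op m f h (g \<otimes>\<^bsub>?G\<^esub> gx m) e) = snd (gamma_op m f h g e)" if "g \<in> carrier ?G" for g
      using that by (simp add: gopx snd)
    show "snd (gamma_op m f h (g \<otimes>\<^bsub>?G\<^esub> gy m) e) =
        snd (gamma_op m f h g e) \<otimes>\<^bsub>L\<^esub> a g \<otimes>\<^bsub>L\<^esub> inv\<^bsub>L\<^esub> a (g \<otimes>\<^bsub>?G\<^esub> gy m)" if "g \<in> carrier ?G" for g
      using that by (simp add: gopy snd fst)
  qed
qed

text \<open>Words act on \<open>G\<close> by right multiplication, and the value of a class is what
  it makes of the identity.\<close>

lemma free_group_eval_exists:
  fixes G :: "('a, 'b) monoid_scheme"
  assumes G: "group G" and S: "S \<subseteq> carrier G"
  obtains \<phi> where "\<phi> \<in> hom (free_group S) G" "\<And>s. s \<in> S \<Longrightarrow> \<phi> (word_class S {} [(s, True)]) = s"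
proof -
  interpret group G by fact
  define act where "act c g = g \<otimes>\<^bsub>G\<^esub> (if snd c then fst c else inv\<^bsub>G\<^esub> fst c)" for c :: "'a \<times> bool" and g
  interpret word_action S "{}" "carrier G" act
    by standard (use S in \<open>auto simp: act_def m_assoc subset_iff\<close>)
  \<comment> \<open>Right multiplications commute with left ones; this turns the composition of two
    actions into a product of values.\<close>
  have left: "fold act w g = g \<otimes>\<^bsub>G\<^esub> fold act w \<one>\<^bsub>G\<^esub>" if "w \<in> words S" "g \<in> carrier G" for w g
    using that
  proof (induction w arbitrary: g)
    case (Cons c w)
    have c: "act c g \<in> carrier G" "act c \<one>\<^bsub>G\<^esub> \<in> carrier G" "act c g = g \<otimes>\<^bsub>G\<^esub> act c \<one>\<^bsub>G\<^esub>" "w \<in> words S"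
      using Cons.prems S by (auto simp: act_def)
    show ?case
      using Cons.IH[OF c(4,1)] Cons.IH[OF c(4,2)] c Cons.prems fold_act_closed[OF c(4) one_closed]
      by (simp add: m_assoc)
  qed simp
  show ?thesis
  proof (rule that[of "\<lambda>A. class_act A \<one>\<^bsub>G\<^esub>"])
    show "(\<lambda>A. class_act A \<one>\<^bsub>G\<^esub>) \<in> hom (free_group S) G"
    proof (rule homI)
      fix A B assume AB: "A \<in> carrier (free_group S)" "B \<in> carrier (free_group S)"
      then obtain v where v: "v \<in> words S" "B = word_class S {} v"
        by (auto simp: free_group_def carrier_presented_group)
      have A: "class_act A \<one>\<^bsub>G\<^esub> \<in> carrier G" using AB by (simp add: free_group_def class_act_closed)
      have "class_act (A \<otimes>\<^bsub>free_group S\<^esub> B) \<one>\<^bsub>G\<^esub> = class_act B (class_act A \<one>\<^bsub>G\<^esub>)"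
        using AB by (simp add: free_group_def class_act_mult)
      also have "\<dots> = class_act A \<one>\<^bsub>G\<^esub> \<otimes>\<^bsub>G\<^esub> class_act B \<one>\<^bsub>G\<^esub>"
        using v A left[OF v(1) A] by (simp add: class_act_word_class)
      finally show "class_act (A \<otimes>\<^bsub>free_group S\<^esub> B) \<one>\<^bsub>G\<^esub> = class_act A \<one>\<^bsub>G\<^esub> \<otimes>\<^bsub>G\<^esub> class_act B \<one>\<^bsub>G\<^esub>" .
    qed (simp add: free_group_def class_act_closed)
    show "class_act (word_class S {} [(s, True)]) \<one>\<^bsub>G\<^esub> = s" if "s \<in> S" for s
      using that S by (auto simp: class_act_letter act_def)
  qed
qed

lemma free_group_subset_generated:
  assumes sub: "subgroup K (free_group S)" and gens: "\<And>s. s \<in> S \<Longrightarrow> word_class S {} [(s, True)] \<in> K"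
  shows "carrier (free_group S) \<subseteq> K"
proof -
  interpret group "free_group S" unfolding free_group_def by (rule group_presented_group)
  have letter: "word_class S {} [(s, e)] \<in> K" if "s \<in> S" for s e
  proof (cases e)
    case False
    have "word_class S {} [(s, False)] = inv\<^bsub>free_group S\<^esub> word_class S {} [(s, True)]"
      using word_class_inverse_letter[of s S "{}" True] that by (simp add: free_group_def)
    then show ?thesis using False gens[OF that] sub by (simp add: subgroup.m_inv_closed)
  qed (use gens that in simp)
  have "word_class S {} w \<in> K" if "w \<in> words S" for w
    using that
  proof (induction w)
    case Nil
    then show ?case using subgroup.one_closed[OF sub] by (simp add: free_group_def one_presented_group)
  next
    case (Cons c w)
    then have "word_class S {} (c # w) = word_class S {} [c] \<otimes>\<^bsub>free_group S\<^esub> word_class S {} w"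
      using word_class_append[of "[c]" S w "{}"] by (simp add: free_group_def)
    moreover have "word_class S {} [c] \<in> K" using letter[of "fst c" "snd c"] Cons.prems by simp
    ultimately show ?case using Cons sub by (simp add: subgroup.m_closed)
  qed
  then show ?thesis by (auto simp: free_group_def carrier_presented_group)
qed

lemma (in group) subgroup_image_hom:
  assumes "group L" "subgroup H G" "C \<in> hom (G\<lparr>carrier := H\<rparr>) L"
  shows "subgroup (C ` H) L"
proof -
  interpret group_hom "G\<lparr>carrier := H\<rparr>" L C
    using assms subgroup.subgroup_is_group[OF assms(2) is_group] by (simp add: group_hom_def group_hom_axioms_def)
  show ?thesis using img_is_subgroup by simp
qed

text \<open>An element of \<open>H\<close> moving \<open>g\<close> into the lift exists by covering
  and is unique by freeness. The other rules follow from uniqueness; for the last one,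
  \<open>k g h^-1\<close> already carries \<open>h g\<close> into \<open>U\<close>.\<close>

lemma (in tree_setting) lift_shift:
  assumes t: "\<forall>g\<in>U. \<forall>a\<in>K. g \<otimes> a \<in> U" "\<forall>g\<in>U. \<forall>h\<in>H. h \<otimes> g \<in> U \<longrightarrow> h = \<one>" "U \<subseteq> carrier G"
    and ex: "\<And>g. g \<in> carrier G \<Longrightarrow> \<exists>h\<in>H. h \<otimes> g \<in> U" and K: "K \<subseteq> carrier G"
  obtains k where "\<And>g. g \<in> carrier G \<Longrightarrow> k g \<in> H" "\<And>g. g \<in> carrier G \<Longrightarrow> k g \<otimes> g \<in> U"
    "\<And>g h. g \<in> carrier G \<Longrightarrow> h \<in> H \<Longrightarrow> h \<otimes> g \<in> U \<Longrightarrow> k g = h"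
    "\<And>g a. g \<in> carrier G \<Longrightarrow> a \<in> K \<Longrightarrow> k (g \<otimes> a) = k g"
    "\<And>g h. g \<in> carrier G \<Longrightarrow> h \<in> H \<Longrightarrow> k (h \<otimes> g) = k g \<otimes> inv h"
proof -
  define k where "k g = (SOME h. h \<in> H \<and> h \<otimes> g \<in> U)" for g
  have k: "k g \<in> H \<and> k g \<otimes> g \<in> U" if "g \<in> carrier G" for g
    unfolding k_def by (rule someI_ex) (use ex[OF that] in blast)
  have uniq: "k g = h" if g: "g \<in> carrier G" and h: "h \<in> H" "h \<otimes> g \<in> U" for g h
  proof -
    have c: "k g \<in> carrier G" "h \<in> carrier G" using k g h H_carrier by auto
    have "k g \<otimes> inv h \<in> H" using k g h H by (simp add: subgroup.m_closed subgroup.m_inv_closed)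
    moreover have "k g \<otimes> inv h \<otimes> (h \<otimes> g) = k g \<otimes> g" using c g by (simp add: m_assoc flip: m_assoc[of "inv h"])
    ultimately have "k g \<otimes> inv h = \<one>" using t(2) h k[OF g] by metis
    then have "k g \<otimes> inv h \<otimes> h = h" using c by simp
    then show ?thesis using c by (simp add: m_assoc)
  qed
  show ?thesis
  proof (rule that[of k])
    fix g a assume ga: "g \<in> carrier G" "a \<in> K"
    then have "k g \<otimes> g \<otimes> a \<in> U" using k t(1) by blast
    moreover have "k g \<otimes> g \<otimes> a = k g \<otimes> (g \<otimes> a)" using ga k H_carrier K by (auto simp: m_assoc)
    ultimately show "k (g \<otimes> a) = k g" using uniq[of "g \<otimes> a" "k g"] ga k K by auto
  next
    fix g h assume gh: "g \<in> carrier G" "h \<in> H"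
    have "k g \<otimes> inv h \<otimes> (h \<otimes> g) = k g \<otimes> g"
      using gh k H_carrier by (simp add: m_assoc flip: m_assoc[of "inv h"])
    moreover have "k g \<otimes> inv h \<in> H" using k gh H by (simp add: subgroup.m_closed subgroup.m_inv_closed)
    ultimately show "k (h \<otimes> g) = k g \<otimes> inv h"
      using uniq[of "h \<otimes> g" "k g \<otimes> inv h"] gh k[OF gh(1)] H_carrier by simp
  qed (use k uniq in auto)
qed

text \<open>
  Let \<open>kX g \<in> H\<close> move the coset \<open>g\<langle>x\<rangle>\<close> into the lifted tree and \<open>kY g\<close> do this for \<open>g\<langle>y\<rangle>\<close>. The elements
  \<open>\<tau> g = kX g \<otimes> inv kY g\<close> measure how the edge \<open>g\<langle>x\<^sup>2\<rangle>\<close> fails to lie in the lifted tree, and the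
  nontrivial ones are a basis of \<open>H\<close>: the cocycle \<open>C\<close> expresses an element of \<open>H\<close> in them, by recording
  the edges that are crossed.
\<close>

lemma is_free_subgroup_Gamma4:
  assumes m: "m \<ge> 1" and H: "subgroup H (Gamma4 m)" and fin: "finite (rcosets\<^bsub>Gamma4 m\<^esub> H)"
    and HX: "\<And>g k. g \<in> carrier (Gamma4 m) \<Longrightarrow>
      g \<otimes>\<^bsub>Gamma4 m\<^esub> gx m [^]\<^bsub>Gamma4 m\<^esub> (k::nat) \<otimes>\<^bsub>Gamma4 m\<^esub> inv\<^bsub>Gamma4 m\<^esub> g \<in> H \<Longrightarrow> gx m [^]\<^bsub>Gamma4 m\<^esub> k = \<one>\<^bsub>Gamma4 m\<^esub>"
    and HY: "\<And>g k. g \<in> carrier (Gamma4 m) \<Longrightarrow>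
      g \<otimes>\<^bsub>Gamma4 m\<^esub> gy m [^]\<^bsub>Gamma4 m\<^esub> (k::nat) \<otimes>\<^bsub>Gamma4 m\<^esub> inv\<^bsub>Gamma4 m\<^esub> g \<in> H \<Longrightarrow> gy m [^]\<^bsub>Gamma4 m\<^esub> k = \<one>\<^bsub>Gamma4 m\<^esub>"
  shows "is_free (Gamma4 m\<lparr>carrier := H\<rparr>)"
proof -
  define G where "G = Gamma4 m"
  define x where "x = gx m"
  define y where "y = gy m"
  define A where "A = range (\<lambda>k::nat. x [^]\<^bsub>G\<^esub> k)"
  define B where "B = range (\<lambda>k::nat. y [^]\<^bsub>G\<^esub> k)"
  note defs = G_def x_def y_def
  interpret group G unfolding G_def by (rule group_Gamma4)
  have x [simp]: "x \<in> carrier G" and y [simp]: "y \<in> carrier G" by (simp_all add: defs)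
  have xA: "x \<in> A" "x [^]\<^bsub>G\<^esub> (2::nat) \<in> A" unfolding A_def
    by (rule range_eqI[of _ _ "1::nat"], simp) blast
  have yB: "y \<in> B" "x [^]\<^bsub>G\<^esub> (2::nat) \<in> B" unfolding B_def
    by (rule range_eqI[of _ _ "1::nat"], simp) (simp add: defs gx_gy_pow)
  have subA: "subgroup A G" unfolding A_def
    by (rule subgroup_range_pow[of _ "2 * m"]) (use m gx_pow in \<open>simp_all add: defs\<close>)
  have subB: "subgroup B G" unfolding B_def
    by (rule subgroup_range_pow[of _ "4 * m"]) (use m gy_pow in \<open>simp_all add: defs\<close>)
  have induct: "carrier G \<subseteq> W" if "\<one>\<^bsub>G\<^esub> \<in> W" "\<And>g. g \<in> W \<Longrightarrow> g \<in> carrier G \<Longrightarrow> g \<otimes>\<^bsub>G\<^esub> x \<in> W"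
    "\<And>g. g \<in> W \<Longrightarrow> g \<in> carrier G \<Longrightarrow> g \<otimes>\<^bsub>G\<^esub> y \<in> W" for W
    using Gamma4_induct[OF m, of W] that by (simp add: defs)
  interpret tree_setting G H A B
  proof (intro tree_setting.intro tree_setting_axioms.intro is_group subA subB)
    show "subgroup H G" "finite (rcosets\<^bsub>G\<^esub> H)" using H fin by (simp_all add: defs)
    show "\<forall>g\<in>carrier G. \<forall>a\<in>A. g \<otimes>\<^bsub>G\<^esub> a \<otimes>\<^bsub>G\<^esub> inv\<^bsub>G\<^esub> g \<in> H \<longrightarrow> a = \<one>\<^bsub>G\<^esub>"
      "\<forall>g\<in>carrier G. \<forall>b\<in>B. g \<otimes>\<^bsub>G\<^esub> b \<otimes>\<^bsub>G\<^esub> inv\<^bsub>G\<^esub> g \<in> H \<longrightarrow> b = \<one>\<^bsub>G\<^esub>"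
      using HX HY by (auto simp: A_def B_def defs)
    show "carrier G \<subseteq> W" if "\<one>\<^bsub>G\<^esub> \<in> W" "\<forall>g\<in>W \<inter> carrier G. \<forall>a\<in>A \<union> B. g \<otimes>\<^bsub>G\<^esub> a \<in> W" for W
      using that xA yB by (intro induct) auto
  qed
  obtain U V where tree: "lifted_tree G H A B {\<one>\<^bsub>G\<^esub>} {} U V"
    and exU: "\<And>g. g \<in> carrier G \<Longrightarrow> \<exists>h\<in>H. h \<otimes>\<^bsub>G\<^esub> g \<in> U"
    and exV: "\<And>g. g \<in> carrier G \<Longrightarrow> \<exists>h\<in>H. h \<otimes>\<^bsub>G\<^esub> g \<in> V"
    using lifted_spanning_tree by blast
  have UV: "U \<subseteq> carrier G" "V \<subseteq> carrier G" "\<one>\<^bsub>G\<^esub> \<in> U"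
    and UA: "\<forall>g\<in>U. \<forall>a\<in>A. g \<otimes>\<^bsub>G\<^esub> a \<in> U" and VB: "\<forall>g\<in>V. \<forall>b\<in>B. g \<otimes>\<^bsub>G\<^esub> b \<in> V"
    and U1: "\<forall>g\<in>U. \<forall>h\<in>H. h \<otimes>\<^bsub>G\<^esub> g \<in> U \<longrightarrow> h = \<one>\<^bsub>G\<^esub>"
    and V1: "\<forall>g\<in>V. \<forall>h\<in>H. h \<otimes>\<^bsub>G\<^esub> g \<in> V \<longrightarrow> h = \<one>\<^bsub>G\<^esub>"
    and con: "lift_connected G A B {\<one>\<^bsub>G\<^esub>} {} U V"
    using tree unfolding lifted_tree_def by - (elim conjE, assumption | elim conjE, simp)+
  have AB: "A \<subseteq> carrier G" "B \<subseteq> carrier G" using A_carrier B_carrier by auto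
  obtain kX where kX: "\<And>g. g \<in> carrier G \<Longrightarrow> kX g \<in> H" "\<And>g. g \<in> carrier G \<Longrightarrow> kX g \<otimes>\<^bsub>G\<^esub> g \<in> U"
    and kX_eq: "\<And>g h. g \<in> carrier G \<Longrightarrow> h \<in> H \<Longrightarrow> h \<otimes>\<^bsub>G\<^esub> g \<in> U \<Longrightarrow> kX g = h"
    and kX_A: "\<And>g a. g \<in> carrier G \<Longrightarrow> a \<in> A \<Longrightarrow> kX (g \<otimes>\<^bsub>G\<^esub> a) = kX g"
    and kX_H: "\<And>g h. g \<in> carrier G \<Longrightarrow> h \<in> H \<Longrightarrow> kX (h \<otimes>\<^bsub>G\<^esub> g) = kX g \<otimes>\<^bsub>G\<^esub> inv\<^bsub>G\<^esub> h"
    using lift_shift[OF UA U1 UV(1) exU AB(1)] by blast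
  obtain kY where kY: "\<And>g. g \<in> carrier G \<Longrightarrow> kY g \<in> H" "\<And>g. g \<in> carrier G \<Longrightarrow> kY g \<otimes>\<^bsub>G\<^esub> g \<in> V"
    and kY_eq: "\<And>g h. g \<in> carrier G \<Longrightarrow> h \<in> H \<Longrightarrow> h \<otimes>\<^bsub>G\<^esub> g \<in> V \<Longrightarrow> kY g = h"
    and kY_B: "\<And>g a. g \<in> carrier G \<Longrightarrow> a \<in> B \<Longrightarrow> kY (g \<otimes>\<^bsub>G\<^esub> a) = kY g"
    and kY_H: "\<And>g h. g \<in> carrier G \<Longrightarrow> h \<in> H \<Longrightarrow> kY (h \<otimes>\<^bsub>G\<^esub> g) = kY g \<otimes>\<^bsub>G\<^esub> inv\<^bsub>G\<^esub> h"
    using lift_shift[OF VB V1 UV(2) exV AB(2)] by blast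
  have kXc [simp]: "kX g \<in> carrier G" and kYc [simp]: "kY g \<in> carrier G" if "g \<in> carrier G" for g
    using kX kY H_carrier that by auto
  have one_H: "\<one>\<^bsub>G\<^esub> \<in> H" using subgroup.one_closed[OF tree_setting.H[OF tree_setting_axioms]] .
  define \<tau> where "\<tau> g = kX g \<otimes>\<^bsub>G\<^esub> inv\<^bsub>G\<^esub> kY g" for g
  have \<tau>H: "\<tau> g \<in> H" if "g \<in> carrier G" for g
    using that kX kY H by (simp add: \<tau>_def defs subgroup.m_closed subgroup.m_inv_closed)
  have \<tau>c [simp]: "\<tau> g \<in> carrier G" if "g \<in> carrier G" for g using that by (simp add: \<tau>_def)
  \<comment> \<open>The factors \<open>inv h\<close> from \<open>kX\<close> and \<open>h\<close>
    from the inverse of \<open>kY\<close> cancel. Together with \<open>\<tau>_z\<close> this makes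
    \<open>\<tau>\<close> a function on the edges of the quotient by \<open>H\<close>.\<close>
  have \<tau>_H: "\<tau> (h \<otimes>\<^bsub>G\<^esub> g) = \<tau> g" if "g \<in> carrier G" "h \<in> H" for g h
    using that H_carrier by (simp add: \<tau>_def kX_H kY_H inv_mult_group m_assoc flip: m_assoc[of "inv\<^bsub>G\<^esub> h"])
  have \<tau>_z: "\<tau> (g \<otimes>\<^bsub>G\<^esub> x [^]\<^bsub>G\<^esub> (2::nat)) = \<tau> g" if "g \<in> carrier G" for g
    using that xA yB by (simp add: \<tau>_def kX_A kY_B)
  \<comment> \<open>Edges of the lifted tree have the value \<open>1\<close> and yield no generator.
    The generators are values of \<open>\<tau>\<close> rather than edges, so that \<open>S\<close>
    is a set of elements of \<open>H\<close>.\<close>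
  define S where "S = \<tau> ` carrier G - {\<one>\<^bsub>G\<^esub>}"
  have S: "S \<subseteq> H" using \<tau>H by (auto simp: S_def)
  define L where "L = free_group S"
  define a where "a g = (if \<tau> g = \<one>\<^bsub>G\<^esub> then \<one>\<^bsub>L\<^esub> else word_class S {} [(\<tau> g, True)])" for g
  interpret L: group L unfolding L_def free_group_def by (rule group_presented_group)
  have ac: "a g \<in> carrier L" if "g \<in> carrier G" for g
  proof (cases "\<tau> g = \<one>\<^bsub>G\<^esub>")
    case False
    then have "\<tau> g \<in> S" using that by (simp add: S_def)
    then have "word_class S {} [(\<tau> g, True)] \<in> carrier L" by (simp add: L_def free_group_def)
    then show ?thesis using False by (simp add: a_def)
  qed (simp add: a_def)
  have a_H: "a (h \<otimes>\<^bsub>G\<^esub> g) = a g" if "g \<in> carrier G" "h \<in> H" for g h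
    using that by (simp add: a_def \<tau>_H)
  have a_z: "a (g \<otimes>\<^bsub>G\<^esub> x [^]\<^bsub>G\<^esub> (2::nat)) = a g" if "g \<in> carrier G" for g
    using that by (simp add: a_def \<tau>_z)
  obtain C where C: "C \<in> carrier G \<rightarrow> carrier L" "C \<one>\<^bsub>G\<^esub> = \<one>\<^bsub>L\<^esub>"
    and Cx: "\<And>g. g \<in> carrier G \<Longrightarrow> C (g \<otimes>\<^bsub>G\<^esub> x) = C g"
    and Cy: "\<And>g. g \<in> carrier G \<Longrightarrow> C (g \<otimes>\<^bsub>G\<^esub> y) = C g \<otimes>\<^bsub>L\<^esub> a g \<otimes>\<^bsub>L\<^esub> inv\<^bsub>L\<^esub> a (g \<otimes>\<^bsub>G\<^esub> y)"
    using Gamma4_cocycle_exists[OF m L.is_group, of a] ac a_z unfolding defs by blast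
  have Cc: "C g \<in> carrier L" if "g \<in> carrier G" for g using C that by auto
  \<comment> \<open>The increments of \<open>C\<close> are built from \<open>a\<close>, which is
    unchanged by left multiplication with \<open>H\<close>: from \<open>h\<close> to
    \<open>h g\<close> the same crossings are recorded as from \<open>1\<close> to
    \<open>g\<close>.\<close>
  have C_H: "C (h \<otimes>\<^bsub>G\<^esub> g) = C h \<otimes>\<^bsub>L\<^esub> C g" if h: "h \<in> H" and "g \<in> carrier G" for h g
  proof -
    have hc: "h \<in> carrier G" using h H_carrier by blast
    have "carrier G \<subseteq> {g. C (h \<otimes>\<^bsub>G\<^esub> g) = C h \<otimes>\<^bsub>L\<^esub> C g}"
    proof (rule induct; clarify)
      show "C (h \<otimes>\<^bsub>G\<^esub> \<one>\<^bsub>G\<^esub>) = C h \<otimes>\<^bsub>L\<^esub> C \<one>\<^bsub>G\<^esub>" using hc C Cc by simp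
      fix g assume g: "C (h \<otimes>\<^bsub>G\<^esub> g) = C h \<otimes>\<^bsub>L\<^esub> C g" "g \<in> carrier G"
      show "C (h \<otimes>\<^bsub>G\<^esub> (g \<otimes>\<^bsub>G\<^esub> x)) = C h \<otimes>\<^bsub>L\<^esub> C (g \<otimes>\<^bsub>G\<^esub> x)"
        using Cx[of "h \<otimes>\<^bsub>G\<^esub> g"] Cx[of g] g hc by (simp add: m_assoc)
      show "C (h \<otimes>\<^bsub>G\<^esub> (g \<otimes>\<^bsub>G\<^esub> y)) = C h \<otimes>\<^bsub>L\<^esub> C (g \<otimes>\<^bsub>G\<^esub> y)"
        using Cy[of "h \<otimes>\<^bsub>G\<^esub> g"] Cy[of g] g hc h a_H[of g h] a_H[of "g \<otimes>\<^bsub>G\<^esub> y" h] ac Cc by (simp add: m_assoc L.m_assoc)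
    qed
    then show ?thesis using that by blast
  qed
  \<comment> \<open>Connectedness is applied to the sets where \<open>C\<close> takes the value
    expected inside the lift: \<open>1\<close> on \<open>U\<close>, and \<open>inv a g\<close> on
    \<open>V\<close>, because \<open>C\<close> refers to the vertex \<open>g<x>\<close> and the edge
    at \<open>g\<close> still has to be crossed to get there from \<open>g<y>\<close>.\<close>
  have tree_C: "U \<subseteq> {g. C g = \<one>\<^bsub>L\<^esub>} \<and> V \<subseteq> {g. C g = inv\<^bsub>L\<^esub> a g}"
  proof (rule con[unfolded lift_connected_def, rule_format])
    show "{\<one>\<^bsub>G\<^esub>} \<subseteq> {g. C g = \<one>\<^bsub>L\<^esub>}" using C by simp
  next
    fix g b assume g: "g \<in> {g. C g = \<one>\<^bsub>L\<^esub>} \<inter> carrier G" and b: "b \<in> A"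
    obtain k :: nat where "b = x [^]\<^bsub>G\<^esub> k" using b by (auto simp: A_def)
    then show "g \<otimes>\<^bsub>G\<^esub> b \<in> {g. C g = \<one>\<^bsub>L\<^esub>}"
      using pow_closed_right[of "{g. C g = \<one>\<^bsub>L\<^esub>}" x g k] g Cx by simp
  next
    fix g b assume g: "g \<in> {g. C g = inv\<^bsub>L\<^esub> a g} \<inter> carrier G" and b: "b \<in> B"
    obtain k :: nat where "b = y [^]\<^bsub>G\<^esub> k" using b by (auto simp: B_def)
    moreover have "C (g \<otimes>\<^bsub>G\<^esub> y) = inv\<^bsub>L\<^esub> a (g \<otimes>\<^bsub>G\<^esub> y)" if "C g = inv\<^bsub>L\<^esub> a g" "g \<in> carrier G" for g
      using that Cy ac by simp
    ultimately show "g \<otimes>\<^bsub>G\<^esub> b \<in> {g. C g = inv\<^bsub>L\<^esub> a g}"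
      using pow_closed_right[of "{g. C g = inv\<^bsub>L\<^esub> a g}" y g k] g by simp
  next
    fix g assume g: "g \<in> U \<inter> V"
    then have "kX g = \<one>\<^bsub>G\<^esub>" "kY g = \<one>\<^bsub>G\<^esub>"
      using g UV one_H kX_eq[of g "\<one>\<^bsub>G\<^esub>"] kY_eq[of g "\<one>\<^bsub>G\<^esub>"] by (simp_all add: subset_iff)
    then have "\<tau> g = \<one>\<^bsub>G\<^esub>" by (simp add: \<tau>_def)
    then show "g \<in> {g. C g = \<one>\<^bsub>L\<^esub>} \<longleftrightarrow> g \<in> {g. C g = inv\<^bsub>L\<^esub> a g}" by (simp add: a_def)
  qed simp
  \<comment> \<open>The elements \<open>u\<close> and \<open>v\<close> are the translates of
    \<open>g\<close> into the two halves of the lift, and \<open>u = \<tau> g v\<close>; comparing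
    the values of \<open>C\<close> isolates \<open>a g\<close>.\<close>
  have C_\<tau>: "C (\<tau> g) = a g" if g: "g \<in> carrier G" for g
  proof -
    define u where "u = kX g \<otimes>\<^bsub>G\<^esub> g"
    define v where "v = kY g \<otimes>\<^bsub>G\<^esub> g"
    have uv: "u \<in> carrier G" "v \<in> carrier G" using g by (simp_all add: u_def v_def)
    have "u = \<tau> g \<otimes>\<^bsub>G\<^esub> v"
      using g by (simp add: u_def v_def \<tau>_def m_assoc flip: m_assoc[of "inv\<^bsub>G\<^esub> kY g"])
    then have "C (\<tau> g) \<otimes>\<^bsub>L\<^esub> C v = \<one>\<^bsub>L\<^esub>"
      using C_H[OF \<tau>H[OF g] uv(2)] tree_C kX(2)[OF g] by (auto simp: u_def)
    moreover have "C v = inv\<^bsub>L\<^esub> a g" using tree_C kY[OF g] a_H[OF g] by (auto simp: v_def)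
    ultimately have "C (\<tau> g) \<otimes>\<^bsub>L\<^esub> inv\<^bsub>L\<^esub> a g = \<one>\<^bsub>L\<^esub>" by simp
    then show ?thesis using ac[OF g] Cc[OF \<tau>c[OF g]] L.inv_solve_right'[of "\<one>\<^bsub>L\<^esub>" "C (\<tau> g)" "a g"] by simp
  qed
  obtain \<phi> where \<phi>: "\<phi> \<in> hom L G" and \<phi>S: "\<And>s. s \<in> S \<Longrightarrow> \<phi> (word_class S {} [(s, True)]) = s"
    using free_group_eval_exists[OF is_group, of S] S H_carrier unfolding L_def by blast
  interpret \<phi>: group_hom L G \<phi> using \<phi> by unfold_locales
  have \<phi>a: "\<phi> (a g) = \<tau> g" if "g \<in> carrier G" for g
    using that \<phi>S by (auto simp: a_def S_def)
  \<comment> \<open>Evaluating the record in the group returns the inverse of the shift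
    \<open>kX\<close>. The shift of an element of \<open>H\<close> is its inverse, so
    \<open>\<phi>\<close> is a left inverse of \<open>C\<close> on \<open>H\<close>.\<close>
  have "carrier G \<subseteq> {g. \<phi> (C g) = inv\<^bsub>G\<^esub> kX g}"
  proof (rule induct; clarify)
    have "kX \<one>\<^bsub>G\<^esub> = \<one>\<^bsub>G\<^esub>" using UV one_H by (intro kX_eq) simp_all
    then show "\<phi> (C \<one>\<^bsub>G\<^esub>) = inv\<^bsub>G\<^esub> kX \<one>\<^bsub>G\<^esub>" using C by simp
    fix g assume g: "\<phi> (C g) = inv\<^bsub>G\<^esub> kX g" "g \<in> carrier G"
    show "\<phi> (C (g \<otimes>\<^bsub>G\<^esub> x)) = inv\<^bsub>G\<^esub> kX (g \<otimes>\<^bsub>G\<^esub> x)" using g xA by (simp add: Cx kX_A)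
    have "\<phi> (C (g \<otimes>\<^bsub>G\<^esub> y)) = inv\<^bsub>G\<^esub> kX g \<otimes>\<^bsub>G\<^esub> \<tau> g \<otimes>\<^bsub>G\<^esub> inv\<^bsub>G\<^esub> \<tau> (g \<otimes>\<^bsub>G\<^esub> y)"
      using g ac Cc by (simp add: Cy \<phi>a)
    also have "inv\<^bsub>G\<^esub> kX g \<otimes>\<^bsub>G\<^esub> \<tau> g = inv\<^bsub>G\<^esub> kY g"
      using g by (simp add: \<tau>_def flip: m_assoc)
    also have "inv\<^bsub>G\<^esub> \<tau> (g \<otimes>\<^bsub>G\<^esub> y) = kY g \<otimes>\<^bsub>G\<^esub> inv\<^bsub>G\<^esub> kX (g \<otimes>\<^bsub>G\<^esub> y)"
      using g yB kY_B[of g y] by (simp add: \<tau>_def inv_mult_group)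
    also have "inv\<^bsub>G\<^esub> kY g \<otimes>\<^bsub>G\<^esub> (kY g \<otimes>\<^bsub>G\<^esub> inv\<^bsub>G\<^esub> kX (g \<otimes>\<^bsub>G\<^esub> y)) = inv\<^bsub>G\<^esub> kX (g \<otimes>\<^bsub>G\<^esub> y)"
      using g by (simp flip: m_assoc)
    finally show "\<phi> (C (g \<otimes>\<^bsub>G\<^esub> y)) = inv\<^bsub>G\<^esub> kX (g \<otimes>\<^bsub>G\<^esub> y)" .
  qed
  then have \<phi>C: "\<phi> (C h) = h" if h: "h \<in> H" for h
  proof -
    have hc: "h \<in> carrier G" "inv\<^bsub>G\<^esub> h \<in> H" using h H H_carrier by (auto simp: defs subgroup.m_inv_closed)
    then have "kX h = inv\<^bsub>G\<^esub> h" using UV by (intro kX_eq) simp_all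
    then show ?thesis using hc \<open>carrier G \<subseteq> _\<close> by auto
  qed
  have hom: "C \<in> hom (G\<lparr>carrier := H\<rparr>) L"
    using C_H Cc H_carrier by (intro homI) auto
  have sub: "subgroup (C ` H) L"
    using subgroup_image_hom[OF L.is_group _ hom] H by (simp add: defs)
  have "carrier L \<subseteq> C ` H"
    unfolding L_def
  proof (rule free_group_subset_generated)
    show "subgroup (C ` H) (free_group S)" using sub by (simp add: L_def)
    fix s assume s: "s \<in> S"
    then obtain g where g: "g \<in> carrier G" "s = \<tau> g" "\<tau> g \<noteq> \<one>\<^bsub>G\<^esub>" by (auto simp: S_def)
    then show "word_class S {} [(s, True)] \<in> C ` H"
      using C_\<tau>[of g] \<tau>H[of g] by (intro image_eqI[of _ _ s]) (simp_all add: a_def)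
  qed
  moreover have "inj_on C H" using \<phi>C by (metis inj_onI)
  ultimately have "C \<in> iso (G\<lparr>carrier := H\<rparr>) L"
    using hom Cc H_carrier by (auto simp: iso_def bij_betw_def)
  then have "G\<lparr>carrier := H\<rparr> \<cong> free_group S" by (auto simp: is_iso_def L_def)
  moreover have "group (G\<lparr>carrier := H\<rparr>)" using H subgroup.subgroup_is_group is_group by (auto simp: defs)
  ultimately show ?thesis unfolding is_free_def G_def by blast
qed

subsection \<open>Free subgroups and regular actions\<close>

lemma is_free_torsion_free:
  fixes G :: "('a, 'b) monoid_scheme"
  assumes "is_free G" and A: "A \<in> carrier G" "A [^]\<^bsub>G\<^esub> (n::nat) = \<one>\<^bsub>G\<^esub>" "n > 0"
  shows "A = \<one>\<^bsub>G\<^esub>"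
proof -
  obtain S :: "'a set" and \<psi> where G: "group G" and \<psi>: "\<psi> \<in> iso G (free_group S)"
    using assms(1) by (auto simp: is_free_def is_iso_def)
  have F: "group (free_group S)" unfolding free_group_def by (rule group_presented_group)
  interpret group_hom G "free_group S" \<psi>
    using G F \<psi> by (simp add: group_hom_def group_hom_axioms_def iso_def)
  have "\<psi> A [^]\<^bsub>free_group S\<^esub> n = \<one>\<^bsub>free_group S\<^esub>" using A by (metis hom_nat_pow hom_one)
  then have "\<psi> A = \<psi> \<one>\<^bsub>G\<^esub>" using free_group_torsion_free[of "\<psi> A" S n] A by simp
  moreover have "inj_on \<psi> (carrier G)" using \<psi> by (simp add: iso_def bij_betw_def)
  ultimately show ?thesis using A monoid.one_closed[OF group.is_monoid[OF G]] by (blast dest: inj_onD)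
qed

text \<open>The power \<open>x^k\<close> fixes the coset \<open>Hg\<close> exactly if
  \<open>g x^k g^-1 \<in> H\<close>. Hence this condition prescribes the cycle lengths
  \<open>2m\<close> for \<open>x\<close> and \<open>4m\<close> for \<open>y\<close> on the cosets of
  \<open>H\<close>.\<close>

definition regular_subgroup :: "nat \<Rightarrow> gen word set set \<Rightarrow> bool" where
  "regular_subgroup m H \<longleftrightarrow> subgroup H (Gamma4 m) \<and>
     (\<forall>g\<in>carrier (Gamma4 m). \<forall>k::nat.
       (g \<otimes>\<^bsub>Gamma4 m\<^esub> gx m [^]\<^bsub>Gamma4 m\<^esub> k \<otimes>\<^bsub>Gamma4 m\<^esub> inv\<^bsub>Gamma4 m\<^esub> g \<in> H \<longleftrightarrow> 2 * m dvd k) \<and>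
       (g \<otimes>\<^bsub>Gamma4 m\<^esub> gy m [^]\<^bsub>Gamma4 m\<^esub> k \<otimes>\<^bsub>Gamma4 m\<^esub> inv\<^bsub>Gamma4 m\<^esub> g \<in> H \<longleftrightarrow> 4 * m dvd k))"

text \<open>A conjugate of a power of \<open>x\<close> has finite order, and a free group has no
  torsion.\<close>

lemma (in group) conj_pow_eq_one:
  assumes free: "is_free (G\<lparr>carrier := H\<rparr>)" and H: "subgroup H G"
    and x: "x \<in> carrier G" "x [^] (n::nat) = \<one>" "n > 0" and g: "g \<in> carrier G"
    and in_H: "g \<otimes> x [^] (k::nat) \<otimes> inv g \<in> H"
  shows "x [^] k = \<one>"
proof -
  have conj: "(g \<otimes> u \<otimes> inv g) [^] j = g \<otimes> u [^] j \<otimes> inv g" if u: "u \<in> carrier G" for u and j :: nat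
  proof (induction j)
    case (Suc j)
    have "inv g \<otimes> (g \<otimes> w) = w" if "w \<in> carrier G" for w using g that by (simp flip: m_assoc)
    then show ?case using Suc g u by (simp add: m_assoc)
  qed (use g in simp)
  have "(x [^] k) [^] n = \<one>" using x by (metis nat_pow_pow mult.commute nat_pow_one)
  then have "(g \<otimes> x [^] k \<otimes> inv g) [^] n = \<one>" using conj x g by simp
  then have "g \<otimes> x [^] k \<otimes> inv g = \<one>"
    using is_free_torsion_free[OF free, of "g \<otimes> x [^] k \<otimes> inv g" n] in_H x(3)
    by (simp flip: nat_pow_consistent)
  then have "g \<otimes> x [^] k = g" using g x by (metis inv_solve_right' l_one m_closed nat_pow_closed one_closed)
  then show ?thesis using g x by simp
qed

lemma free_iff_regular:
  assumes m: "m \<ge> 1" and H: "subgroup H (Gamma4 m)" and fin: "finite (rcosets\<^bsub>Gamma4 m\<^esub> H)"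
  shows "is_free (Gamma4 m\<lparr>carrier := H\<rparr>) \<longleftrightarrow> regular_subgroup m H"
proof
  interpret group "Gamma4 m" by (rule group_Gamma4)
  assume free: "is_free (Gamma4 m\<lparr>carrier := H\<rparr>)"
  show "regular_subgroup m H"
    unfolding regular_subgroup_def
  proof (intro conjI ballI allI H iffI)
    fix g k assume g: "g \<in> carrier (Gamma4 m)"
    show "2 * m dvd k" if "g \<otimes>\<^bsub>Gamma4 m\<^esub> gx m [^]\<^bsub>Gamma4 m\<^esub> k \<otimes>\<^bsub>Gamma4 m\<^esub> inv\<^bsub>Gamma4 m\<^esub> g \<in> H"
      using conj_pow_eq_one[OF free H _ gx_pow _ g that] m by (simp add: gx_pow_eq_one)
    show "4 * m dvd k" if "g \<otimes>\<^bsub>Gamma4 m\<^esub> gy m [^]\<^bsub>Gamma4 m\<^esub> k \<otimes>\<^bsub>Gamma4 m\<^esub> inv\<^bsub>Gamma4 m\<^esub> g \<in> H"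
      using conj_pow_eq_one[OF free H _ gy_pow _ g that] m by (simp add: gy_pow_eq_one)
    have "\<one>\<^bsub>Gamma4 m\<^esub> \<in> H" using H by (rule subgroup.one_closed)
    then show "g \<otimes>\<^bsub>Gamma4 m\<^esub> gx m [^]\<^bsub>Gamma4 m\<^esub> k \<otimes>\<^bsub>Gamma4 m\<^esub> inv\<^bsub>Gamma4 m\<^esub> g \<in> H" if "2 * m dvd k"
      using that gx_pow_eq_one[OF m, of k] g by simp
    show "g \<otimes>\<^bsub>Gamma4 m\<^esub> gy m [^]\<^bsub>Gamma4 m\<^esub> k \<otimes>\<^bsub>Gamma4 m\<^esub> inv\<^bsub>Gamma4 m\<^esub> g \<in> H" if "4 * m dvd k"
      using that gy_pow_eq_one[OF m, of k] g \<open>\<one>\<^bsub>Gamma4 m\<^esub> \<in> H\<close> by simp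
  qed
next
  assume "regular_subgroup m H"
  then show "is_free (Gamma4 m\<lparr>carrier := H\<rparr>)"
    using m by (intro is_free_subgroup_Gamma4[OF m H fin])
      (simp_all add: regular_subgroup_def gx_pow_eq_one gy_pow_eq_one)
qed

definition regular_number :: "nat \<Rightarrow> nat \<Rightarrow> nat" where
  "regular_number m n = card {H. regular_subgroup m H \<and> card (rcosets\<^bsub>Gamma4 m\<^esub> H) = n}"

lemma free_subgroup_number_eq:
  assumes "m \<ge> 1" "l \<ge> 1"
  shows "free_subgroup_number m l = regular_number m (4 * m * l)"
proof -
  have "finite (rcosets\<^bsub>Gamma4 m\<^esub> H)" if "card (rcosets\<^bsub>Gamma4 m\<^esub> H) = 4 * m * l" for H
    using that assms by (intro card_ge_0_finite) simp
  moreover have "subgroup H (Gamma4 m)" if "regular_subgroup m H" for H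
    using that by (simp add: regular_subgroup_def)
  ultimately have "{H. subgroup H (Gamma4 m) \<and> card (rcosets\<^bsub>Gamma4 m\<^esub> H) = 4 * m * l
      \<and> is_free (Gamma4 m\<lparr>carrier := H\<rparr>)} =
      {H. regular_subgroup m H \<and> card (rcosets\<^bsub>Gamma4 m\<^esub> H) = 4 * m * l}"
    using free_iff_regular[OF assms(1)] by blast
  then show ?thesis by (simp add: free_subgroup_number_def regular_number_def)
qed

section \<open>Pairs of permutations and labelled coset spaces\<close>

definition regular_perm :: "nat \<Rightarrow> 'd set \<Rightarrow> ('d \<Rightarrow> 'd) \<Rightarrow> bool" where
  "regular_perm k D s \<longleftrightarrow> s permutes D \<and> (\<forall>d\<in>D. \<forall>i. (s ^^ i) d = d \<longleftrightarrow> k dvd i)"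

definition gamma_pairs :: "nat \<Rightarrow> 'd set \<Rightarrow> (('d \<Rightarrow> 'd) \<times> ('d \<Rightarrow> 'd)) set" where
  "gamma_pairs m D = {(s, t). regular_perm (2 * m) D s \<and> regular_perm (4 * m) D t \<and> s ^^ 2 = t ^^ 4}"

text \<open>Transitivity is stated through invariant sets containing the base point, the form in
  which it is met when the orbit of \<open>d0\<close> is split off.\<close>

definition transitive_pairs :: "nat \<Rightarrow> 'd \<Rightarrow> 'd set \<Rightarrow> (('d \<Rightarrow> 'd) \<times> ('d \<Rightarrow> 'd)) set" where
  "transitive_pairs m d0 U = {(s, t) \<in> gamma_pairs m U.
     \<forall>W\<subseteq>U. d0 \<in> W \<longrightarrow> s ` W \<subseteq> W \<longrightarrow> t ` W \<subseteq> W \<longrightarrow> W = U}"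

lemma gamma_action_gamma_pairs:
  assumes "m \<ge> 1" "(s, t) \<in> gamma_pairs m D"
  shows "gamma_action m D s t"
proof
  show "s \<in> D \<rightarrow> D" "t \<in> D \<rightarrow> D"
    using assms by (auto simp: gamma_pairs_def regular_perm_def permutes_in_image)
  show "(s ^^ (2 * m)) d = d" "(t ^^ (4 * m)) d = d" if "d \<in> D" for d
    using assms that by (auto simp: gamma_pairs_def regular_perm_def)
  show "(s ^^ 2) d = (t ^^ 4) d" for d using assms by (simp add: gamma_pairs_def)
qed fact

text \<open>Once one such bijection \<open>f\<close> is fixed, the others are compositions of
  \<open>f\<close> with the permutations of \<open>B\<close> that fix \<open>b\<close>.\<close>

lemma card_pointed_bijections:
  assumes "finite A" "a \<in> A" "b \<in> B" "finite B" "card A = card B"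
  shows "card {\<beta> \<in> A \<rightarrow>\<^sub>E B. bij_betw \<beta> A B \<and> \<beta> a = b} = fact (card B - 1)"
proof -
  have "card (A - {a}) = card (B - {b})" using assms by simp
  then obtain f0 where f0: "bij_betw f0 (A - {a}) (B - {b})"
    using assms finite_same_card_bij[of "A - {a}" "B - {b}"] by auto
  define f where "f = f0(a := b)"
  have f: "bij_betw f A B" "f a = b"
  proof -
    have "bij_betw f (A - {a}) (B - {b})" using f0 by (rule bij_betw_cong[THEN iffD1, rotated]) (simp add: f_def)
    moreover have "bij_betw f {a} {b}" by (simp add: f_def bij_betw_def)
    ultimately have "bij_betw f (A - {a} \<union> {a}) (B - {b} \<union> {b})" by (rule bij_betw_combine) auto
    then show "bij_betw f A B" using assms by (simp add: insert_absorb)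
  qed (simp add: f_def)
  let ?F = "\<lambda>p. restrict (p \<circ> f) A"
  have "bij_betw ?F {p. p permutes (B - {b})} {\<beta> \<in> A \<rightarrow>\<^sub>E B. bij_betw \<beta> A B \<and> \<beta> a = b}"
  proof (intro bij_betw_imageI inj_onI subset_antisym subsetI)
    fix p q assume pq: "p \<in> {p. p permutes (B - {b})}" "q \<in> {p. p permutes (B - {b})}" "?F p = ?F q"
    have "p (f x) = q (f x)" if "x \<in> A" for x using fun_cong[OF pq(3), of x] that by simp
    then have "p y = q y" if "y \<in> B" for y using f(1) that by (auto simp: bij_betw_def)
    then show "p = q" using pq(1,2) by (intro ext) (metis DiffD1 mem_Collect_eq permutes_not_in)
  next
    fix \<beta> assume "\<beta> \<in> ?F ` {p. p permutes (B - {b})}"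
    then obtain p where p: "p permutes (B - {b})" "\<beta> = ?F p" by auto
    then have "p permutes B" by (auto intro: permutes_subset)
    then have "bij_betw (p \<circ> f) A B" using f permutes_imp_bij bij_betw_trans by blast
    then have "bij_betw \<beta> A B" unfolding p(2) by (simp add: bij_betw_restrict_eq)
    moreover have "\<beta> a = b" using p f assms permutes_not_in[OF p(1), of b] by simp
    ultimately show "\<beta> \<in> {\<beta> \<in> A \<rightarrow>\<^sub>E B. bij_betw \<beta> A B \<and> \<beta> a = b}"
      using p(2) by (auto simp: bij_betw_def)
  next
    fix \<beta> assume \<beta>: "\<beta> \<in> {\<beta> \<in> A \<rightarrow>\<^sub>E B. bij_betw \<beta> A B \<and> \<beta> a = b}"
    define p where "p y = (if y \<in> B then \<beta> (inv_into A f y) else y)" for y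
    have "bij_betw (\<beta> \<circ> inv_into A f) B B"
      using f \<beta> bij_betw_inv_into bij_betw_trans by blast
    then have "bij_betw p B B" by (rule bij_betw_cong[THEN iffD1, rotated]) (simp add: p_def)
    then have pB: "p permutes B" by (rule bij_imp_permutes) (simp add: p_def)
    have "inv_into A f b = a" using f assms by (metis bij_betw_inv_into_left)
    then have "p b = b" using \<beta> assms by (simp add: p_def)
    then have "p permutes (B - {b})" using pB by (auto intro: permutes_superset)
    moreover have "\<beta> = ?F p"
    proof (rule ext)
      fix x show "\<beta> x = ?F p x"
      proof (cases "x \<in> A")
        case True
        then show ?thesis using f bij_betwE[OF f(1)] by (simp add: p_def bij_betw_inv_into_left[OF f(1)])
      next
        case False
        then show ?thesis using \<beta> PiE_arb[of \<beta> A "\<lambda>_. B" x] by simp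
      qed
    qed
    ultimately show "\<beta> \<in> ?F ` {p. p permutes (B - {b})}" by (metis imageI mem_Collect_eq)
  qed
  then have "card {\<beta> \<in> A \<rightarrow>\<^sub>E B. bij_betw \<beta> A B \<and> \<beta> a = b} = card {p. p permutes (B - {b})}"
    by (rule bij_betw_same_card[symmetric])
  also have "\<dots> = fact (card B - 1)" using assms by (subst card_permutations[of _ "card B - 1"]) auto
  finally show ?thesis .
qed

lemma (in group) rcos_eq_iff:
  assumes H: "subgroup H G" and ab: "a \<in> carrier G" "b \<in> carrier G"
  shows "H #> a = H #> b \<longleftrightarrow> a \<otimes> inv b \<in> H"
proof
  assume "H #> a = H #> b"
  then have "a \<in> H #> b" using rcos_self[OF ab(1) H] by simp
  then obtain h where h: "h \<in> H" "a = h \<otimes> b" by (auto simp: r_coset_def)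
  then show "a \<otimes> inv b \<in> H" using ab H subgroup.mem_carrier[OF H] by (simp add: m_assoc)
next
  assume "a \<otimes> inv b \<in> H"
  moreover have "a = (a \<otimes> inv b) \<otimes> b" using ab by (simp add: m_assoc)
  ultimately have "a \<in> H #> b" unfolding r_coset_def by blast
  then show "H #> a = H #> b" using repr_independence[OF _ ab(2) H] by simp
qed

text \<open>Right multiplication by \<open>w\<close> on the cosets, carried over to \<open>U\<close>
  by the labelling; being the identity off \<open>U\<close> is what \<open>permutes\<close>
  demands.\<close>

definition coset_perm :: "('a, 'b) monoid_scheme \<Rightarrow> 'a set \<Rightarrow> ('a set \<Rightarrow> 'd) \<Rightarrow> 'd set \<Rightarrow> 'a \<Rightarrow> 'd \<Rightarrow> 'd" where
  "coset_perm G H \<beta> U w d =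
     (if d \<in> U then \<beta> (inv_into (rcosets\<^bsub>G\<^esub> H) \<beta> d #>\<^bsub>G\<^esub> w) else d)"

locale coset_model = group G for G (structure) +
  fixes H :: "'a set" and \<beta> :: "'a set \<Rightarrow> 'd" and U :: "'d set"
  assumes H: "subgroup H G" and \<beta>: "bij_betw \<beta> (rcosets H) U" and U: "finite U"
begin

lemma rcos_mem: "g \<in> carrier G \<Longrightarrow> H #> g \<in> rcosets H"
  by (auto simp: RCOSETS_def)

lemma \<beta>_eq_iff: "a \<in> carrier G \<Longrightarrow> b \<in> carrier G \<Longrightarrow> \<beta> (H #> a) = \<beta> (H #> b) \<longleftrightarrow> a \<otimes> inv b \<in> H"
  using \<beta> rcos_eq_iff[OF H, of a b] rcos_mem by (auto simp: bij_betw_def inj_on_eq_iff)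

lemma \<beta>_mem: "g \<in> carrier G \<Longrightarrow> \<beta> (H #> g) \<in> U"
  using \<beta> rcos_mem by (auto simp: bij_betw_def)

lemma \<beta>_cases:
  assumes "d \<in> U" obtains g where "g \<in> carrier G" "d = \<beta> (H #> g)"
  using assms \<beta> by (auto simp: bij_betw_def RCOSETS_def)

lemma coset_perm_\<beta>:
  assumes "g \<in> carrier G" "w \<in> carrier G"
  shows "coset_perm G H \<beta> U w (\<beta> (H #> g)) = \<beta> (H #> (g \<otimes> w))"
  using assms \<beta> rcos_mem \<beta>_mem subgroup.subset[OF H]
  by (simp add: coset_perm_def bij_betw_inv_into_left[of \<beta>] coset_mult_assoc)

lemma coset_perm_pow_\<beta>:
  assumes "g \<in> carrier G" "w \<in> carrier G"
  shows "(coset_perm G H \<beta> U w ^^ k) (\<beta> (H #> g)) = \<beta> (H #> (g \<otimes> w [^] k))"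
  by (induction k) (use assms in \<open>auto simp: coset_perm_\<beta> m_assoc\<close>)

lemma coset_perm_permutes:
  assumes w: "w \<in> carrier G"
  shows "coset_perm G H \<beta> U w permutes U"
proof (rule bij_imp_permutes)
  let ?s = "coset_perm G H \<beta> U w"
  have "inj_on ?s U"
  proof (rule inj_onI)
    fix d e assume "d \<in> U" "e \<in> U" and eq: "?s d = ?s e"
    then obtain a b where ab: "a \<in> carrier G" "d = \<beta> (H #> a)" "b \<in> carrier G" "e = \<beta> (H #> b)"
      using \<beta>_cases by metis
    have "a \<otimes> w \<otimes> inv (b \<otimes> w) = a \<otimes> inv b"
      using ab w by (simp add: inv_mult_group m_assoc flip: m_assoc[of w])
    then show "d = e" using eq ab w by (simp add: coset_perm_\<beta> \<beta>_eq_iff)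
  qed
  moreover have "?s ` U \<subseteq> U"
    using w by (auto elim!: \<beta>_cases simp: coset_perm_\<beta> \<beta>_mem)
  ultimately show "bij_betw ?s U U" using U by (simp add: bij_betw_def endo_inj_surj)
qed (simp add: coset_perm_def)

lemma coset_perm_regular:
  assumes w: "w \<in> carrier G" and k: "\<forall>g\<in>carrier G. \<forall>i::nat. g \<otimes> w [^] i \<otimes> inv g \<in> H \<longleftrightarrow> k dvd i"
  shows "regular_perm k U (coset_perm G H \<beta> U w)"
  unfolding regular_perm_def
proof (intro conjI ballI allI coset_perm_permutes w)
  fix d i assume "d \<in> U"
  then obtain g where g: "g \<in> carrier G" "d = \<beta> (H #> g)" by (rule \<beta>_cases)
  then show "(coset_perm G H \<beta> U w ^^ i) d = d \<longleftrightarrow> k dvd i"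
    using k w by (simp add: coset_perm_pow_\<beta> \<beta>_eq_iff)
qed

end

definition coset_pair :: "nat \<Rightarrow> 'd set \<Rightarrow> gen word set set \<times> (gen word set set \<Rightarrow> 'd) \<Rightarrow> ('d \<Rightarrow> 'd) \<times> ('d \<Rightarrow> 'd)" where
  "coset_pair m U = (\<lambda>(H, \<beta>). (coset_perm (Gamma4 m) H \<beta> U (gx m), coset_perm (Gamma4 m) H \<beta> U (gy m)))"

text \<open>The coset \<open>H\<close> must get the label \<open>d0\<close>: without a base point
  the permutations would determine the subgroup only up to conjugation. Extensionality lets a
  labelling be determined by its values on the cosets.\<close>

definition coset_labellings :: "nat \<Rightarrow> 'd set \<Rightarrow> 'd \<Rightarrow> gen word set set \<Rightarrow> (gen word set set \<Rightarrow> 'd) set" where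
  "coset_labellings m U d0 H =
     {\<beta> \<in> (rcosets\<^bsub>Gamma4 m\<^esub> H) \<rightarrow>\<^sub>E U. bij_betw \<beta> (rcosets\<^bsub>Gamma4 m\<^esub> H) U \<and> \<beta> H = d0}"

locale regular_coset_model =
  fixes m :: nat and H :: "gen word set set" and \<beta> :: "gen word set set \<Rightarrow> 'd" and U :: "'d set" and d0 :: 'd
  assumes m: "m \<ge> 1" and U: "finite U" and reg: "regular_subgroup m H" and labelling: "\<beta> \<in> coset_labellings m U d0 H"
begin

sublocale coset_model "Gamma4 m" H \<beta> U
  using U reg labelling by (intro coset_model.intro coset_model_axioms.intro group_Gamma4)
    (auto simp: regular_subgroup_def coset_labellings_def)

lemma \<beta>_one: "\<beta> (H #>\<^bsub>Gamma4 m\<^esub> \<one>\<^bsub>Gamma4 m\<^esub>) = d0"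
  using labelling subgroup.subset[OF H] by (simp add: coset_labellings_def)

lemma coset_pair_gamma_pairs: "coset_pair m U (H, \<beta>) \<in> gamma_pairs m U"
proof -
  let ?s = "coset_perm (Gamma4 m) H \<beta> U (gx m)" and ?t = "coset_perm (Gamma4 m) H \<beta> U (gy m)"
  have "regular_perm (2 * m) U ?s" "regular_perm (4 * m) U ?t"
    using reg by (auto intro!: coset_perm_regular simp: regular_subgroup_def)
  moreover have "(?s ^^ 2) d = (?t ^^ 4) d" for d
  proof (cases "d \<in> U")
    case True
    then show ?thesis by (rule \<beta>_cases) (simp add: coset_perm_pow_\<beta> gx_gy_pow)
  next
    case False
    have "(coset_perm (Gamma4 m) H \<beta> U w ^^ k) d = d" for w k
      by (induction k) (use False in \<open>simp_all add: coset_perm_def\<close>)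
    then show ?thesis by simp
  qed
  ultimately show ?thesis by (auto simp: gamma_pairs_def coset_pair_def)
qed

text \<open>By this formula the pair determines \<open>H\<close> as the stabiliser of
  \<open>d0\<close> and the labelling as the orbit map, which is the source of injectivity.\<close>

lemma gamma_op_coset_pair:
  assumes st: "coset_pair m U (H, \<beta>) = (s, t)" and A: "A \<in> carrier (Gamma4 m)"
  shows "gamma_op m s t A d0 = \<beta> (H #>\<^bsub>Gamma4 m\<^esub> A)"
proof -
  interpret gamma_action m U s t
    using gamma_action_gamma_pairs[OF m] coset_pair_gamma_pairs st by simp
  have d0: "d0 \<in> U" using \<beta>_mem[OF one_closed] \<beta>_one by simp
  have s: "s (\<beta> (H #>\<^bsub>Gamma4 m\<^esub> g)) = \<beta> (H #>\<^bsub>Gamma4 m\<^esub> (g \<otimes>\<^bsub>Gamma4 m\<^esub> gx m))"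
    "t (\<beta> (H #>\<^bsub>Gamma4 m\<^esub> g)) = \<beta> (H #>\<^bsub>Gamma4 m\<^esub> (g \<otimes>\<^bsub>Gamma4 m\<^esub> gy m))" if "g \<in> carrier (Gamma4 m)" for g
    using st that by (auto simp: coset_pair_def coset_perm_\<beta>)
  have "carrier (Gamma4 m) \<subseteq> {A. gamma_op m s t A d0 = \<beta> (H #>\<^bsub>Gamma4 m\<^esub> A)}"
    using d0 by (intro Gamma4_induct[OF m])
      (simp_all add: gamma_op_one \<beta>_one gamma_op_mult gamma_op_gx gamma_op_gy \<beta>_mem s)
  then show ?thesis using A by blast
qed

lemma coset_pair_transitive: "coset_pair m U (H, \<beta>) \<in> transitive_pairs m d0 U"
proof -
  obtain s t where st: "coset_pair m U (H, \<beta>) = (s, t)" by force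
  have "W = U" if W: "W \<subseteq> U" "d0 \<in> W" "s ` W \<subseteq> W" "t ` W \<subseteq> W" for W
  proof -
    have "carrier (Gamma4 m) \<subseteq> {A. \<beta> (H #>\<^bsub>Gamma4 m\<^esub> A) \<in> W}"
    proof (rule Gamma4_induct[OF m])
      have "\<beta> (H #>\<^bsub>Gamma4 m\<^esub> (g \<otimes>\<^bsub>Gamma4 m\<^esub> gx m)) = s (\<beta> (H #>\<^bsub>Gamma4 m\<^esub> g))"
        "\<beta> (H #>\<^bsub>Gamma4 m\<^esub> (g \<otimes>\<^bsub>Gamma4 m\<^esub> gy m)) = t (\<beta> (H #>\<^bsub>Gamma4 m\<^esub> g))" if "g \<in> carrier (Gamma4 m)" for g
        using st that by (auto simp: coset_pair_def coset_perm_\<beta>)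
      then show "\<forall>g\<in>{A. \<beta> (H #>\<^bsub>Gamma4 m\<^esub> A) \<in> W} \<inter> carrier (Gamma4 m). g \<otimes>\<^bsub>Gamma4 m\<^esub> gx m \<in> {A. \<beta> (H #>\<^bsub>Gamma4 m\<^esub> A) \<in> W}"
        "\<forall>g\<in>{A. \<beta> (H #>\<^bsub>Gamma4 m\<^esub> A) \<in> W} \<inter> carrier (Gamma4 m). g \<otimes>\<^bsub>Gamma4 m\<^esub> gy m \<in> {A. \<beta> (H #>\<^bsub>Gamma4 m\<^esub> A) \<in> W}"
        using W by auto
      show "\<one>\<^bsub>Gamma4 m\<^esub> \<in> {A. \<beta> (H #>\<^bsub>Gamma4 m\<^esub> A) \<in> W}" using W \<beta>_one by simp
    qed
    then show "W = U" using W(1) by (auto elim!: \<beta>_cases)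
  qed
  then show ?thesis using coset_pair_gamma_pairs st by (auto simp: transitive_pairs_def)
qed

end

lemma coset_pair_inj:
  assumes "regular_coset_model m H \<beta> U d0" "regular_coset_model m H' \<beta>' U d0"
    and eq: "coset_pair m U (H, \<beta>) = coset_pair m U (H', \<beta>')"
  shows "H = H' \<and> \<beta> = \<beta>'"
proof -
  interpret M: regular_coset_model m H \<beta> U d0 by fact
  interpret M': regular_coset_model m H' \<beta>' U d0 by fact
  obtain s t where st: "coset_pair m U (H, \<beta>) = (s, t)" "coset_pair m U (H', \<beta>') = (s, t)" using eq by force
  have same: "\<beta> (H #>\<^bsub>Gamma4 m\<^esub> A) = \<beta>' (H' #>\<^bsub>Gamma4 m\<^esub> A)" if "A \<in> carrier (Gamma4 m)" for A
    using M.gamma_op_coset_pair[OF st(1) that] M'.gamma_op_coset_pair[OF st(2) that] by simp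
  have "A \<in> H \<longleftrightarrow> A \<in> H'" if "A \<in> carrier (Gamma4 m)" for A
    using same[OF that] same[OF M.one_closed] M.\<beta>_eq_iff[of A "\<one>\<^bsub>Gamma4 m\<^esub>"]
      M'.\<beta>_eq_iff[of A "\<one>\<^bsub>Gamma4 m\<^esub>"] that by simp
  then have H: "H = H'" using subgroup.subset[OF M.H] subgroup.subset[OF M'.H] by blast
  have "\<beta> c = \<beta>' c" if "c \<in> rcosets\<^bsub>Gamma4 m\<^esub> H" for c
    using that same H by (auto simp: RCOSETS_def)
  then have "\<beta> = \<beta>'"
    using M.labelling M'.labelling H unfolding coset_labellings_def by (intro PiE_ext[of \<beta> "rcosets\<^bsub>Gamma4 m\<^esub> H" "\<lambda>_. U"]) simp_all
  with H show ?thesis by simp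
qed

text \<open>\<open>H\<close> is the stabiliser of \<open>d0\<close>, and \<open>Hg\<close> is
  labelled by the image of \<open>d0\<close> under \<open>g\<close>; transitivity makes every point
  a label.\<close>

lemma transitive_pair_is_coset_pair:
  assumes m: "m \<ge> 1" and U: "finite U" "d0 \<in> U" and st: "(s, t) \<in> transitive_pairs m d0 U"
  obtains H \<beta> where "regular_coset_model m H \<beta> U d0" "coset_pair m U (H, \<beta>) = (s, t)"
proof -
  let ?G = "Gamma4 m"
  interpret group ?G by (rule group_Gamma4)
  have st': "(s, t) \<in> gamma_pairs m U" using st by (simp add: transitive_pairs_def)
  interpret gamma_action m U s t using gamma_action_gamma_pairs[OF m st'] .
  have reg: "s permutes U" "t permutes U" "\<And>d i. d \<in> U \<Longrightarrow> (s ^^ i) d = d \<longleftrightarrow> 2 * m dvd i"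
    "\<And>d i. d \<in> U \<Longrightarrow> (t ^^ i) d = d \<longleftrightarrow> 4 * m dvd i"
    using st' by (auto simp: gamma_pairs_def regular_perm_def)
  define op where "op A = gamma_op m s t A" for A
  have opU: "op A d \<in> U" if "A \<in> carrier ?G" "d \<in> U" for A d using that gamma_op_closed by (simp add: op_def)
  have op_mult: "op (A \<otimes>\<^bsub>?G\<^esub> B) d = op B (op A d)" if "A \<in> carrier ?G" "B \<in> carrier ?G" "d \<in> U" for A B d
    using that gamma_op_mult by (simp add: op_def)
  have op_one: "op \<one>\<^bsub>?G\<^esub> d = d" if "d \<in> U" for d using that gamma_op_one by (simp add: op_def)
  have op_inv: "op (inv\<^bsub>?G\<^esub> A) (op A d) = d" "op A (op (inv\<^bsub>?G\<^esub> A) d) = d" if "A \<in> carrier ?G" "d \<in> U" for A d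
    using that op_mult[of A "inv\<^bsub>?G\<^esub> A" d] op_mult[of "inv\<^bsub>?G\<^esub> A" A d] by (simp_all add: op_one)
  define H where "H = {A \<in> carrier ?G. op A d0 = d0}"
  have H: "subgroup H ?G"
  proof (rule subgroupI)
    show "H \<noteq> {}" using op_one[OF U(2)] by (auto simp: H_def)
    show "inv\<^bsub>?G\<^esub> A \<in> H" if "A \<in> H" for A using that op_inv(1)[of A d0] U by (simp add: H_def)
  qed (use U op_mult in \<open>auto simp: H_def\<close>)
  have fix_iff: "op (A \<otimes>\<^bsub>?G\<^esub> inv\<^bsub>?G\<^esub> B) d0 = d0 \<longleftrightarrow> op A d0 = op B d0" if "A \<in> carrier ?G" "B \<in> carrier ?G" for A B
  proof -
    have "op (A \<otimes>\<^bsub>?G\<^esub> inv\<^bsub>?G\<^esub> B) d0 = op (inv\<^bsub>?G\<^esub> B) (op A d0)" using that U by (simp add: op_mult)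
    then show ?thesis using that U op_inv[of B d0] op_inv(2)[of B "op A d0"] opU by metis
  qed
  \<comment> \<open>Any representative of the coset gives the same value, since \<open>H\<close>
    fixes \<open>d0\<close>.\<close>
  define \<beta> where "\<beta> = restrict (\<lambda>c. op (SOME g. g \<in> c) d0) (rcosets\<^bsub>?G\<^esub> H)"
  have \<beta>: "\<beta> (H #>\<^bsub>?G\<^esub> g) = op g d0" if g: "g \<in> carrier ?G" for g
  proof -
    define g' where "g' = (SOME g'. g' \<in> H #>\<^bsub>?G\<^esub> g)"
    have "g' \<in> H #>\<^bsub>?G\<^esub> g" unfolding g'_def using rcos_self[OF g H] by (rule someI)
    then obtain h where "h \<in> H" "g' = h \<otimes>\<^bsub>?G\<^esub> g" by (auto simp: r_coset_def)
    then have "op g' d0 = op g d0" using g U op_mult by (simp add: H_def)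
    moreover have "H #>\<^bsub>?G\<^esub> g \<in> rcosets\<^bsub>?G\<^esub> H" using g by (auto simp: RCOSETS_def)
    ultimately show ?thesis by (simp add: \<beta>_def g'_def)
  qed
  have gen: "op (g \<otimes>\<^bsub>?G\<^esub> gx m) d0 = s (op g d0)" "op (g \<otimes>\<^bsub>?G\<^esub> gy m) d0 = t (op g d0)" if "g \<in> carrier ?G" for g
    using that U op_mult opU[OF that U(2)] gamma_op_gx gamma_op_gy by (simp_all add: op_def)
  have orbit: "(\<lambda>g. op g d0) ` carrier ?G = U"
  proof -
    let ?W = "(\<lambda>g. op g d0) ` carrier ?G"
    have "?W \<subseteq> U" using opU U by auto
    moreover have "d0 \<in> ?W" using op_one[OF U(2)] by (metis image_eqI one_closed)
    moreover have "s ` ?W \<subseteq> ?W"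
    proof clarify
      fix g assume g: "g \<in> carrier ?G"
      show "s (op g d0) \<in> ?W" unfolding gen(1)[OF g, symmetric] using g by (intro imageI) simp
    qed
    moreover have "t ` ?W \<subseteq> ?W"
    proof clarify
      fix g assume g: "g \<in> carrier ?G"
      show "t (op g d0) \<in> ?W" unfolding gen(2)[OF g, symmetric] using g by (intro imageI) simp
    qed
    ultimately show ?thesis using st unfolding transitive_pairs_def by blast
  qed
  have bij: "bij_betw \<beta> (rcosets\<^bsub>?G\<^esub> H) U"
  proof (rule bij_betw_imageI)
    show "inj_on \<beta> (rcosets\<^bsub>?G\<^esub> H)"
    proof (rule inj_onI)
      fix c c' assume "c \<in> rcosets\<^bsub>?G\<^esub> H" "c' \<in> rcosets\<^bsub>?G\<^esub> H" and eq: "\<beta> c = \<beta> c'"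
      then obtain a b where ab: "a \<in> carrier ?G" "c = H #>\<^bsub>?G\<^esub> a" "b \<in> carrier ?G" "c' = H #>\<^bsub>?G\<^esub> b"
        by (auto simp: RCOSETS_def)
      then have "op (a \<otimes>\<^bsub>?G\<^esub> inv\<^bsub>?G\<^esub> b) d0 = d0" using eq by (simp add: \<beta> fix_iff)
      then show "c = c'" using ab rcos_eq_iff[OF H] by (simp add: H_def)
    qed
    have "\<beta> ` (rcosets\<^bsub>?G\<^esub> H) = (\<lambda>g. \<beta> (H #>\<^bsub>?G\<^esub> g)) ` carrier ?G" by (auto simp: RCOSETS_def)
    also have "\<dots> = U" using orbit \<beta> by simp
    finally show "\<beta> ` (rcosets\<^bsub>?G\<^esub> H) = U" .
  qed
  have "\<beta> H = d0"
    using \<beta>[OF one_closed] op_one[OF U(2)] subgroup.subset[OF H] by simp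
  then have lab: "\<beta> \<in> coset_labellings m U d0 H"
    using bij by (auto simp: coset_labellings_def \<beta>_def bij_betw_def)
  have conj: "g \<otimes>\<^bsub>?G\<^esub> A \<otimes>\<^bsub>?G\<^esub> inv\<^bsub>?G\<^esub> g \<in> H \<longleftrightarrow> op A (op g d0) = op g d0"
    if "g \<in> carrier ?G" "A \<in> carrier ?G" for g A
    using that U fix_iff[of "g \<otimes>\<^bsub>?G\<^esub> A" g] by (simp add: H_def op_mult)
  have "regular_subgroup m H"
    unfolding regular_subgroup_def
  proof (intro conjI ballI allI H)
    fix g :: "gen word set" and k :: nat assume g: "g \<in> carrier ?G"
    note d = opU[OF g U(2)]
    show "g \<otimes>\<^bsub>?G\<^esub> gx m [^]\<^bsub>?G\<^esub> k \<otimes>\<^bsub>?G\<^esub> inv\<^bsub>?G\<^esub> g \<in> H \<longleftrightarrow> 2 * m dvd k"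
      using conj[OF g] gamma_op_gx_pow[OF d, of k] reg(3)[OF d] by (simp add: op_def)
    show "g \<otimes>\<^bsub>?G\<^esub> gy m [^]\<^bsub>?G\<^esub> k \<otimes>\<^bsub>?G\<^esub> inv\<^bsub>?G\<^esub> g \<in> H \<longleftrightarrow> 4 * m dvd k"
      using conj[OF g] gamma_op_gy_pow[OF d, of k] reg(4)[OF d] by (simp add: op_def)
  qed
  then interpret M: regular_coset_model m H \<beta> U d0
    by (intro regular_coset_model.intro m U lab)
  have "coset_perm ?G H \<beta> U (gx m) d = s d \<and> coset_perm ?G H \<beta> U (gy m) d = t d" for d
  proof (cases "d \<in> U")
    case True
    then obtain g where "g \<in> carrier ?G" "d = \<beta> (H #>\<^bsub>?G\<^esub> g)" by (rule M.\<beta>_cases)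
    then show ?thesis by (simp add: M.coset_perm_\<beta>) (simp add: \<beta> gen)
  next
    case False
    then show ?thesis using permutes_not_in[OF reg(1)] permutes_not_in[OF reg(2)] by (simp add: coset_perm_def)
  qed
  then have "coset_pair m U (H, \<beta>) = (s, t)" by (auto simp: coset_pair_def)
  then show ?thesis using that M.regular_coset_model_axioms by blast
qed

lemma finite_gamma_pairs: "finite D \<Longrightarrow> finite (gamma_pairs m D)"
  by (rule finite_subset[of _ "{s. s permutes D} \<times> {t. t permutes D}"])
    (auto simp: gamma_pairs_def regular_perm_def intro: finite_permutations)

text \<open>A transitive pair amounts to a regular subgroup of index \<open>card U\<close> together
  with a labelling of its cosets, and with the label of \<open>H\<close> fixed there are
  \<open>fact (card U - 1)\<close> labellings.\<close>

lemma card_transitive_pairs: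
  assumes m: "m \<ge> 1" and U: "finite U" "d0 \<in> U"
  shows "card (transitive_pairs m d0 U) = regular_number m (card U) * fact (card U - 1)"
proof -
  define HS where "HS = {H. regular_subgroup m H \<and> card (rcosets\<^bsub>Gamma4 m\<^esub> H) = card U}"
  have cU: "card U > 0" using U by (auto simp: card_gt_0_iff)
  have fib: "card (coset_labellings m U d0 H) = fact (card U - 1)" if "H \<in> HS" for H
  proof -
    interpret group "Gamma4 m" by (rule group_Gamma4)
    have "subgroup H (Gamma4 m)" using that by (simp add: HS_def regular_subgroup_def)
    then have "H \<in> rcosets\<^bsub>Gamma4 m\<^esub> H"
      by (metis coset_join2 one_closed rcosetsI subgroup.one_closed subgroup.subset)
    moreover have "card (rcosets\<^bsub>Gamma4 m\<^esub> H) = card U" using that by (simp add: HS_def)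
    moreover from this have "finite (rcosets\<^bsub>Gamma4 m\<^esub> H)" using cU by (intro card_ge_0_finite) simp
    ultimately show ?thesis using U unfolding coset_labellings_def by (intro card_pointed_bijections) simp_all
  qed
  have model: "regular_coset_model m H \<beta> U d0 \<longleftrightarrow> (H, \<beta>) \<in> Sigma HS (coset_labellings m U d0)" for H \<beta>
    using m U bij_betw_same_card by (fastforce simp: regular_coset_model_def HS_def coset_labellings_def)
  have bij: "bij_betw (coset_pair m U) (Sigma HS (coset_labellings m U d0)) (transitive_pairs m d0 U)"
  proof (rule bij_betw_imageI)
    show "inj_on (coset_pair m U) (Sigma HS (coset_labellings m U d0))"
    proof (rule inj_onI)
      fix p q assume p: "p \<in> Sigma HS (coset_labellings m U d0)" and q: "q \<in> Sigma HS (coset_labellings m U d0)"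
        and eq: "coset_pair m U p = coset_pair m U q"
      then show "p = q"
        using coset_pair_inj[of m "fst p" "snd p" U d0 "fst q" "snd q"] model[of "fst p" "snd p"] model[of "fst q" "snd q"]
        by (simp add: prod_eq_iff)
    qed
    show "coset_pair m U ` Sigma HS (coset_labellings m U d0) = transitive_pairs m d0 U"
    proof (intro subset_antisym subsetI)
      fix st assume "st \<in> coset_pair m U ` Sigma HS (coset_labellings m U d0)"
      then obtain H \<beta> where "st = coset_pair m U (H, \<beta>)" "(H, \<beta>) \<in> Sigma HS (coset_labellings m U d0)" by blast
      then show "st \<in> transitive_pairs m d0 U"
        using regular_coset_model.coset_pair_transitive model by metis
    next
      fix st assume "st \<in> transitive_pairs m d0 U"
      then obtain H \<beta> where "regular_coset_model m H \<beta> U d0" "coset_pair m U (H, \<beta>) = st"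
        using transitive_pair_is_coset_pair[OF m U] by (metis surj_pair)
      then show "st \<in> coset_pair m U ` Sigma HS (coset_labellings m U d0)" using model by blast
    qed
  qed
  have "finite (transitive_pairs m d0 U)"
    using finite_gamma_pairs[OF U(1)] by (rule finite_subset[rotated]) (auto simp: transitive_pairs_def)
  then have fin: "finite (Sigma HS (coset_labellings m U d0))" using bij bij_betw_finite by blast
  \<comment> \<open>An infinite set would have \<open>card\<close> equal to 0 by default. Finiteness
    of the set of subgroups is inferred from that of the set of pairs, since every subgroup admits a
    labelling.\<close>
  have "HS = fst ` Sigma HS (coset_labellings m U d0)"
  proof -
    have "coset_labellings m U d0 H \<noteq> {}" if "H \<in> HS" for H using fib[OF that] by fastforce
    then show ?thesis by force
  qed
  then have "finite HS" using fin finite_imageI by metis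
  moreover have "\<forall>H\<in>HS. finite (coset_labellings m U d0 H)"
    using fib by (intro ballI card_ge_0_finite) simp
  ultimately have "card (Sigma HS (coset_labellings m U d0)) = card HS * fact (card U - 1)"
    using fib by (simp add: card_SigmaI)
  then show ?thesis using bij_betw_same_card[OF bij] by (simp add: regular_number_def HS_def)
qed

subsection \<open>Counting regular permutations\<close>

definition restr :: "'d set \<Rightarrow> ('d \<Rightarrow> 'd) \<Rightarrow> 'd \<Rightarrow> 'd" where
  "restr U s d = (if d \<in> U then s d else d)"

lemma permutes_funpow_not_in: "s permutes U \<Longrightarrow> d \<notin> U \<Longrightarrow> (s ^^ i) d = d"
  by (induction i) (auto simp: permutes_not_in)

lemma permutes_funpow_in: "s permutes U \<Longrightarrow> d \<in> U \<Longrightarrow> (s ^^ i) d \<in> U"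
  by (induction i) (auto simp: permutes_in_image)

lemma funpow_in: "s ` U \<subseteq> U \<Longrightarrow> d \<in> U \<Longrightarrow> (s ^^ i) d \<in> U"
  by (induction i) auto

lemma restr_funpow: "s ` U \<subseteq> U \<Longrightarrow> d \<in> U \<Longrightarrow> (restr U s ^^ i) d = (s ^^ i) d"
  by (induction i) (auto simp: restr_def funpow_in)

lemma restr_permutes:
  assumes "s permutes D" "finite U" "s ` U \<subseteq> U"
  shows "restr U s permutes U"
proof (rule bij_imp_permutes)
  have "inj_on s U" using permutes_inj[OF assms(1)] by (rule inj_on_subset) simp
  then have "bij_betw s U U" using assms by (simp add: bij_betw_def endo_inj_surj)
  then show "bij_betw (restr U s) U U" by (rule bij_betw_cong[THEN iffD1, rotated]) (simp add: restr_def)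
qed (simp add: restr_def)

lemma regular_restr:
  assumes "regular_perm k D s" "finite U" "U \<subseteq> D" "s ` U \<subseteq> U"
  shows "regular_perm k U (restr U s)"
  using assms restr_permutes[of s D U] by (auto simp: regular_perm_def restr_funpow)

lemma permutes_image_Diff:
  assumes "s permutes D" "finite D" "U \<subseteq> D" "s ` U \<subseteq> U"
  shows "s ` (D - U) \<subseteq> D - U"
proof -
  have "inj s" using assms(1) by (rule permutes_inj)
  then have "s ` U = U" using assms finite_subset[OF assms(3,2)] by (intro endo_inj_surj) (auto intro: inj_on_subset)
  then show ?thesis using image_set_diff[OF \<open>inj s\<close>, of D U] permutes_image[OF assms(1)] by simp
qed

lemma restr_comp_restr:
  assumes "s permutes D" "s ` (D - U) \<subseteq> D - U"
  shows "restr U s \<circ> restr (D - U) s = s"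
proof (rule ext)
  fix d
  show "(restr U s \<circ> restr (D - U) s) d = s d"
  proof (cases "d \<in> D - U")
    case True
    then have "s d \<in> D - U" using assms(2) by blast
    then show ?thesis using True by (simp add: restr_def)
  next
    case False
    then show ?thesis using permutes_not_in[OF assms(1), of d] by (auto simp: restr_def)
  qed
qed

text \<open>As the supports are disjoint, composition is the union of the two permutations, and
  \<open>restr\<close> recovers both parts.\<close>

locale glue =
  fixes U V :: "'d set" and s s' :: "'d \<Rightarrow> 'd"
  assumes disj: "U \<inter> V = {}" and s: "s permutes U" and s': "s' permutes V"
begin

lemma glue_left: "d \<in> U \<Longrightarrow> (s \<circ> s') d = s d"
  using disj permutes_not_in[OF s', of d] by (simp add: disjoint_iff)

lemma glue_right: "d \<in> V \<Longrightarrow> (s \<circ> s') d = s' d"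
  using disj permutes_not_in[OF s, of "s' d"] permutes_in_image[OF s', of d] by auto

lemma glue_permutes: "(s \<circ> s') permutes (U \<union> V)"
  using s s' by (intro permutes_compose) (auto intro: permutes_subset)

lemma funpow_left: "d \<in> U \<Longrightarrow> ((s \<circ> s') ^^ i) d = (s ^^ i) d"
  by (induction i) (simp_all add: glue_left[unfolded comp_apply] permutes_funpow_in[OF s])

lemma funpow_right: "d \<in> V \<Longrightarrow> ((s \<circ> s') ^^ i) d = (s' ^^ i) d"
  by (induction i) (simp_all add: glue_right[unfolded comp_apply] permutes_funpow_in[OF s'])

lemma restr_left: "restr U (s \<circ> s') = s"
  using permutes_not_in[OF s] by (auto simp del: comp_apply simp: restr_def glue_left)

lemma restr_right: "restr V (s \<circ> s') = s'"
  using permutes_not_in[OF s'] by (auto simp del: comp_apply simp: restr_def glue_right)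

lemma regular_glue:
  assumes "regular_perm k U s" "regular_perm k V s'"
  shows "regular_perm k (U \<union> V) (s \<circ> s')"
  using assms glue_permutes by (auto simp del: comp_apply simp: regular_perm_def funpow_left funpow_right)

end

lemma funpow_eqI_glue:
  assumes "glue U V s s'" "glue U V t t'" "s ^^ i = t ^^ j" "s' ^^ i = t' ^^ j"
  shows "(s \<circ> s') ^^ i = (t \<circ> t') ^^ j"
proof (rule ext)
  interpret G: glue U V s s' by fact
  interpret G': glue U V t t' by fact
  fix d
  consider "d \<in> U" | "d \<in> V" | "d \<notin> U \<union> V" by blast
  then show "((s \<circ> s') ^^ i) d = ((t \<circ> t') ^^ j) d"
  proof cases
    case 1 then show ?thesis using assms by (simp only: G.funpow_left G'.funpow_left)
  next
    case 2 then show ?thesis using assms by (simp only: G.funpow_right G'.funpow_right)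
  next
    case 3 then show ?thesis
      using permutes_funpow_not_in[OF G.glue_permutes] permutes_funpow_not_in[OF G'.glue_permutes] by metis
  qed
qed

lemma restr_funpow_eq:
  assumes "s ^^ i = t ^^ j" "s ` U \<subseteq> U" "t ` U \<subseteq> U"
  shows "restr U s ^^ i = restr U t ^^ j"
proof (rule ext)
  fix d
  have "(restr U s ^^ i) d = d" "(restr U t ^^ j) d = d" if "d \<notin> U"
    using that by (induction i, simp_all add: restr_def) (induction j, simp_all add: restr_def)
  then show "(restr U s ^^ i) d = (restr U t ^^ j) d"
    using assms by (cases "d \<in> U") (simp_all add: restr_funpow)
qed

lemma gamma_pairs_restr:
  assumes "(s, t) \<in> gamma_pairs m D" "finite D" "U \<subseteq> D" "s ` U \<subseteq> U" "t ` U \<subseteq> U"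
  shows "(restr U s, restr U t) \<in> gamma_pairs m U"
proof -
  have "finite U" using assms finite_subset by blast
  then show ?thesis using assms restr_funpow_eq[where s = s and i = 2 and t = t and j = 4 and U = U] regular_restr[of _ D _ U]
    by (auto simp: gamma_pairs_def)
qed

lemma gamma_pairs_glue:
  assumes "(s, t) \<in> gamma_pairs m U" "(s', t') \<in> gamma_pairs m V" "U \<inter> V = {}"
  shows "(s \<circ> s', t \<circ> t') \<in> gamma_pairs m (U \<union> V)"
proof -
  have "glue U V s s'" "glue U V t t'"
    using assms by (auto simp: glue_def gamma_pairs_def regular_perm_def)
  then show ?thesis
    using assms funpow_eqI_glue[where U = U and V = V and s = s and s' = s' and t = t and t' = t' and i = 2 and j = 4] glue.regular_glue[of U V s s' "2 * m"]
      glue.regular_glue[of U V t t' "4 * m"]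
    by (auto simp: gamma_pairs_def)
qed

section \<open>Splitting off the orbit of a point\<close>

text \<open>Here \<open>U\<close> is the orbit of \<open>d0\<close>, the least invariant set
  containing it. Restricting a pair to \<open>U\<close> gives a transitive pair, restricting it to
  the complement an arbitrary one, and gluing inverts this.\<close>

lemma card_gamma_pairs_orbit:
  assumes D: "finite D" "d0 \<in> D"
  shows "card (gamma_pairs m D) =
    (\<Sum>U | U \<subseteq> D \<and> d0 \<in> U. card (transitive_pairs m d0 U) * card (gamma_pairs m (D - U)))"
proof -
  let ?I = "{U. U \<subseteq> D \<and> d0 \<in> U}"
  let ?S = "Sigma ?I (\<lambda>U. transitive_pairs m d0 U \<times> gamma_pairs m (D - U))"
  define F :: "'a set \<times> (('a \<Rightarrow> 'a) \<times> ('a \<Rightarrow> 'a)) \<times> (('a \<Rightarrow> 'a) \<times> ('a \<Rightarrow> 'a)) \<Rightarrow> ('a \<Rightarrow> 'a) \<times> ('a \<Rightarrow> 'a)"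
    where "F = (\<lambda>(U, (s, t), (s', t')). (s \<circ> s', t \<circ> t'))"
  have glued: "glue U (D - U) s s' \<and> glue U (D - U) t t'"
    if "(s, t) \<in> transitive_pairs m d0 U" "(s', t') \<in> gamma_pairs m (D - U)" for U s t s' t'
    using that by (auto simp: glue_def transitive_pairs_def gamma_pairs_def regular_perm_def)
  \<comment> \<open>\<open>U\<close> lies in every invariant set of the glued pair that contains
    \<open>d0\<close>, so it can be read off from that pair; this gives injectivity.\<close>
  have orbit_le: "U \<subseteq> W"
    if st: "(s, t) \<in> transitive_pairs m d0 U" and s't': "(s', t') \<in> gamma_pairs m (D - U)"
      and W: "d0 \<in> U" "d0 \<in> W" "(s \<circ> s') ` W \<subseteq> W" "(t \<circ> t') ` W \<subseteq> W" for U s t s' t' W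
  proof -
    have g: "glue U (D - U) s s'" "glue U (D - U) t t'" using glued[OF st s't'] by auto
    have "s d \<in> U \<inter> W" "t d \<in> U \<inter> W" if "d \<in> U \<inter> W" for d
    proof -
      have "s d = (s \<circ> s') d" "t d = (t \<circ> t') d"
        using glue.glue_left[OF g(1), of d] glue.glue_left[OF g(2), of d] that by auto
      moreover have "s d \<in> U" "t d \<in> U"
        using that g permutes_in_image by (auto simp: glue_def dest: permutes_in_image)
      ultimately show "s d \<in> U \<inter> W" "t d \<in> U \<inter> W" using W(3,4) that by (auto simp del: comp_apply)
    qed
    then have "U \<inter> W = U" using st W unfolding transitive_pairs_def by blast
    then show ?thesis by blast
  qed
  have "bij_betw F ?S (gamma_pairs m D)"
  proof (rule bij_betw_imageI)
    show "inj_on F ?S"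
    proof (rule inj_onI)
      fix p q assume p: "p \<in> ?S" and q: "q \<in> ?S" and F: "F p = F q"
      obtain U s t s' t' where p': "p = (U, (s, t), (s', t'))" by (metis surj_pair)
      obtain U1 s1 t1 s1' t1' where q': "q = (U1, (s1, t1), (s1', t1'))" by (metis surj_pair)
      have U: "U \<subseteq> D" "d0 \<in> U" "(s, t) \<in> transitive_pairs m d0 U" "(s', t') \<in> gamma_pairs m (D - U)"
        using p p' by auto
      have U1: "U1 \<subseteq> D" "d0 \<in> U1" "(s1, t1) \<in> transitive_pairs m d0 U1" "(s1', t1') \<in> gamma_pairs m (D - U1)"
        using q q' by auto
      have eq: "s \<circ> s' = s1 \<circ> s1'" "t \<circ> t' = t1 \<circ> t1'" using F p' q' by (simp_all add: F_def)
      note g = glued[OF U(3,4)] and g1 = glued[OF U1(3,4)]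
      have inv: "(a \<circ> a') ` W \<subseteq> W" if "glue W (D - W) a a'" for a a' W
        using that glue.glue_left[OF that] by (auto simp del: comp_apply simp: glue_def permutes_in_image)
      have "U \<subseteq> U1" using orbit_le[OF U(3,4), of U1] U U1 inv[of U1 s1 s1'] inv[of U1 t1 t1'] g1 by (simp add: eq del: image_comp)
      moreover have "U1 \<subseteq> U" using orbit_le[OF U1(3,4), of U] U U1 inv[of U s s'] inv[of U t t'] g by (simp add: eq del: image_comp)
      ultimately have UU: "U = U1" by simp
      have "s = s1" using g g1 eq UU glue.restr_left by metis
      moreover have "t = t1" using g g1 eq UU glue.restr_left by metis
      moreover have "s' = s1'" using g g1 eq UU glue.restr_right by metis
      moreover have "t' = t1'" using g g1 eq UU glue.restr_right by metis
      ultimately show "p = q" using UU p' q' by simp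
    qed
    show "F ` ?S = gamma_pairs m D"
    proof (intro subset_antisym subsetI)
      fix p assume "p \<in> F ` ?S"
      then obtain U s t s' t' where U: "U \<subseteq> D" "(s, t) \<in> transitive_pairs m d0 U" "(s', t') \<in> gamma_pairs m (D - U)"
        and p: "p = (s \<circ> s', t \<circ> t')" by (auto simp: F_def)
      have "(s, t) \<in> gamma_pairs m U" using U(2) by (simp add: transitive_pairs_def)
      from gamma_pairs_glue[OF this U(3)] show "p \<in> gamma_pairs m D" using U(1) p by (simp add: Un_absorb1)
    next
      fix p assume p: "p \<in> gamma_pairs m D"
      obtain s t where st: "p = (s, t)" by force
      have perm: "s permutes D" "t permutes D" using p st by (auto simp: gamma_pairs_def regular_perm_def)
      define C where "C = {W. W \<subseteq> D \<and> d0 \<in> W \<and> s ` W \<subseteq> W \<and> t ` W \<subseteq> W}"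
      define U where "U = \<Inter> C"
      have "D \<in> C" using D perm permutes_image by (auto simp: C_def)
      then have UD: "U \<subseteq> D" unfolding U_def by (rule Inter_lower)
      have "s d \<in> U \<and> t d \<in> U" if "d \<in> U" for d
        unfolding U_def
      proof (intro conjI InterI)
        fix W assume W: "W \<in> C"
        then have "d \<in> W" using that by (simp add: U_def)
        then show "s d \<in> W" "t d \<in> W" using W by (auto simp: C_def)
      qed
      moreover have "d0 \<in> U" by (simp add: U_def C_def)
      ultimately have U: "U \<subseteq> D" "d0 \<in> U" "s ` U \<subseteq> U" "t ` U \<subseteq> U" using UD by auto
      have inv: "s ` (D - U) \<subseteq> D - U" "t ` (D - U) \<subseteq> D - U"
        using permutes_image_Diff perm D U by metis+
      have "W = U" if W: "W \<subseteq> U" "d0 \<in> W" "restr U s ` W \<subseteq> W" "restr U t ` W \<subseteq> W" for W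
      proof -
        have "s d \<in> W \<and> t d \<in> W" if "d \<in> W" for d
        proof -
          have "restr U s d \<in> W" "restr U t d \<in> W" using W that by blast+
          then show ?thesis using W(1) that by (auto simp: restr_def)
        qed
        then have "W \<in> C" using W U by (auto simp: C_def)
        then have "U \<subseteq> W" unfolding U_def by (rule Inter_lower)
        then show "W = U" using W(1) by simp
      qed
      moreover have "(restr U s, restr U t) \<in> gamma_pairs m U" using gamma_pairs_restr p st D U by blast
      ultimately have "(restr U s, restr U t) \<in> transitive_pairs m d0 U" by (simp add: transitive_pairs_def)
      moreover have "(restr (D - U) s, restr (D - U) t) \<in> gamma_pairs m (D - U)"
        using gamma_pairs_restr[of s t m D "D - U"] p st D inv by simp
      moreover have "p = F (U, (restr U s, restr U t), (restr (D - U) s, restr (D - U) t))"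
        using restr_comp_restr[OF perm(1) inv(1)] restr_comp_restr[OF perm(2) inv(2)] st by (simp add: F_def)
      ultimately show "p \<in> F ` ?S"
        using U by (intro image_eqI[of p F "(U, (restr U s, restr U t), (restr (D - U) s, restr (D - U) t))"]) simp_all
    qed
  qed
  then have "card (gamma_pairs m D) = card ?S" by (rule bij_betw_same_card[symmetric])
  also have "\<dots> = (\<Sum>U\<in>?I. card (transitive_pairs m d0 U \<times> gamma_pairs m (D - U)))"
  proof (rule card_SigmaI)
    show "finite ?I" using D by simp
    show "\<forall>U\<in>?I. finite (transitive_pairs m d0 U \<times> gamma_pairs m (D - U))"
    proof
      fix U assume "U \<in> ?I"
      then have "finite (gamma_pairs m U)" "finite (gamma_pairs m (D - U))"
        using D finite_subset by (auto intro: finite_gamma_pairs)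
      then show "finite (transitive_pairs m d0 U \<times> gamma_pairs m (D - U))"
        by (auto intro: finite_subset[of _ "gamma_pairs m U"] simp: transitive_pairs_def)
    qed
  qed
  finally show ?thesis by (simp add: card_cartesian_product)
qed

lemma regular_perm_funpow_eq_iff:
  assumes s: "regular_perm n D s" and d: "d \<in> D"
  shows "(s ^^ a) d = (s ^^ b) d \<longleftrightarrow> a mod n = b mod n"
proof -
  have "(s ^^ a) d = (s ^^ (a + i)) d \<longleftrightarrow> a mod n = (a + i) mod n" for a i
  proof -
    have "inj (s ^^ a)" using s permutes_inj inj_fn unfolding regular_perm_def by blast
    then have "(s ^^ a) d = (s ^^ (a + i)) d \<longleftrightarrow> (s ^^ i) d = d"
      by (auto simp: funpow_add inj_eq)
    also have "\<dots> \<longleftrightarrow> n dvd i" using s d by (simp add: regular_perm_def)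
    also have "\<dots> \<longleftrightarrow> a mod n = (a + i) mod n"
      using mod_eq_dvd_iff_nat[of a "a + i" n] by (metis add_diff_cancel_left' le_add1)
    finally show ?thesis .
  qed
  from this[of a "b - a"] this[of b "a - b"] show ?thesis by (cases "a \<le> b") auto
qed

section \<open>Counting regular roots of a regular permutation\<close>

text \<open>Each cycle of \<open>s\<close>, of length \<open>c * k\<close>, interleaves
  \<open>k\<close> cycles of \<open>z\<close>, each of length \<open>c\<close>.\<close>

definition regular_roots :: "nat \<Rightarrow> nat \<Rightarrow> ('d \<Rightarrow> 'd) \<Rightarrow> 'd set \<Rightarrow> ('d \<Rightarrow> 'd) set" where
  "regular_roots c k z D = {s. regular_perm (c * k) D s \<and> s ^^ k = z}"

definition orbits_of :: "('d \<Rightarrow> 'd) \<Rightarrow> 'd list \<Rightarrow> 'd set" where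
  "orbits_of z es = (\<Union>e\<in>set es. range (\<lambda>a. (z ^^ a) e))"

text \<open>These are lists \<open>[d0, d1, ..., dn]\<close> of points in pairwise different cycles
  of \<open>z\<close>. For \<open>n = k - 1\<close> they are the candidates for the initial segment
  \<open>d0, s d0, ...\<close> of a cycle of a \<open>k\<close>-th root \<open>s\<close>.\<close>

fun orbit_chains :: "('d \<Rightarrow> 'd) \<Rightarrow> 'd set \<Rightarrow> 'd \<Rightarrow> nat \<Rightarrow> 'd list set" where
  "orbit_chains z D d0 0 = {[d0]}"
| "orbit_chains z D d0 (Suc n) =
    (\<lambda>(es, d). es @ [d]) ` Sigma (orbit_chains z D d0 n) (\<lambda>es. D - orbits_of z es)"

locale regular_z =
  fixes c :: nat and D :: "'d set" and z :: "'d \<Rightarrow> 'd"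
  assumes c: "c \<ge> 1" and D: "finite D" and z: "regular_perm c D z"
begin

lemma z_permutes: "z permutes D" using z by (simp add: regular_perm_def)

lemma z_pow_mod: "d \<in> D \<Longrightarrow> (z ^^ (a mod c)) d = (z ^^ a) d"
  using regular_perm_funpow_eq_iff[OF z, of d "a mod c" a] by simp

lemma orbit_eq: "d \<in> D \<Longrightarrow> range (\<lambda>a. (z ^^ a) d) = (\<lambda>a. (z ^^ a) d) ` {..<c}"
proof (intro subset_antisym subsetI)
  fix e assume d: "d \<in> D" and "e \<in> range (\<lambda>a. (z ^^ a) d)"
  then obtain a where "e = (z ^^ a) d" by blast
  then have "e = (z ^^ (a mod c)) d" using z_pow_mod[OF d] by simp
  then show "e \<in> (\<lambda>a. (z ^^ a) d) ` {..<c}" using c by auto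
qed auto

lemma card_orbit: "d \<in> D \<Longrightarrow> card (range (\<lambda>a. (z ^^ a) d)) = c"
  using regular_perm_funpow_eq_iff[OF z, of d]
  by (simp add: orbit_eq card_image inj_on_def)

lemma orbits_of_subset: "set es \<subseteq> D \<Longrightarrow> orbits_of z es \<subseteq> D"
  using permutes_funpow_in[OF z_permutes] by (auto simp: orbits_of_def)

lemma orbit_disjoint:
  assumes "set es \<subseteq> D" "d \<in> D - orbits_of z es"
  shows "orbits_of z es \<inter> range (\<lambda>a. (z ^^ a) d) = {}"
proof (rule ccontr)
  assume "\<not> ?thesis"
  then obtain e a b where e: "e \<in> set es" "(z ^^ a) d = (z ^^ b) e" by (auto simp: orbits_of_def)
  have "(z ^^ (a * (c - 1))) ((z ^^ a) d) = (z ^^ (a * (c - 1) + a)) d" by (simp add: funpow_add)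
  also have "a * (c - 1) + a = a * c" using c by (cases c) auto
  also have "(z ^^ (a * c)) d = d" using z assms by (simp add: regular_perm_def)
  finally have "d = (z ^^ (a * (c - 1) + b)) e" unfolding e(2) by (simp add: funpow_add)
  then show False using assms e(1) by (auto simp: orbits_of_def)
qed

lemma orbit_chains_props:
  assumes "d0 \<in> D" "es \<in> orbit_chains z D d0 n"
  shows "length es = Suc n \<and> set es \<subseteq> D \<and> es ! 0 = d0 \<and> card (orbits_of z es) = c * Suc n"
  using assms(2)
proof (induction n arbitrary: es)
  case 0
  then show ?case using assms(1) card_orbit by (simp add: orbits_of_def)
next
  case (Suc n)
  then obtain fs d where es: "es = fs @ [d]" "fs \<in> orbit_chains z D d0 n" "d \<in> D - orbits_of z fs" by auto
  note IH = Suc.IH[OF es(2)]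
  have "orbits_of z es = orbits_of z fs \<union> range (\<lambda>a. (z ^^ a) d)" by (auto simp: es orbits_of_def)
  moreover have "finite (orbits_of z fs)" using orbits_of_subset[of fs] IH D finite_subset by blast
  moreover have "finite (range (\<lambda>a. (z ^^ a) d))" using es by (subst orbit_eq) auto
  ultimately have "card (orbits_of z es) = c * Suc n + c"
    using card_Un_disjoint[OF _ _ orbit_disjoint[of fs d]] IH es card_orbit[of d] by simp
  then show ?case using IH es by (auto simp: nth_append)
qed

lemma orbit_chains_finite: "finite (orbit_chains z D d0 n)"
  using D by (induction n) auto

text \<open>The \<open>j\<close>-th new entry avoids the \<open>j\<close> cycles already met, each
  of which has \<open>c\<close> points.\<close>

lemma card_orbit_chains:
  assumes "d0 \<in> D"
  shows "card (orbit_chains z D d0 n) = (\<Prod>j=1..n. card D - c * j)"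
proof (induction n)
  case (Suc n)
  have "inj_on (\<lambda>(es, d). es @ [d]) X" for X :: "('d list \<times> 'd) set" by (auto simp: inj_on_def)
  then have "card (orbit_chains z D d0 (Suc n)) = (\<Sum>es\<in>orbit_chains z D d0 n. card (D - orbits_of z es))"
    using D orbit_chains_finite by (simp add: card_image card_SigmaI)
  also have "\<dots> = (\<Sum>es\<in>orbit_chains z D d0 n. card D - c * Suc n)"
  proof (rule sum.cong)
    fix es assume "es \<in> orbit_chains z D d0 n"
    note p = orbit_chains_props[OF assms this]
    then have "orbits_of z es \<subseteq> D" using orbits_of_subset by simp
    then show "card (D - orbits_of z es) = card D - c * Suc n"
      using p D by (subst card_Diff_subset) (auto intro: finite_subset)
  qed simp
  finally show ?case using Suc by simp
qed simp

end

definition root_chain :: "nat \<Rightarrow> 'd \<Rightarrow> ('d \<Rightarrow> 'd) \<Rightarrow> 'd list" where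
  "root_chain k d0 s = map (\<lambda>j. (s ^^ j) d0) [0..<k]"

text \<open>
  The points \<open>d0, s d0, \<dots>, s\<^sup>k\<^sup>-\<^sup>1 d0\<close> determine a \<open>k\<close>-th root \<open>s\<close> of \<open>z\<close> on the orbit of \<open>d0\<close>: the list of
  these points is \<open>es\<close> below, and \<open>chain_walk k z es i\<close> is \<open>s\<^sup>i d0\<close>.
\<close>

definition chain_walk :: "nat \<Rightarrow> ('d \<Rightarrow> 'd) \<Rightarrow> 'd list \<Rightarrow> nat \<Rightarrow> 'd" where
  "chain_walk k z es i = (z ^^ (i div k)) (es ! (i mod k))"

lemma funpow_root_split: "s ^^ k = z \<Longrightarrow> (s ^^ i) d = (z ^^ (i div k)) ((s ^^ (i mod k)) d)"
proof -
  assume z: "s ^^ k = z"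
  have "(s ^^ i) d = (s ^^ (k * (i div k) + i mod k)) d" by simp
  also have "\<dots> = (z ^^ (i div k)) ((s ^^ (i mod k)) d)" unfolding funpow_add z[symmetric] by (simp add: funpow_mult)
  finally show ?thesis .
qed

locale regular_z_chain = regular_z +
  fixes d0 :: 'a and k :: nat and es :: "'a list"
  assumes k: "k \<ge> 1" and d0: "d0 \<in> D" and es: "es \<in> orbit_chains z D d0 (k - 1)"
begin

abbreviation "V \<equiv> orbits_of z es"
abbreviation "walk \<equiv> chain_walk k z es"

lemma es_props: "length es = k" "set es \<subseteq> D" "es ! 0 = d0" "card V = c * k"
  using orbit_chains_props[OF d0 es] k by auto

lemma V_subset: "V \<subseteq> D" using es_props orbits_of_subset by simp

lemma walk_0: "walk 0 = d0" using es_props by (simp add: chain_walk_def)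

lemma walk_add: "walk (i + k) = z (walk i)"
  using k by (simp add: chain_walk_def)

lemma walk_D: "walk i \<in> V"
proof -
  have "es ! (i mod k) \<in> set es" using es_props k by simp
  then show ?thesis by (auto simp: chain_walk_def orbits_of_def)
qed

lemma walk_period: "walk (i mod (c * k)) = walk i"
proof -
  have "i mod (c * k) = (i div k) mod c * k + i mod k"
    by (metis mod_mult2_eq mult.commute add.commute)
  then have "walk (i mod (c * k)) = (z ^^ ((i div k) mod c)) (es ! (i mod k))"
    using k by (simp add: chain_walk_def)
  moreover have "es ! (i mod k) \<in> D" using es_props k by (metis mod_less_divisor nth_mem subset_eq less_le_trans zero_less_one)
  ultimately show ?thesis by (simp add: chain_walk_def z_pow_mod)
qed

lemma walk_image: "walk ` {..<c * k} = V"
proof (intro subset_antisym subsetI)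
  fix v assume "v \<in> V"
  then obtain e a where e: "e \<in> set es" "v = (z ^^ a) e" by (auto simp: orbits_of_def)
  then obtain j where j: "j < k" "e = es ! j" using es_props by (metis in_set_conv_nth)
  then have "v = walk (a * k + j)" using e by (simp add: chain_walk_def)
  then have "v = walk ((a * k + j) mod (c * k))" using walk_period by simp
  moreover have "(a * k + j) mod (c * k) < c * k" using c k by simp
  ultimately show "v \<in> walk ` {..<c * k}" by blast
qed (use walk_D in auto)

text \<open>The walk maps \<open>c * k\<close> indices onto \<open>V\<close>, which has as many
  points, so it is injective on one period.\<close>

lemma walk_eq_iff: "walk i = walk j \<longleftrightarrow> i mod (c * k) = j mod (c * k)"
proof -
  have "inj_on walk {..<c * k}"
    by (rule eq_card_imp_inj_on) (simp_all add: walk_image es_props)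
  moreover have "i mod (c * k) < c * k" "j mod (c * k) < c * k" using c k by simp_all
  ultimately have "walk (i mod (c * k)) = walk (j mod (c * k)) \<longleftrightarrow> i mod (c * k) = j mod (c * k)"
    by (simp add: inj_on_eq_iff)
  then show ?thesis by (simp add: walk_period)
qed

text \<open>One step along the walk. The chosen index is determined modulo \<open>c * k\<close>
  only, which is enough by periodicity.\<close>

definition walk_perm :: "'a \<Rightarrow> 'a" where
  "walk_perm v = (if v \<in> V then walk (Suc (SOME i. walk i = v)) else v)"

lemma walk_perm_walk: "walk_perm (walk i) = walk (Suc i)"
proof -
  define j where "j = (SOME j. walk j = walk i)"
  have "walk j = walk i" unfolding j_def by (rule someI) simp
  then have "walk (Suc j) = walk (Suc i)" unfolding walk_eq_iff by (metis mod_Suc_eq)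
  then show ?thesis using walk_D by (simp add: walk_perm_def j_def)
qed

lemma walk_perm_pow: "(walk_perm ^^ n) (walk i) = walk (i + n)"
  by (induction n) (simp_all add: walk_perm_walk)

lemma V_cases: assumes "v \<in> V" obtains i where "v = walk i"
  using assms walk_image by blast

lemma walk_perm_regular: "regular_perm (c * k) V walk_perm"
  unfolding regular_perm_def
proof (intro conjI ballI allI)
  have "finite V" using V_subset D finite_subset by blast
  have "walk_perm ` V = V"
  proof (intro subset_antisym subsetI)
    fix v assume "v \<in> V"
    then obtain i where "v = walk i" by (rule V_cases)
    moreover have "walk i = walk_perm (walk (i + (c * k - 1)))"
    proof -
      have "Suc (i + (c * k - 1)) = i + c * k" using c k by (cases "c * k") auto
      then have "walk_perm (walk (i + (c * k - 1))) = walk (i + c * k)" by (simp only: walk_perm_walk)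
      then show ?thesis by (simp add: walk_eq_iff)
    qed
    ultimately show "v \<in> walk_perm ` V" using walk_D by blast
  qed (auto elim!: V_cases simp: walk_perm_walk walk_D)
  then have "bij_betw walk_perm V V" using \<open>finite V\<close> by (simp add: bij_betw_def finite_surj_inj)
  then show "walk_perm permutes V" by (rule bij_imp_permutes) (simp add: walk_perm_def)
  fix v i assume "v \<in> V"
  then obtain j where "v = walk j" by (rule V_cases)
  then have "(walk_perm ^^ i) v = v \<longleftrightarrow> (j + i) mod (c * k) = j mod (c * k)"
    by (simp add: walk_perm_pow walk_eq_iff)
  also have "\<dots> \<longleftrightarrow> c * k dvd i"
    using mod_eq_dvd_iff_nat[of j "j + i" "c * k"] by (metis add_diff_cancel_left' le_add1)
  finally show "(walk_perm ^^ i) v = v \<longleftrightarrow> c * k dvd i" .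
qed

lemma walk_perm_root: "v \<in> V \<Longrightarrow> (walk_perm ^^ k) v = z v"
  by (erule V_cases) (simp add: walk_perm_pow walk_add)

lemma z_V: "z ` V \<subseteq> V"
  by (auto elim!: V_cases simp: walk_D simp flip: walk_add)

lemma z_rest: "z ` (D - V) \<subseteq> D - V"
  using permutes_image_Diff[OF z_permutes D V_subset z_V] .

lemma root_walk:
  assumes "s \<in> regular_roots c k z D" "root_chain k d0 s = es"
  shows "(s ^^ i) d0 = walk i"
proof -
  have "(s ^^ (i mod k)) d0 = es ! (i mod k)" using k by (simp add: root_chain_def flip: assms(2))
  moreover have "(s ^^ i) d0 = (z ^^ (i div k)) ((s ^^ (i mod k)) d0)"
    using assms(1) by (intro funpow_root_split) (simp add: regular_roots_def)
  ultimately show ?thesis by (simp add: chain_walk_def)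
qed

lemma root_on_V:
  assumes s: "s \<in> regular_roots c k z D" "root_chain k d0 s = es" and v: "v \<in> V"
  shows "s v = walk_perm v"
proof -
  obtain i where i: "v = walk i" using v by (rule V_cases)
  then have "s v = (s ^^ Suc i) d0" using root_walk[OF s, of i] by simp
  also have "\<dots> = walk (Suc i)" by (rule root_walk[OF s])
  finally show ?thesis using i walk_perm_walk by simp
qed

lemma root_rest:
  assumes s: "s \<in> regular_roots c k z D" "root_chain k d0 s = es"
  shows "s ` V \<subseteq> V" "s ` (D - V) \<subseteq> D - V" "restr (D - V) s \<in> regular_roots c k (restr (D - V) z) (D - V)"
proof -
  have perm: "s permutes D" "regular_perm (c * k) D s" using s by (auto simp: regular_roots_def regular_perm_def)
  show V: "s ` V \<subseteq> V" using root_on_V[OF s] by (auto elim!: V_cases simp: walk_perm_walk walk_D)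
  show rest: "s ` (D - V) \<subseteq> D - V" by (rule permutes_image_Diff[OF perm(1) D V_subset V])
  have "s ^^ k = z ^^ 1" using s by (simp add: regular_roots_def)
  then have "restr (D - V) s ^^ k = restr (D - V) z ^^ 1" by (rule restr_funpow_eq[OF _ rest z_rest])
  then show "restr (D - V) s \<in> regular_roots c k (restr (D - V) z) (D - V)"
    using regular_restr[OF perm(2) _ _ rest] D by (simp add: regular_roots_def)
qed

text \<open>The chain prescribes the cycle through \<open>d0\<close>, and any root of the rest of
  \<open>z\<close> may be glued to it; both parts are recovered from the result.\<close>

lemma glue_root:
  assumes s': "s' \<in> regular_roots c k (restr (D - V) z) (D - V)"
  shows "walk_perm \<circ> s' \<in> regular_roots c k z D" "root_chain k d0 (walk_perm \<circ> s') = es"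
    "restr (D - V) (walk_perm \<circ> s') = s'"
proof -
  have reg: "regular_perm (c * k) (D - V) s'" "s' ^^ k = restr (D - V) z"
    using s' by (auto simp: regular_roots_def)
  interpret glue V "D - V" walk_perm s'
    using reg walk_perm_regular by (auto simp: glue_def regular_perm_def)
  have un: "V \<union> (D - V) = D" using V_subset by blast
  have "((walk_perm \<circ> s') ^^ k) d = z d" for d
  proof -
    consider "d \<in> V" | "d \<in> D - V" | "d \<notin> D" by blast
    then show ?thesis
    proof cases
      case 1 then show ?thesis by (simp only: funpow_left walk_perm_root)
    next
      case 2 then show ?thesis by (simp only: funpow_right reg) (simp add: restr_def)
    next
      case 3 then show ?thesis
        using permutes_funpow_not_in[OF glue_permutes, of d k] permutes_not_in[OF z_permutes] un by auto
    qed
  qed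
  then show "walk_perm \<circ> s' \<in> regular_roots c k z D"
    using regular_glue[OF walk_perm_regular reg(1)] un by (auto simp: regular_roots_def)
  have d0V: "d0 \<in> V" using walk_D[of 0] walk_0 by simp
  have "((walk_perm \<circ> s') ^^ j) d0 = walk j" for j
    using funpow_left[OF d0V, of j] walk_perm_pow[of j 0] walk_0 by simp
  then show "root_chain k d0 (walk_perm \<circ> s') = es"
    using es_props by (intro nth_equalityI) (simp_all add: root_chain_def chain_walk_def)
  show "restr (D - V) (walk_perm \<circ> s') = s'" by (rule restr_right)
qed

end

context regular_z
begin

text \<open>Applying \<open>z = s^k\<close> raises the exponent by \<open>k\<close>, so if
  \<open>s^i d0\<close> and \<open>s^j d0\<close> share a cycle of \<open>z\<close>, then
  \<open>i\<close> and \<open>j\<close> are congruent modulo \<open>k\<close>. Different exponents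
  below \<open>k\<close> therefore belong to different cycles.\<close>

lemma root_chain_mem:
  assumes d0: "d0 \<in> D" and s: "s \<in> regular_roots c k z D"
  shows "n < k \<Longrightarrow> root_chain (Suc n) d0 s \<in> orbit_chains z D d0 n"
proof (induction n)
  case 0
  then show ?case by (simp add: root_chain_def)
next
  case (Suc n)
  have reg: "regular_perm (c * k) D s" and root: "s ^^ k = z" using s by (auto simp: regular_roots_def)
  have "(s ^^ Suc n) d0 \<notin> orbits_of z (root_chain (Suc n) d0 s)"
  proof
    assume "(s ^^ Suc n) d0 \<in> orbits_of z (root_chain (Suc n) d0 s)"
    then obtain j a where j: "j < Suc n" "(s ^^ Suc n) d0 = (z ^^ a) ((s ^^ j) d0)"
      by (auto simp: orbits_of_def root_chain_def simp del: upt_Suc funpow.simps)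
    have "(z ^^ a) ((s ^^ j) d0) = (s ^^ (k * a + j)) d0" unfolding funpow_add root[symmetric] by (simp add: funpow_mult)
    then have "Suc n mod (c * k) = (k * a + j) mod (c * k)"
      using j(2) regular_perm_funpow_eq_iff[OF reg d0] by metis
    then have "Suc n mod (c * k) mod k = (k * a + j) mod (c * k) mod k" by simp
    then have "Suc n mod k = (k * a + j) mod k" by (simp add: mod_mod_cancel)
    then show False using j(1) Suc.prems by simp
  qed
  moreover have "(s ^^ Suc n) d0 \<in> D" using reg d0 by (intro permutes_funpow_in) (simp_all add: regular_perm_def)
  moreover have "root_chain (Suc (Suc n)) d0 s = root_chain (Suc n) d0 s @ [(s ^^ Suc n) d0]"
    by (simp add: root_chain_def)
  ultimately show ?case using Suc by (auto intro!: image_eqI[of _ _ "(root_chain (Suc n) d0 s, (s ^^ Suc n) d0)"])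
qed

text \<open>A root is the same as a chain of \<open>k\<close> points together with a root of what
  remains after their cycles are removed. That the latter number \<open>N\<close> does not depend on
  the chain is left to the induction that applies this step.\<close>

lemma card_regular_roots_step:
  assumes k: "k \<ge> 1" and d0: "d0 \<in> D"
    and N: "\<And>es. es \<in> orbit_chains z D d0 (k - 1) \<Longrightarrow>
      card (regular_roots c k (restr (D - orbits_of z es) z) (D - orbits_of z es)) = N"
  shows "card (regular_roots c k z D) = (\<Prod>j=1..k - 1. card D - c * j) * N"
proof -
  let ?C = "orbit_chains z D d0 (k - 1)"
  let ?R = "\<lambda>es. regular_roots c k (restr (D - orbits_of z es) z) (D - orbits_of z es)"
  let ?f = "\<lambda>s. (root_chain k d0 s, restr (D - orbits_of z (root_chain k d0 s)) s)"
  have model: "regular_z_chain c D z d0 k es" if "es \<in> ?C" for es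
    using that k d0 by unfold_locales
  have chain: "root_chain k d0 s \<in> ?C" if "s \<in> regular_roots c k z D" for s
    using root_chain_mem[OF d0 that, of "k - 1"] k by simp
  have "bij_betw ?f (regular_roots c k z D) (Sigma ?C ?R)"
  proof (rule bij_betw_imageI)
    show "inj_on ?f (regular_roots c k z D)"
    proof (rule inj_onI)
      fix s s' assume s: "s \<in> regular_roots c k z D" "s' \<in> regular_roots c k z D" and eq: "?f s = ?f s'"
      define es where "es = root_chain k d0 s"
      have chain_eq: "root_chain k d0 s = es" "root_chain k d0 s' = es" using eq by (simp_all add: es_def)
      interpret regular_z_chain c D z d0 k es using model chain[OF s(1)] chain_eq by simp
      have r: "restr (D - V) s d = restr (D - V) s' d" for d using eq chain_eq by simp
      show "s = s'"
      proof
        fix d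
        consider "d \<in> V" | "d \<in> D - V" | "d \<notin> D" by blast
        then show "s d = s' d"
        proof cases
          case 1 then show ?thesis using root_on_V[OF s(1) chain_eq(1)] root_on_V[OF s(2) chain_eq(2)] by simp
        next
          case 2 then show ?thesis using r[of d] by (simp add: restr_def)
        next
          case 3 then show ?thesis using s permutes_not_in[of s D d] permutes_not_in[of s' D d]
            by (simp add: regular_roots_def regular_perm_def)
        qed
      qed
    qed
    show "?f ` regular_roots c k z D = Sigma ?C ?R"
    proof (intro subset_antisym subsetI)
      fix p assume "p \<in> ?f ` regular_roots c k z D"
      then obtain s where s: "s \<in> regular_roots c k z D" "p = ?f s" by blast
      interpret regular_z_chain c D z d0 k "root_chain k d0 s" using model chain[OF s(1)] .
      show "p \<in> Sigma ?C ?R" using s chain[OF s(1)] root_rest(3)[OF s(1) HOL.refl] by simp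
    next
      fix p assume "p \<in> Sigma ?C ?R"
      then obtain es s' where p: "p = (es, s')" "es \<in> ?C" "s' \<in> ?R es" by blast
      interpret regular_z_chain c D z d0 k es using model p(2) .
      show "p \<in> ?f ` regular_roots c k z D"
        using glue_root[OF p(3)] p(1) by (intro image_eqI[of _ _ "walk_perm \<circ> s'"]) simp_all
    qed
  qed
  then have "card (regular_roots c k z D) = card (Sigma ?C ?R)" by (rule bij_betw_same_card)
  also have "\<dots> = (\<Sum>es\<in>?C. card (?R es))"
  proof (rule card_SigmaI[OF orbit_chains_finite], rule ballI)
    fix es
    show "finite (?R es)"
      by (rule finite_subset[of _ "{s. s permutes (D - orbits_of z es)}"])
        (use D in \<open>auto simp: regular_roots_def regular_perm_def intro: finite_permutations\<close>)
  qed
  also have "\<dots> = (\<Prod>j=1..k - 1. card D - c * j) * N"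
    using N card_orbit_chains[OF d0] by simp
  finally show ?thesis .
qed

end

text \<open>The argument \<open>q\<close> is the number of cycles of the root. One step removes the
  cycle through a chosen point; the product counts the chains for it in a set of
  \<open>c * k * Suc q\<close> points.\<close>

fun root_number :: "nat \<Rightarrow> nat \<Rightarrow> nat \<Rightarrow> nat" where
  "root_number c k 0 = 1"
| "root_number c k (Suc q) = (\<Prod>j=1..k - 1. c * k * Suc q - c * j) * root_number c k q"

lemma card_regular_roots:
  assumes "c \<ge> 1" "k \<ge> 1" "finite D" "regular_perm c D z" "card D = c * k * q"
  shows "card (regular_roots c k z D) = root_number c k q"
  using assms(3-5)
proof (induction q arbitrary: D z)
  case 0
  then have D: "D = {}" by simp
  then have z: "z = id" using 0 by (simp add: regular_perm_def)
  have "regular_roots c k z D = {id}" using D z by (auto simp: regular_roots_def regular_perm_def)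
  then show ?case by simp
next
  case (Suc q)
  interpret regular_z c D z using Suc assms by unfold_locales
  have "card D > 0" using Suc assms by simp
  then obtain d0 where d0: "d0 \<in> D" by fastforce
  have "card (regular_roots c k z D) = (\<Prod>j=1..k - 1. card D - c * j) * root_number c k q"
  proof (rule card_regular_roots_step[OF assms(2) d0])
    fix es assume es: "es \<in> orbit_chains z D d0 (k - 1)"
    interpret regular_z_chain c D z d0 k es using es assms d0 by unfold_locales
    have "card (D - V) = c * k * q"
      using V_subset D es_props Suc.prems by (subst card_Diff_subset) (auto intro: finite_subset)
    then show "card (regular_roots c k (restr (D - V) z) (D - V)) = root_number c k q"
      using Suc.IH regular_restr[OF z _ _ z_rest] D by simp
  qed
  then show ?case using Suc.prems by simp
qed

text \<open>Each factor of the product yields a \<open>c\<close>; what remains, times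
  \<open>k * Suc q\<close>, is the quotient of \<open>fact (k * Suc q)\<close> by
  \<open>fact (k * q)\<close>. Denominators are multiplied out to stay within the natural
  numbers.\<close>

lemma root_number_closed_form:
  assumes "c \<ge> 1" "k \<ge> 1"
  shows "root_number c k q * (k ^ q * fact q) = c ^ ((k - 1) * q) * fact (k * q)"
proof (induction q)
  case (Suc q)
  have "(\<Prod>j=1..k - 1. c * k * Suc q - c * j) = c ^ (k - 1) * (\<Prod>j=1..k - 1. k * Suc q - j)"
  proof -
    have "(\<Prod>j=1..k - 1. c * k * Suc q - c * j) = (\<Prod>j=1..k - 1. c * (k * Suc q - j))"
      by (rule prod.cong) (simp_all only: diff_mult_distrib2 mult.assoc)
    then show ?thesis by (simp add: prod.distrib)
  qed
  moreover have "fact (k * Suc q) = (\<Prod>j=1..k - 1. k * Suc q - j) * (k * Suc q) * (fact (k * q) :: nat)"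
  proof -
    have *: "fact (n + i) = (\<Prod>j=1..i. n + i + 1 - j) * (fact n :: nat)" for n i :: nat
    proof -
      have "(\<Prod>j=1..i. n + i + 1 - j) = (\<Prod>j=1..i. n + i + 1 - (i + 1 - j))"
        by (rule prod.atLeastAtMost_rev)
      also have "\<dots> = (\<Prod>j=1..i. n + j)" by (rule prod.cong) auto
      moreover have "fact (n + i) = (\<Prod>j=1..i. n + j) * (fact n :: nat)"
        by (induction i) (simp_all add: algebra_simps)
      ultimately show ?thesis by simp
    qed
    have "k * Suc q = Suc (k * q + (k - 1))" using assms by (cases k) auto
    then have "fact (k * Suc q) = k * Suc q * fact (k * q + (k - 1))" by (metis fact_Suc of_nat_id)
    also have "fact (k * q + (k - 1)) = (\<Prod>j=1..k - 1. k * Suc q - j) * (fact (k * q) :: nat)"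
    proof -
      have "k * q + (k - 1) + 1 = k * Suc q" using \<open>k * Suc q = _\<close> by simp
      from *[of "k * q" "k - 1", unfolded this] show ?thesis .
    qed
    finally show ?thesis by (simp add: algebra_simps)
  qed
  ultimately have "root_number c k (Suc q) * (k ^ Suc q * fact (Suc q)) =
      c ^ (k - 1) * ((\<Prod>j=1..k - 1. k * Suc q - j) * (k * Suc q)) * (root_number c k q * (k ^ q * fact q))"
    by (simp add: algebra_simps)
  also have "\<dots> = c ^ (k - 1) * c ^ ((k - 1) * q) * ((\<Prod>j=1..k - 1. k * Suc q - j) * (k * Suc q) * fact (k * q))"
    unfolding Suc.IH by (simp add: algebra_simps)
  also have "(\<Prod>j=1..k - 1. k * Suc q - j) * (k * Suc q) * fact (k * q) = fact (k * Suc q)"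
    using \<open>fact (k * Suc q) = _\<close> by simp
  also have "c ^ (k - 1) * c ^ ((k - 1) * q) = c ^ ((k - 1) * Suc q)" by (simp add: power_add)
  finally show ?case .
qed simp

subsection \<open>The recurrence for the numbers of free subgroups\<close>

lemma regular_perm_funpow:
  assumes s: "regular_perm (c * k) D s" and c: "k \<ge> 1"
  shows "regular_perm c D (s ^^ k)"
  unfolding regular_perm_def
proof (intro conjI ballI allI)
  show "s ^^ k permutes D"
  proof -
    have "s permutes D" using s by (simp add: regular_perm_def)
    then have "s ^^ i permutes D" for i
      by (induction i) (simp_all only: funpow.simps permutes_id permutes_compose)
    then show ?thesis .
  qed
  fix d i assume "d \<in> D"
  then have "((s ^^ k) ^^ i) d = d \<longleftrightarrow> c * k dvd k * i"
    using s by (simp add: funpow_mult regular_perm_def)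
  then show "((s ^^ k) ^^ i) d = d \<longleftrightarrow> c dvd i" using c by (simp add: mult.commute)
qed

lemma regular_perm_power_id:
  assumes "regular_perm c D s"
  shows "s ^^ c = id"
proof
  fix d show "(s ^^ c) d = id d"
    using assms permutes_funpow_not_in[of s D d c] by (cases "d \<in> D") (auto simp: regular_perm_def)
qed

text \<open>The cycles, all of length \<open>c\<close>, are removed one at a time.\<close>

lemma regular_perm_dvd_card:
  assumes "c \<ge> 1" "finite D" "regular_perm c D z"
  shows "c dvd card D"
  using assms(2,3)
proof (induction "card D" arbitrary: D z rule: less_induct)
  case less
  show ?case
  proof (cases "D = {}")
    case False
    then obtain d0 where d0: "d0 \<in> D" by blast
    interpret regular_z c D z using assms(1) less.prems by unfold_locales
    \<comment> \<open>For \<open>k = 1\<close> a chain is a single point, and \<open>V\<close> is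
      its cycle under \<open>z\<close>.\<close>
    interpret regular_z_chain c D z d0 1 "[d0]" using d0 by unfold_locales simp_all
    have V: "card V = c" "V \<subseteq> D" "finite V" using es_props V_subset D finite_subset by auto
    have le: "c \<le> card D" using card_mono[OF D V(2)] V(1) by simp
    have diff: "card (D - V) = card D - c" using V by (simp add: card_Diff_subset)
    have "regular_perm c (D - V) (restr (D - V) z)" using regular_restr[OF z _ _ z_rest] D by simp
    then have "c dvd card D - c" using less.hyps[of "D - V" "restr (D - V) z"] D diff le assms(1) by simp
    then show ?thesis using le by (simp add: dvd_minus_self)
  qed simp
qed

section \<open>Closed form for the number of pairs\<close>

text \<open>The common value \<open>z = s^2 = t^4\<close> is chosen with \<open>4n\<close> cycles of
  length \<open>m\<close>, and then, independently, its square root \<open>s\<close> with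
  \<open>2n\<close> cycles and its fourth root \<open>t\<close> with \<open>n\<close>
  cycles.\<close>

definition gamma_number :: "nat \<Rightarrow> nat \<Rightarrow> nat" where
  "gamma_number m n = root_number 1 m (4 * n) * (root_number m 2 (2 * n) * root_number m 4 n)"

text \<open>The permutations with cycles of length \<open>m\<close> are themselves counted as
  regular \<open>m\<close>-th roots of the identity, so that one formula for roots serves three
  times.\<close>

lemma card_gamma_pairs:
  assumes m: "m \<ge> 1" and D: "finite D" "card D = 4 * m * n"
  shows "card (gamma_pairs m D) = gamma_number m n"
proof -
  let ?Z = "regular_roots 1 m id D" and ?R = "\<lambda>z. regular_roots m 2 z D \<times> regular_roots m 4 z D"
  have "bij_betw snd (Sigma ?Z ?R) (gamma_pairs m D)"
  proof (rule bij_betw_imageI)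
    show "inj_on snd (Sigma ?Z ?R)" by (auto simp: inj_on_def regular_roots_def)
    show "snd ` Sigma ?Z ?R = gamma_pairs m D"
    proof (intro subset_antisym subsetI)
      fix p assume "p \<in> snd ` Sigma ?Z ?R"
      then show "p \<in> gamma_pairs m D" by (auto simp: regular_roots_def gamma_pairs_def mult.commute)
    next
      fix p assume p: "p \<in> gamma_pairs m D"
      obtain s t where st: "p = (s, t)" by force
      have reg: "regular_perm (m * 2) D s" "regular_perm (m * 4) D t" "s ^^ 2 = t ^^ 4"
        using p st by (auto simp: gamma_pairs_def mult.commute)
      have "regular_perm m D (s ^^ 2)" using reg(1) by (rule regular_perm_funpow) simp
      then have "s ^^ 2 \<in> ?Z" using regular_perm_power_id[of m D "s ^^ 2"] by (simp add: regular_roots_def)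
      then have "(s ^^ 2, p) \<in> Sigma ?Z ?R" using reg st by (simp add: regular_roots_def)
      then show "p \<in> snd ` Sigma ?Z ?R" by (rule image_eqI[rotated]) simp
    qed
  qed
  then have "card (gamma_pairs m D) = card (Sigma ?Z ?R)" by (rule bij_betw_same_card[symmetric])
  also have "\<dots> = (\<Sum>z\<in>?Z. card (?R z))"
  proof (rule card_SigmaI)
    have fin: "finite (regular_roots c k z D)" for c k z
      by (rule finite_subset[of _ "{s. s permutes D}"])
        (use D in \<open>auto simp: regular_roots_def regular_perm_def intro: finite_permutations\<close>)
    then show "finite ?Z" "\<forall>z\<in>?Z. finite (?R z)" by auto
  qed
  also have "\<dots> = (\<Sum>z\<in>?Z. root_number m 2 (2 * n) * root_number m 4 n)"
  proof (rule sum.cong)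
    fix z assume "z \<in> ?Z"
    then have z: "regular_perm m D z" by (simp add: regular_roots_def)
    show "card (?R z) = root_number m 2 (2 * n) * root_number m 4 n"
      using card_regular_roots[OF m _ D(1) z, of 2 "2 * n"] card_regular_roots[OF m _ D(1) z, of 4 n] D(2)
      by (simp add: card_cartesian_product mult_ac)
  qed simp
  also have "card ?Z = root_number 1 m (4 * n)"
    by (rule card_regular_roots) (use m D in \<open>auto simp: regular_perm_def permutes_id mult_ac\<close>)
  then have "(\<Sum>z\<in>?Z. root_number m 2 (2 * n) * root_number m 4 n) = gamma_number m n"
    by (simp add: gamma_number_def)
  finally show ?thesis .
qed

text \<open>The product form exhibits divisibility by \<open>fact n\<close>, on which the reduction
  modulo a prime power rests.\<close>

definition K_number :: "nat \<Rightarrow> nat" where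
  "K_number n = ((4 * n) choose (2 * n)) * ((2 * n) choose n) * fact n"

lemma K_number_fact: "K_number n * (fact (2 * n) * fact n) = fact (4 * n)"
proof -
  have "fact (2 * n) * fact (4 * n - 2 * n) * ((4 * n) choose (2 * n)) = (fact (4 * n) :: nat)"
    by (rule binomial_fact_lemma) simp
  then have 1: "fact (2 * n) * fact (2 * n) * ((4 * n) choose (2 * n)) = (fact (4 * n) :: nat)" by simp
  have "fact n * fact (2 * n - n) * ((2 * n) choose n) = (fact (2 * n) :: nat)"
    by (rule binomial_fact_lemma) simp
  then have 2: "fact n * fact n * ((2 * n) choose n) = (fact (2 * n) :: nat)" by (simp add: mult_2)
  have "K_number n * (fact (2 * n) * fact n) =
      fact (2 * n) * (fact n * fact n * ((2 * n) choose n)) * ((4 * n) choose (2 * n))"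
    by (simp add: K_number_def algebra_simps)
  then show ?thesis unfolding 2 1 .
qed

text \<open>The roots bring in the denominators \<open>2^(2n) (2n)!\<close> and
  \<open>4^n n!\<close>, whence \<open>16^n\<close>. The exponents of \<open>m\<close> add up to
  \<open>2n + 3n - 4n = n\<close>, where \<open>4n\<close> belongs to the denominator in the count
  of \<open>z\<close>.\<close>

lemma gamma_number_closed_form:
  assumes m: "m \<ge> 1"
  shows "gamma_number m n * 16 ^ n = fact (4 * m * n) * (m ^ n * K_number n)"
proof -
  define a b c where "a = root_number 1 m (4 * n)" and "b = root_number m 2 (2 * n)" and "c = root_number m 4 n"
  have A: "a * (m ^ (4 * n) * fact (4 * n)) = fact (4 * m * n)"
    using root_number_closed_form[of 1 m "4 * n"] m by (simp add: a_def mult_ac)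
  have B: "b * (4 ^ n * fact (2 * n)) = m ^ (2 * n) * fact (4 * n)"
    using root_number_closed_form[of m 2 "2 * n"] m by (simp add: b_def power_mult)
  have C: "c * (4 ^ n * fact n) = m ^ (3 * n) * fact (4 * n)"
    using root_number_closed_form[of m 4 n] m by (simp add: c_def)
  have sixteen: "(16::nat) ^ n = 4 ^ n * 4 ^ n" by (simp flip: power_mult_distrib)
  have "(a * (b * c)) * 16 ^ n * ((fact (2 * n) * fact n) * (m ^ (4 * n) * fact (4 * n))) =
      (a * (m ^ (4 * n) * fact (4 * n))) * (b * (4 ^ n * fact (2 * n))) * (c * (4 ^ n * fact n))"
    unfolding sixteen by (simp only: mult_ac)
  also have "\<dots> = fact (4 * m * n) * (m ^ (2 * n) * fact (4 * n)) * (m ^ (3 * n) * fact (4 * n))"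
    unfolding A B C ..
  also have "\<dots> = fact (4 * m * n) * (m ^ n * fact (4 * n)) * (m ^ (4 * n) * fact (4 * n))"
  proof -
    have "m ^ (2 * n) * m ^ (3 * n) = m ^ n * m ^ (4 * n)" by (simp flip: power_add)
    moreover have "fact (4 * m * n) * (m ^ (2 * n) * fact (4 * n)) * (m ^ (3 * n) * fact (4 * n)) =
        fact (4 * m * n) * fact (4 * n) * fact (4 * n) * (m ^ (2 * n) * m ^ (3 * n))"
      by (simp only: mult_ac)
    ultimately show ?thesis by (simp only: mult_ac)
  qed
  also have "\<dots> = fact (4 * m * n) * (m ^ n * K_number n) * ((fact (2 * n) * fact n) * (m ^ (4 * n) * fact (4 * n)))"
    unfolding K_number_fact[symmetric, of n] by (simp only: mult_ac)
  finally have "(a * (b * c)) * 16 ^ n * ((fact (2 * n) * fact n) * (m ^ (4 * n) * fact (4 * n))) =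
    fact (4 * m * n) * (m ^ n * K_number n) * ((fact (2 * n) * fact n) * (m ^ (4 * n) * fact (4 * n)))" .
  moreover have "(fact (2 * n) * fact n) * (m ^ (4 * n) * fact (4 * n)) \<noteq> (0::nat)" using m by simp
  ultimately have "(a * (b * c)) * 16 ^ n = fact (4 * m * n) * (m ^ n * K_number n)" by (metis mult_right_cancel)
  then show ?thesis by (simp add: gamma_number_def a_def b_def c_def)
qed

lemma card_subsets_containing:
  assumes "finite D" "d0 \<in> D" "j \<ge> 1"
  shows "card {U. U \<subseteq> D \<and> d0 \<in> U \<and> card U = j} = (card D - 1) choose (j - 1)"
proof -
  have "bij_betw (insert d0) {U. U \<subseteq> D - {d0} \<and> card U = j - 1} {U. U \<subseteq> D \<and> d0 \<in> U \<and> card U = j}"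
  proof (rule bij_betw_byWitness[where f' = "\<lambda>U. U - {d0}"])
    show "insert d0 ` {U. U \<subseteq> D - {d0} \<and> card U = j - 1} \<subseteq> {U. U \<subseteq> D \<and> d0 \<in> U \<and> card U = j}"
    proof clarify
      fix U assume U: "U \<subseteq> D - {d0}" "card U = j - 1"
      then have "finite U" "d0 \<notin> U" using assms finite_subset by auto
      then show "insert d0 U \<subseteq> D \<and> d0 \<in> insert d0 U \<and> card (insert d0 U) = j" using U assms by auto
    qed
    show "(\<lambda>U. U - {d0}) ` {U. U \<subseteq> D \<and> d0 \<in> U \<and> card U = j} \<subseteq> {U. U \<subseteq> D - {d0} \<and> card U = j - 1}"
      by auto
  qed auto
  then have "card {U. U \<subseteq> D \<and> d0 \<in> U \<and> card U = j} = card {U. U \<subseteq> D - {d0} \<and> card U = j - 1}"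
    by (rule bij_betw_same_card[symmetric])
  also have "\<dots> = (card D - 1) choose (j - 1)" using n_subsets[of "D - {d0}" "j - 1"] assms by simp
  finally show ?thesis .
qed

text \<open>The possible orbits \<open>U\<close> of the point 0 are sorted by size. Only multiples
  of \<open>4 * m\<close> occur, since \<open>t\<close> has cycles of this length on
  \<open>U\<close>, and the binomial coefficient counts the sets of a given size that contain
  0.\<close>

lemma gamma_number_recurrence:
  assumes m: "m \<ge> 1" and n: "n \<ge> 1"
  shows "gamma_number m n = (\<Sum>l=1..n. ((4 * m * n - 1) choose (4 * m * l - 1)) *
    (free_subgroup_number m l * fact (4 * m * l - 1) * gamma_number m (n - l)))"
proof -
  define D where "D = {..<4 * m * n}"
  have D: "finite D" "card D = 4 * m * n" "0 \<in> D" using m n by (auto simp: D_def)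
  let ?I = "{U. U \<subseteq> D \<and> 0 \<in> U}"
  define h where "h U = card (transitive_pairs m 0 U) * card (gamma_pairs m (D - U))" for U
  have zero: "h U = 0" if "U \<in> ?I" "\<not> 4 * m dvd card U" for U
  proof -
    have "finite U" using that D finite_subset by auto
    then have "transitive_pairs m 0 U = {}"
      using that(2) regular_perm_dvd_card[of "4 * m" U] m by (fastforce simp: transitive_pairs_def gamma_pairs_def)
    then show ?thesis by (simp add: h_def)
  qed
  have val: "h U = free_subgroup_number m l * fact (4 * m * l - 1) * gamma_number m (n - l)"
    if U: "U \<in> ?I" "card U = 4 * m * l" "1 \<le> l" "l \<le> n" for U l
  proof -
    have "finite U" "0 \<in> U" using U D finite_subset by auto
    moreover have "card (D - U) = 4 * m * (n - l)"
      using U D \<open>finite U\<close> by (simp add: card_Diff_subset diff_mult_distrib2)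
    ultimately show ?thesis
      using U D card_transitive_pairs[OF m, of U 0] card_gamma_pairs[OF m, of "D - U" "n - l"] free_subgroup_number_eq[OF m U(3)]
      by (simp add: h_def)
  qed
  have "gamma_number m n = (\<Sum>U\<in>?I. h U)"
    using card_gamma_pairs_orbit[OF D(1,3), of m] card_gamma_pairs[OF m D(1,2)] by (simp add: h_def)
  also have "\<dots> = (\<Sum>U\<in>{U \<in> ?I. 4 * m dvd card U}. h U)"
    by (rule sum.mono_neutral_right) (use D zero in auto)
  also have "\<dots> = (\<Sum>l\<in>{1..n}. \<Sum>U\<in>{U \<in> {U \<in> ?I. 4 * m dvd card U}. card U div (4 * m) = l}. h U)"
  proof (rule sum.group[symmetric])
    show "(\<lambda>U. card U div (4 * m)) ` {U \<in> ?I. 4 * m dvd card U} \<subseteq> {1..n}"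
    proof clarify
      fix U assume U: "U \<subseteq> D" "0 \<in> U" "4 * m dvd card U"
      have "0 < card U" "card U \<le> 4 * m * n" using U D finite_subset[OF U(1) D(1)] card_mono[OF D(1) U(1)] by (auto simp: card_gt_0_iff)
      then show "card U div (4 * m) \<in> {1..n}" using U(3) m by (auto elim!: dvdE)
    qed
  qed (use D in auto)
  also have "\<dots> = (\<Sum>l=1..n. ((4 * m * n - 1) choose (4 * m * l - 1)) *
      (free_subgroup_number m l * fact (4 * m * l - 1) * gamma_number m (n - l)))"
  proof (rule sum.cong)
    fix l assume l: "l \<in> {1..n}"
    have eq: "{U \<in> {U \<in> ?I. 4 * m dvd card U}. card U div (4 * m) = l} = {U. U \<subseteq> D \<and> 0 \<in> U \<and> card U = 4 * m * l}"
      using m by (auto elim!: dvdE)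
    have "(\<Sum>U\<in>{U. U \<subseteq> D \<and> 0 \<in> U \<and> card U = 4 * m * l}. h U) =
        (\<Sum>U\<in>{U. U \<subseteq> D \<and> 0 \<in> U \<and> card U = 4 * m * l}. free_subgroup_number m l * fact (4 * m * l - 1) * gamma_number m (n - l))"
      using l by (intro sum.cong val) auto
    also have "\<dots> = ((4 * m * n - 1) choose (4 * m * l - 1)) * (free_subgroup_number m l * fact (4 * m * l - 1) * gamma_number m (n - l))"
      using card_subsets_containing[OF D(1,3), of "4 * m * l"] D(2) m l by simp
    finally show "(\<Sum>U\<in>{U \<in> {U \<in> ?I. 4 * m dvd card U}. card U div (4 * m) = l}. h U) =
      ((4 * m * n - 1) choose (4 * m * l - 1)) * (free_subgroup_number m l * fact (4 * m * l - 1) * gamma_number m (n - l))"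
      unfolding eq .
  qed simp
  finally show ?thesis .
qed

text \<open>After multiplication by \<open>16^n\<close> the binomial coefficient,
  \<open>(4ml - 1)!\<close> and the factorial \<open>(4m(n-l))!\<close> of the closed form combine
  to \<open>(4mn - 1)!\<close> in every summand. This factor also divides \<open>(4mn)!\<close> on
  the left and cancels.\<close>

lemma free_subgroup_number_recurrence:
  assumes m: "m \<ge> 1" and n: "n \<ge> 1"
  shows "4 * m * n * (m ^ n * K_number n) = (\<Sum>l=1..n. 16 ^ l * free_subgroup_number m l * (m ^ (n - l) * K_number (n - l)))"
proof -
  let ?N = "4 * m * n"
  have N: "?N > 0" using m n by simp
  have "fact (?N - 1) * (?N * (m ^ n * K_number n)) = gamma_number m n * 16 ^ n"
    using gamma_number_closed_form[OF m, of n] fact_reduce[OF N, where ?'a = nat] by simp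
  also have "\<dots> = (\<Sum>l=1..n. fact (?N - 1) * (16 ^ l * free_subgroup_number m l * (m ^ (n - l) * K_number (n - l))))"
    unfolding gamma_number_recurrence[OF m n] sum_distrib_right
  proof (rule sum.cong)
    fix l assume "l \<in> {1..n}"
    then have l: "1 \<le> l" "l \<le> n" by auto
    have "4 * m * l \<le> ?N" using l by simp
    then have "fact (4 * m * l - 1) * fact (?N - 1 - (4 * m * l - 1)) * ((?N - 1) choose (4 * m * l - 1)) = (fact (?N - 1) :: nat)"
      by (intro binomial_fact_lemma diff_le_mono)
    moreover have "?N - 1 - (4 * m * l - 1) = 4 * m * (n - l)"
      using l m N by (simp add: diff_mult_distrib2)
    ultimately have F: "fact (4 * m * l - 1) * fact (4 * m * (n - l)) * ((?N - 1) choose (4 * m * l - 1)) = (fact (?N - 1) :: nat)"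
      by simp
    have "(16::nat) ^ n = 16 ^ l * 16 ^ (n - l)" using l by (simp flip: power_add)
    then have "((?N - 1) choose (4 * m * l - 1)) * (free_subgroup_number m l * fact (4 * m * l - 1) * gamma_number m (n - l)) * 16 ^ n =
      ((?N - 1) choose (4 * m * l - 1)) * (free_subgroup_number m l * fact (4 * m * l - 1)) * 16 ^ l * (gamma_number m (n - l) * 16 ^ (n - l))"
      by (simp only: mult_ac)
    also have "\<dots> = (fact (4 * m * l - 1) * fact (4 * m * (n - l)) * ((?N - 1) choose (4 * m * l - 1))) *
        (16 ^ l * free_subgroup_number m l * (m ^ (n - l) * K_number (n - l)))"
      unfolding gamma_number_closed_form[OF m] by (simp only: mult_ac)
    finally show "((?N - 1) choose (4 * m * l - 1)) * (free_subgroup_number m l * fact (4 * m * l - 1) * gamma_number m (n - l)) * 16 ^ n =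
      fact (?N - 1) * (16 ^ l * free_subgroup_number m l * (m ^ (n - l) * K_number (n - l)))"
      unfolding F .
  qed simp
  finally show ?thesis by (simp flip: sum_distrib_left)
qed

section \<open>Periodicity and rationality modulo a prime power\<close>

text \<open>There are finitely many windows of \<open>J\<close> consecutive residues, so two of them
  agree, and the recurrence propagates the agreement. The windows start at indices from 1 on, which
  provides \<open>N \<ge> 1\<close>.\<close>

lemma linear_recurrence_mod_periodic:
  fixes u :: "nat \<Rightarrow> int" and a :: "nat \<Rightarrow> int"
  assumes M: "M > 0" and rec: "\<And>n. n \<ge> J \<Longrightarrow> [u n = (\<Sum>j\<in>{1..<J}. a j * u (n - j))] (mod M)"
  shows "\<exists>N\<ge>1. \<exists>\<omega>\<ge>1. \<forall>l\<ge>N. [u (l + \<omega>) = u l] (mod M)"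
proof -
  define w where "w n = map (\<lambda>j. u (n + j) mod M) [0..<J]" for n
  have "w ` {1..} \<subseteq> {xs. set xs \<subseteq> {0..<M} \<and> length xs = J}" using M by (auto simp: w_def)
  then have "finite (w ` {1..})" by (rule finite_subset) (simp add: finite_lists_length_eq)
  then have "\<not> inj_on w {1..}" using finite_imageD infinite_Ici by blast
  then obtain n1 n2 where n: "1 \<le> n1" "n1 < n2" "w n1 = w n2"
    by (auto simp: inj_on_def) (metis linorder_neqE_nat)
  have "[u (n2 + i) = u (n1 + i)] (mod M)" for i
  proof (induction i rule: less_induct)
    case (less i)
    show ?case
    proof (cases "i < J")
      case True
      then have "w n1 ! i = w n2 ! i" using n by simp
      then show ?thesis using True by (simp add: w_def cong_def)
    next
      case False
      have "[u (n2 + i) = (\<Sum>j\<in>{1..<J}. a j * u (n2 + i - j))] (mod M)" using False by (intro rec) simp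
      also have "[(\<Sum>j\<in>{1..<J}. a j * u (n2 + i - j)) = (\<Sum>j\<in>{1..<J}. a j * u (n1 + i - j))] (mod M)"
      proof (intro cong_sum cong_mult cong_refl)
        fix j assume "j \<in> {1..<J}"
        then have "j \<le> i" "i - j < i" using False by auto
        then show "[u (n2 + i - j) = u (n1 + i - j)] (mod M)" using less[of "i - j"] by simp
      qed
      also have "[(\<Sum>j\<in>{1..<J}. a j * u (n1 + i - j)) = u (n1 + i)] (mod M)"
        using False by (intro cong_sym[OF rec]) simp
      finally show ?thesis .
    qed
  qed
  from this[of "l - n1" for l] have "[u (l + (n2 - n1)) = u l] (mod M)" if "l \<ge> n1" for l
    using that n by (metis add.commute add_diff_assoc2 le_add_diff_inverse less_imp_le diff_add_assoc2)
  then show ?thesis using n by (intro exI[of _ n1] conjI exI[of _ "n2 - n1"]) auto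
qed

theorem theorem18:
  fixes m p \<alpha> :: nat
  assumes "m \<ge> 1" and "prime p" and "p \<ge> 3" and "\<alpha> \<ge> 1"
  shows "(\<exists>P Q :: int poly. coeff Q 0 = 1 \<and>
            (\<forall>n. [fps_nth (fps_of_poly Q * free_subgroup_series m) n = coeff P n] (mod int p ^ \<alpha>)))
       \<and> (\<exists>N \<ge> 1. \<exists>\<omega> \<ge> 1. \<forall>l \<ge> N.
            [free_subgroup_number m (l + \<omega>) = free_subgroup_number m l] (mod p ^ \<alpha>))"
proof -
  define M where "M = int p ^ \<alpha>"
  \<comment> \<open>For \<open>j \<ge> p^\<alpha>\<close> the number \<open>p^\<alpha>\<close>
    occurs among the factors of \<open>j!\<close>; this crude bound on the length of the recurrence
    suffices.\<close>
  define J where "J = p ^ \<alpha>"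
  have M: "M > 0" "J \<ge> 1" "M = int J" using assms by (auto simp: M_def J_def prime_gt_0_nat)
  have "odd p" using assms by (intro prime_odd_nat) auto
  then have "odd M" by (simp add: M_def)
  then have "coprime (2 ^ 4) M" by (simp only: coprime_power_left_iff coprime_left_2_iff_odd simp_thms)
  then have "coprime (16::int) M" by simp
  then obtain s where s: "[16 * s = 1] (mod M)" using cong_solve_coprime_int by blast
  define f where "f l = int (free_subgroup_number m l)" for l
  \<comment> \<open>As \<open>s\<close> is inverse to 16, \<open>q j\<close> stands for
    \<open>(m/16)^j K_j\<close>; dividing the recurrence by \<open>16^n\<close> turns it into a
    convolution of \<open>f\<close> with \<open>q\<close>.\<close>
  define q where "q j = s ^ j * int (m ^ j * K_number j)" for j
  have q0: "q 0 = 1" by (simp add: q_def K_number_def)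
  have q_zero: "[q j = 0] (mod M)" if "j \<ge> J" for j
  proof -
    have "J dvd fact j" using M(2) that by (rule dvd_fact)
    then have "J dvd m ^ j * K_number j" by (simp add: K_number_def)
    then have "M dvd int (m ^ j * K_number j)" unfolding M(3) by (simp only: int_dvd_int_iff)
    then show ?thesis unfolding q_def cong_0_iff by (rule dvd_mult)
  qed
  have rec: "[(\<Sum>l=1..n. q (n - l) * f l) = int (4 * m * n) * q n] (mod M)" if n: "n \<ge> 1" for n
  proof -
    have "int (4 * m * n) * q n = s ^ n * int (4 * m * n * (m ^ n * K_number n))" by (simp add: q_def)
    also have "\<dots> = s ^ n * int (\<Sum>l=1..n. 16 ^ l * free_subgroup_number m l * (m ^ (n - l) * K_number (n - l)))"
      unfolding free_subgroup_number_recurrence[OF assms(1) n] ..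
    also have "\<dots> = (\<Sum>l=1..n. s ^ n * (16 ^ l * f l * int (m ^ (n - l) * K_number (n - l))))"
      by (simp add: f_def sum_distrib_left)
    also have "\<dots> = (\<Sum>l=1..n. (16 * s) ^ l * (q (n - l) * f l))"
    proof (rule sum.cong)
      fix l assume "l \<in> {1..n}"
      then have "s ^ n = s ^ l * s ^ (n - l)" by (simp flip: power_add)
      then show "s ^ n * (16 ^ l * f l * int (m ^ (n - l) * K_number (n - l))) = (16 * s) ^ l * (q (n - l) * f l)"
        unfolding q_def power_mult_distrib by (simp only: mult_ac)
    qed simp
    also have "[\<dots> = (\<Sum>l=1..n. 1 ^ l * (q (n - l) * f l))] (mod M)"
      by (intro cong_sum cong_mult cong_pow s cong_refl)
    finally show ?thesis by (simp add: cong_sym_eq)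
  qed
  \<comment> \<open>The coefficient \<open>q 0 = 1\<close> isolates \<open>f n\<close>. For
    \<open>n \<ge> J\<close> the terms with \<open>j \<ge> J\<close> vanish, and so does the
    inhomogeneous term \<open>4mn q n\<close>.\<close>
  have rec': "[f n = (\<Sum>j\<in>{1..<J}. (- q j) * f (n - j))] (mod M)" if n: "n \<ge> J" for n
  proof -
    have n1: "n \<ge> 1" using n M by simp
    have "(\<Sum>l=1..n. q (n - l) * f l) = (\<Sum>j\<in>{0..<n}. q j * f (n - j))"
      by (rule sum.reindex_bij_witness[of _ "\<lambda>j. n - j" "\<lambda>l. n - l"]) auto
    also have "\<dots> = (\<Sum>j\<in>{0..<J}. q j * f (n - j)) + (\<Sum>j\<in>{J..<n}. q j * f (n - j))"
      using n by (simp add: sum.atLeastLessThan_concat)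
    also have "(\<Sum>j\<in>{0..<J}. q j * f (n - j)) = f n + (\<Sum>j\<in>{1..<J}. q j * f (n - j))"
      using M(2) q0 by (simp add: sum.atLeast_Suc_lessThan)
    finally have e: "f n = (\<Sum>l=1..n. q (n - l) * f l) - (\<Sum>j\<in>{1..<J}. q j * f (n - j)) - (\<Sum>j\<in>{J..<n}. q j * f (n - j))"
      by simp
    have "[(\<Sum>j\<in>{J..<n}. q j * f (n - j)) = (\<Sum>j\<in>{J..<n}. 0 * f (n - j))] (mod M)"
      using q_zero by (intro cong_sum cong_mult cong_refl) auto
    moreover have "[(\<Sum>l=1..n. q (n - l) * f l) = int (4 * m * n) * 0] (mod M)"
      by (rule cong_trans[OF rec[OF n1] cong_mult[OF cong_refl q_zero[OF n]]])
    ultimately have "[f n = 0 - (\<Sum>j\<in>{1..<J}. q j * f (n - j)) - 0] (mod M)"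
      unfolding e by (intro cong_diff cong_refl) simp_all
    then show ?thesis by (simp add: sum_negf)
  qed
  have "\<exists>N\<ge>1. \<exists>\<omega>\<ge>1. \<forall>l\<ge>N. [f (l + \<omega>) = f l] (mod M)"
    using linear_recurrence_mod_periodic[OF M(1) rec'] .
  then have periodic: "\<exists>N\<ge>1. \<exists>\<omega>\<ge>1. \<forall>l\<ge>N. [free_subgroup_number m (l + \<omega>) = free_subgroup_number m l] (mod p ^ \<alpha>)"
    unfolding f_def M(3) J_def cong_int_iff .
  \<comment> \<open>The denominator is the generating function of \<open>q\<close> cut off at
    \<open>J\<close>.\<close>
  define Q where "Q = Poly (map q [0..<J])"
  have Q: "coeff Q j = (if j < J then q j else 0)" for j
    by (simp add: Q_def nth_default_def)
  \<comment> \<open>The series has constant term 1 by convention, whereas \<open>f 0\<close> carries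
    no meaning.\<close>
  define g where "g l = (if l = 0 then 1 else f l)" for l
  have prod: "fps_nth (fps_of_poly Q * free_subgroup_series m) n = (\<Sum>j=0..n. coeff Q j * g (n - j))" for n
    by (simp add: fps_mult_nth free_subgroup_series_def g_def f_def cong: if_cong)
  have tail: "[fps_nth (fps_of_poly Q * free_subgroup_series m) n = 0] (mod M)" if n: "n \<ge> J" for n
  proof -
    \<comment> \<open>Since \<open>n \<ge> J\<close>, an index \<open>j < J\<close> leaves
      \<open>n - j \<ge> 1\<close>, so the conventional constant term is not met.\<close>
    have "(\<Sum>j=0..n. coeff Q j * g (n - j)) = (\<Sum>j\<in>{0..<J}. q j * f (n - j))"
    proof (rule sum.mono_neutral_cong_right)
      show "{0..<J} \<subseteq> {0..n}" using n by auto
    qed (use n in \<open>auto simp: Q g_def\<close>)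
    also have "\<dots> = f n - (\<Sum>j\<in>{1..<J}. (- q j) * f (n - j))"
      using M(2) q0 by (simp add: sum.atLeast_Suc_lessThan sum_negf)
    finally show ?thesis using rec'[OF n] unfolding prod by (simp add: cong_diff_iff_cong_0)
  qed
  \<comment> \<open>The product vanishes modulo \<open>M\<close> from \<open>J\<close> on, so
    cutting it off there gives the numerator.\<close>
  define P where "P = Poly (map (fps_nth (fps_of_poly Q * free_subgroup_series m)) [0..<J])"
  have P: "coeff P n = (if n < J then fps_nth (fps_of_poly Q * free_subgroup_series m) n else 0)" for n
    by (simp add: P_def nth_default_def)
  have "coeff Q 0 = 1" using Q[of 0] M(2) q0 by simp
  moreover have "[fps_nth (fps_of_poly Q * free_subgroup_series m) n = coeff P n] (mod int p ^ \<alpha>)" for n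
    using tail[of n] unfolding P by (auto simp: M_def)
  ultimately show ?thesis using periodic by blast
qed

end
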